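(* For $n\geq 3$, the Temperley--Lieb monoid $\mathcal{TL}_n$ satisfies $$\deg'(\mathcal{TL}_n)=|Q|\qquad\text{and}\qquad\deg(\mathcal{TL}_n)=\deg_{\mathrm{rc}}(\mathcal{TL}_n)=1+|Q|,$$ where $$Q=\begin{cases}P_0\cup P_2\cup P_4&\text{if $n$ is even}\\ P_1\cup P_3&\text{if $n$ is odd,}\end{cases}$$ and $P_r=\{\varepsilon\in P(\mathcal{TL}_n):\operatorname{rank}(\varepsilon)=r\}$ is the set of projections of $\mathcal{TL}_n$ of rank $r$.
   Context: Diagram monoids. For an integer $n\ge 0$ let $\mathbf n=\{1,\dots,n\}$ and $\mathbf n'=\{1',\dots,n'\}$. The partition monoid $\mathcal P_n$ is the set of all set partitions of $\mathbf n\cup\mathbf n'$. Product of $\alpha,\beta\in\mathcal P_n$: with $\mathbf n''=\{1'',\dots,n''\}$, rename each $x'$ in $\alpha$ as $x''$ and each (unprimed) $x$ in $\beta$ as $x''$; consider the equivalence on $\mathbf n\cup\mathbf n''\cup\mathbf n'$ generated by the blocks of these two renamed partitions; $x,y\in\mathbf n\cup\mathbf n'$ are in the same block of $\alpha\beta$ iff they are related by this equivalence. This is a monoid with identity the partition with blocks $\{x,x'\}$. $\alpha^*$ is obtained from $\alpha$ by interchanging $x$ and $x'$ for all $x$. A transversal of $\alpha$ is a block meeting both $\mathbf n$ and $\mathbf n'$; $\operatorname{rank}(\alpha)$ is the number of transversals. $\alpha$ is planar if it can be drawn by a graph, whose connected components are the blocks, with vertices $1,\dots,n$ in order on an upper row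 and $1',\dots,n'$ in order on a lower row, with all edges inside the rectangle spanned by the vertices and with no crossings (equivalently, $\alpha$ is a non-crossing partition for the cyclic order $1,\dots,n,n',\dots,1'$). $\mathcal{TL}_n$ is the submonoid of $\mathcal P_n$ of all planar partitions all of whose blocks have size exactly $2$. $P(\mathcal{TL}_n)=\{\varepsilon\in \mathcal{TL}_n:\varepsilon^2=\varepsilon=\varepsilon^*\}$ is its set of projections. Degrees. $\mathcal T_m$ (resp. $\mathcal{PT}_m$) is the monoid of all maps (resp. partial maps) from $\{1,\dots,m\}$ to itself, composed left to right. For a finite semigroup $S$: $\deg(S)=\min\{m\ge1: S\text{ embeds in }\mathcal T_m\}$ and $\deg'(S)=\min\{m\geq1:S\text{ embeds in }\mathcal{PT}_m\}$, embeddings being injective semigroup homomorphisms. A right congruence $\sigma$ on $S$ is an equivalence with $(a,b)\in\sigma\Rightarrow(as,bs)\in\sigma$ for all $s \in S$; it gives a right action of $S$ on $S/\sigma$ by $([x]_\sigma,a)\mapsto[xa]_\sigma$, of degree $|S/\sigma|$. An action of $S$ on $X$ is faithful if distinct elements of $S$ induce distinct maps $X\to X$. $\deg_{\mathrm{rc}}(S)$ is the minimum of $|S/\sigma|$ over right congruences $\sigma$ whose associated action is faithful. *)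

theory Defs
  imports "HOL-Algebra.Group" "HOL-Library.Disjoint_Sets"
begin

text \<open>\<open>Up x\<close>, \<open>Low x\<close> and \<open>Mid x\<close> stand for \<open>x\<close>, \<open>x'\<close> and \<open>x''\<close>; partitions only involve
  the first two, \<open>Mid\<close> occurs only inside the definition of the product.\<close>

datatype vertex = Up nat | Low nat | Mid nat

definition vertices :: "nat \<Rightarrow> vertex set" where
  "vertices n = Up ` {1..n} \<union> Low ` {1..n}"

type_synonym diagram = "vertex set set"

fun lower_to_mid :: "vertex \<Rightarrow> vertex" where
  "lower_to_mid (Up x) = Up x"
| "lower_to_mid (Low x) = Mid x"
| "lower_to_mid (Mid x) = Mid x"

fun upper_to_mid :: "vertex \<Rightarrow> vertex" where
  "upper_to_mid (Up x) = Mid x"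
| "upper_to_mid (Low x) = Low x"
| "upper_to_mid (Mid x) = Mid x"

definition joined :: "diagram \<Rightarrow> diagram \<Rightarrow> vertex \<Rightarrow> vertex \<Rightarrow> bool" where
  "joined \<alpha> \<beta> = equivclp (\<lambda>x y. \<exists>B \<in> (image lower_to_mid) ` \<alpha> \<union> (image upper_to_mid) ` \<beta>. x \<in> B \<and> y \<in> B)"

definition diagram_mult :: "nat \<Rightarrow> diagram \<Rightarrow> diagram \<Rightarrow> diagram" where
  "diagram_mult n \<alpha> \<beta> =
     vertices n // {(x, y). x \<in> vertices n \<and> y \<in> vertices n \<and> joined \<alpha> \<beta> x y}"

definition partition_monoid :: "nat \<Rightarrow> diagram monoid" where
  "partition_monoid n =
     \<lparr>carrier = {\<alpha>. partition_on (vertices n) \<alpha>},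
      mult = diagram_mult n,
      one = (\<lambda>x. {Up x, Low x}) ` {1..n}\<rparr>"

fun swap_vertex :: "vertex \<Rightarrow> vertex" where
  "swap_vertex (Up x) = Low x"
| "swap_vertex (Low x) = Up x"
| "swap_vertex (Mid x) = Mid x"

definition diagram_star :: "diagram \<Rightarrow> diagram" where
  "diagram_star \<alpha> = (image swap_vertex) ` \<alpha>"

definition transversals :: "diagram \<Rightarrow> vertex set set" where
  "transversals \<alpha> = {B \<in> \<alpha>. B \<inter> range Up \<noteq> {} \<and> B \<inter> range Low \<noteq> {}}"

definition diagram_rank :: "diagram \<Rightarrow> nat" where
  "diagram_rank \<alpha> = card (transversals \<alpha>)"

text \<open>Position of a vertex in the boundary order \<open>1, \<dots>, n, n', \<dots>, 1'\<close> of the rectangle.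
  The value at \<open>Mid\<close> is irrelevant.\<close>

fun boundary_pos :: "nat \<Rightarrow> vertex \<Rightarrow> nat" where
  "boundary_pos n (Up x) = x"
| "boundary_pos n (Low x) = 2 * n + 1 - x"
| "boundary_pos n (Mid x) = 0"

text \<open>A partition can be drawn in the rectangle without crossings iff it is non-crossing for
  the cyclic boundary order; cutting the cycle into a linear order does not affect crossings.\<close>

definition planar :: "nat \<Rightarrow> diagram \<Rightarrow> bool" where
  "planar n \<alpha> \<longleftrightarrow>
     \<not> (\<exists>A\<in>\<alpha>. \<exists>B\<in>\<alpha>. A \<noteq> B \<and>
          (\<exists>a\<in>A. \<exists>b\<in>B. \<exists>c\<in>A. \<exists>d\<in>B.
             boundary_pos n a < boundary_pos n b \<and>
             boundary_pos n b < boundary_pos n c \<and>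
             boundary_pos n c < boundary_pos n d))"

definition temperley_lieb :: "nat \<Rightarrow> diagram monoid" where
  "temperley_lieb n = (partition_monoid n)
     \<lparr>carrier := {\<alpha> \<in> carrier (partition_monoid n). planar n \<alpha> \<and> (\<forall>B\<in>\<alpha>. card B = 2)}\<rparr>"

definition TL_projections :: "nat \<Rightarrow> diagram set" where
  "TL_projections n = {\<epsilon> \<in> carrier (temperley_lieb n).
     \<epsilon> \<otimes>\<^bsub>temperley_lieb n\<^esub> \<epsilon> = \<epsilon> \<and> diagram_star \<epsilon> = \<epsilon>}"

definition TL_projections_rank :: "nat \<Rightarrow> nat \<Rightarrow> diagram set" where
  "TL_projections_rank n r = {\<epsilon> \<in> TL_projections n. diagram_rank \<epsilon> = r}"

definition TL_Q :: "nat \<Rightarrow> diagram set" where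
  "TL_Q n = (if even n
     then TL_projections_rank n 0 \<union> TL_projections_rank n 2 \<union> TL_projections_rank n 4
     else TL_projections_rank n 1 \<union> TL_projections_rank n 3)"

text \<open>Maps are composed left to right: \<open>f \<otimes> g\<close> means first \<open>f\<close>, then \<open>g\<close>.\<close>

definition full_transformation_monoid :: "nat \<Rightarrow> (nat \<Rightarrow> nat) monoid" where
  "full_transformation_monoid m =
     \<lparr>carrier = {1..m} \<rightarrow>\<^sub>E {1..m},
      mult = (\<lambda>f g. compose {1..m} g f),
      one = restrict id {1..m}\<rparr>"

definition partial_transformation_monoid :: "nat \<Rightarrow> (nat \<rightharpoonup> nat) monoid" where
  "partial_transformation_monoid m =
     \<lparr>carrier = {f. dom f \<subseteq> {1..m} \<and> ran f \<subseteq> {1..m}},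
      mult = (\<lambda>f g. g \<circ>\<^sub>m f),
      one = Some |` {1..m}\<rparr>"

text \<open>Semigroups are represented by the record type of monoids, with the field \<open>one\<close> ignored.
  The set \<open>mon S T\<close> consists of the injective homomorphisms; they preserve multiplication
  but need not preserve the identity.\<close>

definition deg :: "('a, 'b) monoid_scheme \<Rightarrow> nat" where
  "deg S = (LEAST m. m \<ge> 1 \<and> mon S (full_transformation_monoid m) \<noteq> {})"

definition deg' :: "('a, 'b) monoid_scheme \<Rightarrow> nat" where
  "deg' S = (LEAST m. m \<ge> 1 \<and> mon S (partial_transformation_monoid m) \<noteq> {})"

definition right_congruence :: "('a, 'b) monoid_scheme \<Rightarrow> ('a \<times> 'a) set \<Rightarrow> bool" where
  "right_congruence S \<sigma> \<longleftrightarrow> equiv (carrier S) \<sigma> \<and>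
     (\<forall>a b s. (a, b) \<in> \<sigma> \<and> s \<in> carrier S \<longrightarrow> (a \<otimes>\<^bsub>S\<^esub> s, b \<otimes>\<^bsub>S\<^esub> s) \<in> \<sigma>)"

text \<open>The map induced by \<open>a\<close> on the set of classes. For a right congruence all members of the
  union coincide, so that the class of \<open>x\<close> is sent to the class of \<open>x \<otimes> a\<close>.\<close>

definition rc_action ::
    "('a, 'b) monoid_scheme \<Rightarrow> ('a \<times> 'a) set \<Rightarrow> 'a \<Rightarrow> 'a set \<Rightarrow> 'a set" where
  "rc_action S \<sigma> a = (\<lambda>X\<in>carrier S // \<sigma>. \<Union>x\<in>X. \<sigma> `` {x \<otimes>\<^bsub>S\<^esub> a})"

definition faithful_rc :: "('a, 'b) monoid_scheme \<Rightarrow> ('a \<times> 'a) set \<Rightarrow> bool" where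
  "faithful_rc S \<sigma> \<longleftrightarrow> inj_on (rc_action S \<sigma>) (carrier S)"

definition deg_rc :: "('a, 'b) monoid_scheme \<Rightarrow> nat" where
  "deg_rc S =
     (LEAST k. \<exists>\<sigma>. right_congruence S \<sigma> \<and> faithful_rc S \<sigma> \<and> card (carrier S // \<sigma>) = k)"

end

theory Submission
  imports Defs "HOL-Library.Infinite_Set"
begin

text \<open>An element \<open>x\<close> of the monoid is determined by its upper and lower half. Let \<open>m \<in> {0, 1}\<close> be the
  minimal rank, \<open>k = 4 - m\<close>, and fix a projection \<open>u\<close> of rank \<open>k\<close>. Its free ends can be closed in
  exactly two noncrossing ways, giving projections \<open>f1\<close> and \<open>f2\<close> of rank \<open>m\<close>. Everything rests on one
  combinatorial fact: distinct diagrams can be contracted, arc by arc between neighbouring points,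
  to distinct diagrams on four points, and for diagrams of rank \<open>r \<le> 4\<close> with the same lower half
  this can be done from above, leaving \<open>4 - r\<close> upper points.

  Upper bound: relate \<open>x\<close> and \<open>y\<close> if \<open>u x s = f1\<close> and \<open>u y s = f1\<close> for the same \<open>s\<close>. A class is given by
  the lower half of \<open>u x\<close>, of rank \<open>m\<close>, 2 or \<open>k\<close>, except for one absorbing class, which can be dropped
  for partial transformations. The contraction fact makes the action on the classes faithful.

  Lower bound: a partial action becomes a total one by adding a fixed point, so it suffices to find
  \<open>1 + |Q|\<close> points in any faithful total action. Points moved differently by two elements that have
  to be distinguished (two elements of minimal rank with the same upper or the same lower half; an
  element of rank 2 and its closure) have orbits on which, again by contraction, the lower halves of
  rank \<open>m\<close>, 2 and \<open>k\<close> give distinct points.\<close>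

section \<open>Noncrossing matchings and contractions\<close>

text \<open>The number four comes from counting noncrossing matchings: two points admit one, four
  points exactly two. So contraction of two different diagrams has to stop at four points, and there
  the difference is a choice between two known matchings. Splitting four as \<open>4 - r\<close>
  upper and \<open>r\<close> lower points leaves the pairs of ranks (m, k), (k, m) and, for even n,
  (2, 2); this is the origin of the ranks in Q. Rank 2 behaves differently because two free ends can
  be closed in one way only, so closing cannot tell upper halves of rank 2 apart. The delicate point
  is contraction from above alone: a careless choice can make the two diagrams equal, and an
  invariant stronger than being different has to be carried along. The algebra is done with
  relations between two-colourings of the upper and the lower row. Products become composition, the
  involution becomes converse, closed loops vanish by themselves, and associativity is inherited
  from relations.\<close>

definition matching_on :: "nat set \<Rightarrow> (nat \<Rightarrow> nat) \<Rightarrow> bool" where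
  "matching_on X f \<longleftrightarrow> finite X \<and> (\<forall>x\<in>X. f x \<in> X \<and> f (f x) = x \<and> f x \<noteq> x)"

definition nc_matching :: "nat set \<Rightarrow> (nat \<Rightarrow> nat) \<Rightarrow> bool" where
  "nc_matching X f \<longleftrightarrow> matching_on X f \<and> (\<forall>x\<in>X. \<forall>y\<in>X. \<not> (x < y \<and> y < f x \<and> f x < f y))"

definition consecutive :: "nat set \<Rightarrow> nat \<Rightarrow> nat \<Rightarrow> bool" where
  "consecutive X p q \<longleftrightarrow> p \<in> X \<and> q \<in> X \<and> p < q \<and> (\<forall>z\<in>X. \<not> (p < z \<and> z < q))"

text \<open>The effect of adding an outer arc from \<open>p\<close> to \<open>q\<close>; the guard
  is the case of a closed loop, which is discarded. The values at \<open>p\<close> and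
  \<open>q\<close> stay as they were, since both points leave the domain.\<close>

definition contract :: "nat \<Rightarrow> nat \<Rightarrow> (nat \<Rightarrow> nat) \<Rightarrow> nat \<Rightarrow> nat" where
  "contract p q f = (if f p = q then f else f(f p := f q, f q := f p))"

text \<open>Two-colourings constant on the arcs stand in for the equivalence closure in the product of
  diagrams: they determine the matching, and contracting an arc amounts to projecting them.\<close>

definition coloring :: "nat set \<Rightarrow> (nat \<Rightarrow> nat) \<Rightarrow> (nat \<Rightarrow> bool) \<Rightarrow> bool" where
  "coloring X f c \<longleftrightarrow> (\<forall>x\<in>X. c (f x) = c x)"

lemma matching_onD:
  assumes "matching_on X f" "x \<in> X"
  shows "f x \<in> X" "f (f x) = x" "f x \<noteq> x"
  using assms by (auto simp: matching_on_def)

lemma matching_on_inj: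
  assumes "matching_on X f" "x \<in> X" "y \<in> X" "f x = f y"
  shows "x = y"
  using assms by (metis matching_onD(2))

lemma matching_on_Diff:
  assumes "matching_on X f" "x \<in> X"
  shows "matching_on (X - {x, f x}) f"
proof -
  have "f y \<noteq> x \<and> f y \<noteq> f x" if "y \<in> X - {x, f x}" for y
    using that matching_on_inj[OF assms(1), of y x] matching_onD(2)[OF assms(1), of y] assms by auto
  then show ?thesis using assms by (simp add: matching_on_def)
qed

lemma even_card_matching:
  assumes "matching_on X f" shows "even (card X)"
  using assms
proof (induction "card X" arbitrary: X rule: less_induct)
  case less
  have fin: "finite X" using less.prems by (simp add: matching_on_def)
  show ?case
  proof (cases "X = {}")
    case False
    then obtain x where x: "x \<in> X" by blast
    note fx = matching_onD[OF less.prems x]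
    let ?Y = "X - {x, f x}"
    have "matching_on ?Y f"
      using matching_on_Diff[OF less.prems x] .
    moreover have c: "card X = card ?Y + 2"
    proof -
      have "card {x, f x} = 2" using fx by simp
      moreover have "card ?Y = card X - card {x, f x}" using fin fx x by (intro card_Diff_subset) auto
      moreover have "card {x, f x} \<le> card X" using fin fx x by (intro card_mono) auto
      ultimately show ?thesis by simp
    qed
    ultimately have "even (card ?Y)" using less.hyps[of ?Y] by simp
    then show ?thesis using c by simp
  qed simp
qed

lemma nc_matchingD:
  assumes "nc_matching X f" "x \<in> X" "y \<in> X" "x < y" "y < f x"
  shows "x < f y" "f y < f x"
proof -
  have m: "matching_on X f" using assms by (simp add: nc_matching_def)
  note fy = matching_onD[OF m assms(3)] and fx = matching_onD[OF m assms(2)]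
  have n: "\<And>x y. x \<in> X \<Longrightarrow> y \<in> X \<Longrightarrow> \<not> (x < y \<and> y < f x \<and> f x < f y)"
    using assms by (simp add: nc_matching_def)
  have "\<not> f x < f y" using n assms by blast
  moreover have "f x \<noteq> f y" using matching_on_inj[OF m assms(2,3)] assms by auto
  ultimately show "f y < f x" by simp
  have "f y \<noteq> x" using fy assms by auto
  moreover have "\<not> f y < x" using n[of "f y" x] fy assms by auto
  ultimately show "x < f y" by simp
qed

definition btw :: "nat \<Rightarrow> nat \<Rightarrow> nat \<Rightarrow> bool" where
  "btw s t z \<longleftrightarrow> s < z \<and> z < t \<or> t < z \<and> z < s"

text \<open>Noncrossing freed from the order of the ends of an arc, so that contraction needs no
  case split on it.\<close>

lemma nc_between:
  assumes "nc_matching X f" "y \<in> X" "z \<in> X" "z \<noteq> y" "z \<noteq> f y"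
  shows "btw y (f y) (f z) = btw y (f y) z"
proof -
  have m: "matching_on X f" using assms by (simp add: nc_matching_def)
  note fy = matching_onD[OF m assms(2)] and fz = matching_onD[OF m assms(3)]
  have "btw y (f y) (f z)" if "z \<in> X" "btw y (f y) z" for z
    using nc_matchingD[OF assms(1,2) that(1)] nc_matchingD[OF assms(1) fy(1) that(1)] fy that(2)
    by (auto simp: btw_def)
  from this[of z] this[of "f z"] show ?thesis using assms fz by auto
qed

lemma contract_other:
  assumes "matching_on X f" "x \<in> X" "x \<noteq> f p" "x \<noteq> f q"
  shows "contract p q f x = f x"
  using assms by (simp add: contract_def)

lemma contract_partner:
  assumes "matching_on X f" "p \<in> X" "q \<in> X" "p \<noteq> q" "f p \<noteq> q"
  shows "contract p q f (f p) = f q" "contract p q f (f q) = f p"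
  using assms matching_on_inj[of X f p q] by (auto simp: contract_def)

text \<open>Neighbours come in increasing order, but later arguments single out one of them by its
  partner; this lets the roles be exchanged.\<close>

lemma contract_commute:
  assumes "matching_on X f" "p \<in> X" "q \<in> X" "p \<noteq> q"
  shows "contract p q f = contract q p f"
proof -
  have "f p = q \<longleftrightarrow> f q = p" "f p \<noteq> f q"
    using assms matching_onD[OF assms(1)] matching_on_inj[OF assms(1)] by metis+
  then show ?thesis by (auto simp: contract_def fun_upd_twist)
qed

lemma matching_contract:
  assumes "matching_on X f" "p \<in> X" "q \<in> X" "p \<noteq> q"
  shows "matching_on (X - {p, q}) (contract p q f)"
proof -
  note m = matching_onD[OF assms(1)] and inj = matching_on_inj[OF assms(1)]
  have fin: "finite X" using assms by (simp add: matching_on_def)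
  have "contract p q f x \<in> X - {p, q} \<and> contract p q f (contract p q f x) = x \<and> contract p q f x \<noteq> x"
    if x: "x \<in> X - {p, q}" for x
  proof (cases "f p = q")
    case True
    then have "contract p q f = f" by (simp add: contract_def)
    then show ?thesis using matching_onD[OF matching_on_Diff[OF assms(1,2)]] x True by auto
  next
    case False
    have ne: "f q \<noteq> p" "f p \<noteq> f q" "f p \<noteq> p" "f q \<noteq> q" "f p \<in> X" "f q \<in> X"
      using m(2,3)[of p] m(2,3)[of q] m(1) inj[of p q] False assms by auto
    show ?thesis
    proof (cases "x = f p \<or> x = f q")
      case True
      then show ?thesis
        using contract_partner[OF assms False] ne False by (elim disjE) simp_all
    next
      case F2: False
      have "x \<in> X" using x by simp
      then have fx: "f x \<noteq> p" "f x \<noteq> q" "f x \<noteq> f p" "f x \<noteq> f q"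
        using F2 m(2)[of x] inj[of x p] inj[of x q] x assms by auto
      moreover have "contract p q f x = f x" "contract p q f (f x) = f (f x)"
        using F2 fx m(1)[of x] \<open>x \<in> X\<close> by (auto intro!: contract_other[OF assms(1)])
      ultimately show ?thesis using m[of x] \<open>x \<in> X\<close> by auto
    qed
  qed
  then show ?thesis using fin by (simp add: matching_on_def)
qed

text \<open>Nothing lies between the neighbours \<open>p\<close> and \<open>q\<close>, so any other
  arc has both of them on the same side, and hence both of their partners. The new arc between the
  partners therefore crosses nothing.\<close>

lemma nc_contract:
  assumes "nc_matching X f" "consecutive X p q"
  shows "nc_matching (X - {p, q}) (contract p q f)"
proof -
  have m: "matching_on X f" using assms by (simp add: nc_matching_def)
  have pq: "p \<in> X" "q \<in> X" "p < q" using assms by (auto simp: consecutive_def)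
  have near: "z < p \<longleftrightarrow> z < q" "p < z \<longleftrightarrow> q < z" if "z \<in> X - {p, q}" for z
    using assms(2) that by (auto simp: consecutive_def) 
  have mc: "matching_on (X - {p, q}) (contract p q f)"
    using matching_contract[OF m] pq by auto
  have n: "\<And>x y. x \<in> X \<Longrightarrow> y \<in> X \<Longrightarrow> \<not> (x < y \<and> y < f x \<and> f x < f y)"
    using assms by (simp add: nc_matching_def)
  show ?thesis
  proof (cases "f p = q")
    case True
    then show ?thesis using mc n by (simp add: nc_matching_def contract_def)
  next
    case False
    let ?g = "contract p q f"
    have F: "f p \<in> X" "f q \<in> X" "f (f p) = p" "f (f q) = q" "f p \<noteq> f q" "f q \<noteq> p" "f p \<noteq> p" "f q \<noteq> q"
      using matching_onD[OF m pq(1)] matching_onD[OF m pq(2)] False pq by auto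
    have g: "?g (f p) = f q" "?g (f q) = f p"
      using contract_partner[OF m pq(1,2)] pq False by auto
    have go: "?g z = f z" "f z \<in> X - {p, q}" "f (f z) = z"
      if "z \<in> X - {p, q}" "z \<noteq> f p" "z \<noteq> f q" for z
      using that contract_other[OF m, of z p q] matching_onD[OF m, of z] by auto
    have same: "btw y (f y) (f q) = btw y (f y) (f p)"
      if "y \<in> X - {p, q}" "y \<noteq> f p" "y \<noteq> f q" for y
    proof -
      note gy = go[OF that]
      have "btw y (f y) (f q) = btw y (f y) q" "btw y (f y) (f p) = btw y (f y) p"
        using nc_between[OF assms(1), of y q] nc_between[OF assms(1), of y p] that pq gy by auto
      moreover have "btw y (f y) q = btw y (f y) p"
        using near[OF that(1)] near[OF gy(2)] by (auto simp: btw_def)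
      ultimately show ?thesis by simp
    qed
    have "\<not> (x < y \<and> y < ?g x \<and> ?g x < ?g y)" if x: "x \<in> X - {p, q}" and y: "y \<in> X - {p, q}" for x y
    proof
      assume A: "x < y \<and> y < ?g x \<and> ?g x < ?g y"
      have FX: "f p \<in> X - {p,q}" "f q \<in> X - {p,q}" using F False by auto
      consider "x \<noteq> f p" "x \<noteq> f q" "y \<noteq> f p" "y \<noteq> f q" | "x = f p \<or> x = f q" "y = f p \<or> y = f q"
        | "x = f p \<or> x = f q" "y \<noteq> f p" "y \<noteq> f q" | "x \<noteq> f p" "x \<noteq> f q" "y = f p \<or> y = f q"
        by blast
      then show False
      proof cases
        case 1
        then show ?thesis using A go(1)[OF x] go(1)[OF y] x y n[of x y] by simp
      next
        case 2
        then show ?thesis using A g by auto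
      next
        case 3
        then have "btw y (f y) (f q) = btw y (f y) (f p)" using same[OF y] by simp
        then show ?thesis using A 3 g go[OF y 3(2,3)] by (auto simp: btw_def)
      next
        case 4
        then have "btw x (f x) (f q) = btw x (f x) (f p)" using same[OF x] by simp
        then show ?thesis using A 4 g go[OF x 4(1,2)] by (auto simp: btw_def)
      qed
    qed
    then show ?thesis using mc by (simp add: nc_matching_def)
  qed
qed

text \<open>Adding an arc means demanding equal colours at \<open>p\<close> and \<open>q\<close>;
  deleting the two points means quantifying their colours away.\<close>

lemma coloring_contract:
  assumes "matching_on X f" "p \<in> X" "q \<in> X" "p \<noteq> q"
  shows "coloring (X - {p, q}) (contract p q f) c \<longleftrightarrow>
    (\<exists>c'. (\<forall>x\<in>X - {p, q}. c' x = c x) \<and> coloring X f c' \<and> c' p = c' q)"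
proof
  note m = matching_onD[OF assms(1)] and inj = matching_on_inj[OF assms(1)]
  have mc: "matching_on (X - {p, q}) (contract p q f)" using matching_contract[OF assms] .
  {
    assume r: "coloring (X - {p, q}) (contract p q f) c"
    show "\<exists>c'. (\<forall>x\<in>X - {p, q}. c' x = c x) \<and> coloring X f c' \<and> c' p = c' q"
    proof (cases "f p = q")
      case True
      then have fq: "f q = p" using m assms by metis
      \<comment> \<open>A closed loop may take any colour.\<close>
      have "coloring X f (c(p := True, q := True))"
        unfolding coloring_def
      proof
        fix x assume x: "x \<in> X"
        show "(c(p := True, q := True)) (f x) = (c(p := True, q := True)) x"
        proof (cases "x \<in> {p, q}")
          case F: False
          then have "f x \<notin> {p, q}" using matching_onD(1)[OF matching_on_Diff[OF assms(1,2)], of x] True x by auto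
          then show ?thesis using F r x True by (auto simp: coloring_def contract_def)
        qed (use True fq in auto)
      qed
      then show ?thesis by (intro exI[of _ "c(p := True, q := True)"]) auto
    next
      case False
      \<comment> \<open>The partners are joined after the contraction, so they share a colour;
        \<open>p\<close> and \<open>q\<close> take it over.\<close>
      let ?c = "c(p := c (f p), q := c (f p))"
      have ne: "f q \<noteq> p" "f p \<noteq> f q" "f p \<in> X" "f q \<in> X" "f (f p) = p" "f (f q) = q" "f p \<noteq> p" "f q \<noteq> q"
        using m(2,3)[of p] m(2,3)[of q] m(1) inj[of p q] False assms by auto
      have fpq: "c (f p) = c (f q)" 
      proof -
        have "contract p q f (f p) = f q" using contract_partner[OF assms False] by simp
        moreover have "f p \<in> X - {p, q}" using ne False by auto
        ultimately show ?thesis using r unfolding coloring_def by metis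
      qed
      have "coloring X f ?c"
        unfolding coloring_def
      proof
        fix x assume x: "x \<in> X"
        show "?c (f x) = ?c x"
        proof (cases "x \<in> {p, q, f p, f q}")
          case True
          then show ?thesis using ne fpq False assms(4) by auto
        next
          case F: False
          then have "f x \<noteq> p" "f x \<noteq> q" using m(2)[OF x] by auto
          moreover have "contract p q f x = f x" using F contract_other[OF assms(1) x] by auto
          moreover have "c (contract p q f x) = c x" using r x F by (simp add: coloring_def)
          ultimately show ?thesis using F by simp
        qed
      qed
      then show ?thesis by (intro exI[of _ ?c]) auto
    qed
  }
  assume "\<exists>c'. (\<forall>x\<in>X - {p, q}. c' x = c x) \<and> coloring X f c' \<and> c' p = c' q"
  then obtain c' where c': "\<And>x. x \<in> X - {p, q} \<Longrightarrow> c' x = c x" "coloring X f c'" "c' p = c' q" by blast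
  have "c' (contract p q f x) = c' x" if x: "x \<in> X - {p, q}" for x
  proof (cases "f p = q")
    case True
    then show ?thesis using c' x by (simp add: contract_def coloring_def)
  next
    case False
    have "c' (f p) = c' (f q)" using c' assms by (simp add: coloring_def)
    then show ?thesis
      using contract_partner[OF assms False] contract_other[OF assms(1), of x p q] c' x
      by (cases "x = f p \<or> x = f q") (auto simp: coloring_def)
  qed
  then show "coloring (X - {p, q}) (contract p q f) c"
    unfolding coloring_def using c'(1) matching_onD(1)[OF mc] by metis
qed

text \<open>The indicator of a single arc of \<open>f\<close> is a colouring, so one inclusion
  between the sets of colourings already suffices.\<close>

lemma matching_eqI:
  assumes "matching_on X f" "matching_on X g" "\<And>c. coloring X f c \<Longrightarrow> coloring X g c" "x \<in> X"
  shows "f x = g x"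
proof -
  let ?c = "\<lambda>z. z = x \<or> z = f x"
  have "?c (f y) = ?c y" if "y \<in> X" for y
    using matching_onD[OF assms(1)] that assms(4) by metis
  then have "coloring X f ?c" by (simp add: coloring_def)
  then have "coloring X g ?c" by (rule assms(3))
  then have "?c (g x) = ?c x" using assms(4) unfolding coloring_def by (rule bspec)
  then show ?thesis using matching_onD[OF assms(2,4)] by auto
qed

section \<open>Neighbours that can be contracted while two matchings stay different\<close>

text \<open>A discrete intermediate value theorem. Later \<open>P\<close> is often agreement of two
  matchings at a point.\<close>

lemma consecutive_commonE:
  assumes "x \<in> V" "y \<in> V" "P x" "\<not> P y"
  obtains p q where "consecutive V p q" "P p \<noteq> P q"
proof -
  have "\<exists>p q. consecutive V p q \<and> P p \<noteq> P q" if "x \<in> V" "y \<in> V" "x < y" "P x \<noteq> P y" for x y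
    using that
  proof (induction "y - x" arbitrary: x y rule: less_induct)
    case less
    show ?case
    proof (cases "consecutive V x y")
      case False
      then obtain z where z: "z \<in> V" "x < z" "z < y" using less.prems by (auto simp: consecutive_def)
      then have "P x \<noteq> P z \<or> P z \<noteq> P y" using less.prems by auto
      moreover have "z - x < y - x" "y - z < y - x" using z by auto
      ultimately show ?thesis using less.hyps[of z x] less.hyps[of y z] z less.prems by blast
    qed (use less.prems in blast)
  qed
  then show ?thesis using that assms by (metis linorder_neqE_nat)
qed

text \<open>Descent on the length of an arc: points under an arc are joined under it, so a shortest
  arc inside the convex set \<open>V\<close> joins neighbours of the whole of
  \<open>X\<close>.\<close>

lemma innermost_arcE:
  assumes nc: "nc_matching X f" and conv: "\<And>x y z. x \<in> V \<Longrightarrow> y \<in> V \<Longrightarrow> z \<in> X \<Longrightarrow> x < z \<Longrightarrow> z < y \<Longrightarrow> z \<in> V"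
    and VX: "V \<subseteq> X" and x: "x \<in> V" "f x \<in> V"
  obtains p q where "consecutive X p q" "p \<in> V" "q \<in> V" "f p = q"
proof -
  have m: "matching_on X f" using nc by (simp add: nc_matching_def)
  have *: "\<exists>p q. consecutive X p q \<and> p \<in> V \<and> q \<in> V \<and> f p = q" if "x \<in> V" "f x \<in> V" "x < f x" for x
    using that
  proof (induction "f x - x" arbitrary: x rule: less_induct)
    case less
    show ?case
    proof (cases "consecutive X x (f x)")
      case False
      then obtain z where z: "z \<in> X" "x < z" "z < f x" using less.prems VX by (auto simp: consecutive_def)
      have fz: "x < f z" "f z < f x" "f z \<in> X" "f (f z) = z" "f z \<noteq> z"
        using nc_matchingD[OF nc _ z(1) z(2,3)] matching_onD[OF m z(1)] less.prems VX by auto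
      have V: "z \<in> V" "f z \<in> V" using conv[OF less.prems(1,2)] z fz by auto
      show ?thesis
      proof (cases "z < f z")
        case True
        then show ?thesis using less.hyps[of z] V fz z by simp
      next
        case F: False
        then show ?thesis using less.hyps[of "f z"] V fz z by simp
      qed
    qed (use less.prems in blast)
  qed
  have "x < f x \<or> f x < f (f x)" "f (f x) = x" using matching_onD[OF m] x VX by (auto simp: neq_iff subset_iff)
  then have "\<exists>p q. consecutive X p q \<and> p \<in> V \<and> q \<in> V \<and> f p = q" using *[of x] *[of "f x"] x by auto
  then show ?thesis using that by blast
qed

text \<open>A noncrossing matching all of whose arcs join the two halves is order reversing, so unique.\<close>

lemma transversal_matching_unique:
  assumes a: "nc_matching X a" and b: "nc_matching X b"
    and ta: "\<And>x. x \<in> X \<Longrightarrow> (a x \<le> n) = (n < x)" and tb: "\<And>x. x \<in> X \<Longrightarrow> (b x \<le> n) = (n < x)"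
    and x: "x \<in> X"
  shows "a x = b x"
proof (rule ccontr)
  assume ne: "a x \<noteq> b x"
  have ma: "matching_on X a" and mb: "matching_on X b" using a b by (auto simp: nc_matching_def)
  let ?P = "\<lambda>w. w \<in> X \<and> n < w \<and> a w \<noteq> b w"
  have "\<exists>w. ?P w"
  proof (cases "n < x")
    case False
    then have "n < a x" using ta x by (metis leI)
    moreover have "b (a x) \<noteq> x" using ne matching_onD[OF mb] matching_onD[OF ma] x by metis
    ultimately show ?thesis using matching_onD[OF ma x] by metis
  qed (use ne x in blast)
  then obtain w where w: "w \<in> X" "n < w" "a w \<noteq> b w"
    and least: "\<And>v. v < w \<Longrightarrow> v \<in> X \<Longrightarrow> n < v \<Longrightarrow> a v = b v"
    using exists_least_iff[of ?P] by blast
  \<comment> \<open>The arc of \<open>a\<close> at \<open>w\<close> passes over \<open>b w\<close>,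
    so the \<open>a\<close>-partner of \<open>b w\<close> lies beyond \<open>n\<close> but before
    \<open>w\<close>. There both matchings agree, which forces that partner to be \<open>w\<close>
    itself.\<close>
  have *: False if a: "nc_matching X a" and b: "nc_matching X b"
    and ta: "\<And>x. x \<in> X \<Longrightarrow> (a x \<le> n) = (n < x)" and tb: "\<And>x. x \<in> X \<Longrightarrow> (b x \<le> n) = (n < x)"
    and w: "w \<in> X" "n < w" and lt: "a w < b w" 
    and least: "\<And>v. v < w \<Longrightarrow> v \<in> X \<Longrightarrow> n < v \<Longrightarrow> a v = b v" for a b w
  proof -
    have ma: "matching_on X a" and mb: "matching_on X b" using a b by (auto simp: nc_matching_def)
    let ?z = "b w"
    have z: "?z \<in> X" "?z \<le> n" using matching_onD[OF mb w(1)] tb[OF w(1)] w by auto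
    have "a (a w) = w" "a w \<in> X" using matching_onD[OF ma w(1)] by auto
    then have "a ?z < w" using nc_matchingD(2)[OF a, of "a w" ?z] z lt w by auto
    moreover have "n < a ?z" "a ?z \<in> X" using ta[OF z(1)] z matching_onD[OF ma z(1)] by auto
    ultimately have "b (a ?z) = a (a ?z)" using least by metis
    then have "b (a ?z) = b w" using matching_onD[OF ma z(1)] by simp
    then have "a ?z = w" using matching_on_inj[OF mb] \<open>a ?z \<in> X\<close> w by blast
    then show False using \<open>a ?z < w\<close> by simp
  qed
  show False
  proof (cases "a w < b w")
    case True
    show False by (rule *[OF a b ta tb w(1,2) True least])
  next
    case False
    then have "b w < a w" using w by simp
    show False by (rule *[OF b a tb ta w(1,2) \<open>b w < a w\<close> least[symmetric]])
  qed
qed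

lemma contract_neq_common:
  assumes a: "matching_on X a" and b: "matching_on X b" and pq: "p \<in> X" "q \<in> X" "p \<noteq> q"
    and "a p = b p" "a q \<noteq> b q"
  shows "a p \<in> X - {p, q}" "contract p q a (a p) = a q" "contract p q b (a p) = b q"
proof -
  have "a p \<noteq> q" "b p \<noteq> q" using assms matching_onD by metis+
  then show "a p \<in> X - {p, q}" "contract p q a (a p) = a q" "contract p q b (a p) = b q"
    using contract_partner[OF a pq] contract_partner[OF b pq] matching_onD[OF a pq(1)] assms by auto
qed

lemma contract_neq_common':
  assumes a: "matching_on X a" and b: "matching_on X b" and pq: "p \<in> X" "q \<in> X" "p \<noteq> q"
    and ne: "(a p = b p) \<noteq> (a q = b q)"
  shows "\<exists>x\<in>X - {p, q}. contract p q a x \<noteq> contract p q b x"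
proof (cases "a p = b p")
  case True
  then have "a q \<noteq> b q" using ne by simp
  then show ?thesis using contract_neq_common[OF a b pq True] by (intro bexI[of _ "a p"]) (auto simp: True)
next
  case False
  then have "a q = b q" using ne by simp
  then show ?thesis
    unfolding contract_commute[OF a pq] contract_commute[OF b pq]
    using contract_neq_common[OF a b pq(2,1) pq(3)[symmetric] _ False] False
    by (intro bexI[of _ "a q"]) auto
qed

lemma contract_arc:
  assumes "f p = q" shows "contract p q f = f"
  using assms by (simp add: contract_def)

lemma contract_eq_common:
  assumes "matching_on X b" "a p = q" "\<And>x. x \<in> X - {p, q} \<Longrightarrow> contract p q a x = contract p q b x"
    "x \<in> X - {p, q, b p, b q}"
  shows "a x = b x"
proof -
  have "contract p q a x = a x" using assms by (simp add: contract_arc)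
  moreover have "contract p q b x = b x" using contract_other[OF assms(1)] assms(4) by auto
  ultimately show ?thesis using assms by auto
qed

text \<open>Call a point common if \<open>a\<close> and \<open>b\<close> agree there. If one side of
  the cut at \<open>n\<close> has both common and other points, contracting two neighbours of
  different kind gives the partner of the common one two different new partners. Otherwise either a
  common arc on the side away from \<open>x0\<close> is contracted, or nothing is common and an arc
  inside one side is contracted: this touches only \<open>p\<close>, \<open>q\<close> and their
  partners, so six points leave a witness.\<close>

lemma contract_step:
  assumes a: "nc_matching X a" and b: "nc_matching X b"
    and ne: "x0 \<in> X" "a x0 \<noteq> b x0" and card: "card X \<ge> 6"
  shows "\<exists>p q. consecutive X p q \<and> (p \<le> n \<longleftrightarrow> q \<le> n) \<and>
    (\<exists>x\<in>X - {p, q}. contract p q a x \<noteq> contract p q b x)"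
proof -
  have ma: "matching_on X a" and mb: "matching_on X b" using a b by (auto simp: nc_matching_def)
  let ?C = "\<lambda>x. a x = b x"
  let ?side = "\<lambda>s. {x \<in> X. (x \<le> n) = s}"
  have side_cons: "consecutive X p q" if "consecutive (?side s) p q" for p q s
    using that by (auto simp: consecutive_def)
  have mixed: ?thesis if xy: "x \<in> X" "y \<in> X" "(x \<le> n) = (y \<le> n)" "?C x" "\<not> ?C y" for x y
  proof -
    let ?V = "?side (x \<le> n)"
    obtain p q where pq: "consecutive ?V p q" "?C p \<noteq> ?C q"
      by (rule consecutive_commonE[of x ?V y ?C]) (use xy in auto)
    then have "p \<in> X" "q \<in> X" "p \<noteq> q" "(p \<le> n) = (q \<le> n)" by (auto simp: consecutive_def)
    then show ?thesis using contract_neq_common'[OF ma mb _ _ _ pq(2)] side_cons[OF pq(1)] by blast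
  qed
  have arc: "\<exists>p q. consecutive X p q \<and> (p \<le> n) = s \<and> (q \<le> n) = s \<and> f p = q"
    if f: "nc_matching X f" "x \<in> X" "(x \<le> n) = s" "(f x \<le> n) = s" for f x s
  proof -
    have fX: "f x \<in> X" using f matching_onD by (auto simp: nc_matching_def)
    obtain p q where "consecutive X p q" "p \<in> ?side s" "q \<in> ?side s" "f p = q"
      by (rule innermost_arcE[OF f(1), of "?side s" x]) (use f fX in auto)
    then show ?thesis by auto
  qed
  show ?thesis
  proof (cases "\<exists>x\<in>X. ?C x")
    case True
    then obtain v where v: "v \<in> X" "?C v" by blast
    show ?thesis
    proof (cases "(v \<le> n) = (x0 \<le> n)")
      case True
      then show ?thesis using mixed v ne by blast
    next
      case F: False
      have av: "a v \<in> X" "?C (a v)" using matching_onD[OF ma v(1)] matching_onD[OF mb v(1)] v(2) by auto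
      show ?thesis
      proof (cases "(a v \<le> n) = (x0 \<le> n)")
        case True
        then show ?thesis using mixed av ne by blast
      next
        case F2: False
        then obtain p q where pq: "consecutive X p q" "(p \<le> n) = (v \<le> n)" "(q \<le> n) = (v \<le> n)" "a p = q"
          using arc[OF a v(1), of "v \<le> n"] F by auto
        show ?thesis
        proof (cases "?C p")
          case True
          then have "contract p q a x0 = a x0" "contract p q b x0 = b x0" using pq by (auto simp: contract_arc)
          moreover have "x0 \<in> X - {p, q}" using ne(1) F pq by auto
          ultimately have "\<exists>x\<in>X - {p, q}. contract p q a x \<noteq> contract p q b x"
            using ne by (intro bexI[of _ x0]) auto
          then show ?thesis using pq(1-3) by blast
        next
          case False
          then show ?thesis using mixed[OF v(1) _ _ v(2), of p] pq by (auto simp: consecutive_def)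
        qed
      qed
    qed
  next
    case none: False
    have fin: "finite X" using ma by (simp add: matching_on_def)
    \<comment> \<open>Stated for \<open>f\<close> and \<open>g\<close> so that it serves both orders
      of \<open>a\<close> and \<open>b\<close>.\<close>
    have step: ?thesis if fg: "nc_matching X f" "nc_matching X g" "\<And>x. x \<in> X \<Longrightarrow> f x \<noteq> g x"
      "x \<in> X" "(x \<le> n) = (f x \<le> n)" "\<And>p q x. contract p q f x \<noteq> contract p q g x \<Longrightarrow> contract p q a x \<noteq> contract p q b x"
      for f g x
    proof -
      obtain p q where pq: "consecutive X p q" "(p \<le> n) = (x \<le> n)" "(q \<le> n) = (x \<le> n)" "f p = q"
        using arc[OF fg(1,4) refl] fg(5) by auto
      have mg: "matching_on X g" using that(2) by (simp add: nc_matching_def)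
      have "card (X - {p, q, g p, g q}) \<ge> card X - card {p, q, g p, g q}" by (intro diff_card_le_card_Diff) simp
      moreover have "card {p, q, g p, g q} \<le> 4" by (simp add: card_insert_if)
      ultimately have "card (X - {p, q, g p, g q}) \<noteq> 0" using card by linarith
      then have "X - {p, q, g p, g q} \<noteq> {}" by (metis card.empty)
      then obtain y where y: "y \<in> X - {p, q, g p, g q}" by blast
      then have "\<exists>x\<in>X - {p, q}. contract p q f x \<noteq> contract p q g x"
        using contract_eq_common[of X g f p q y, OF mg pq(4) _ y] fg(3)[of y] y by blast
      then show ?thesis using fg(6) pq by blast
    qed
    show ?thesis
    proof (cases "\<exists>x\<in>X. (x \<le> n) = (a x \<le> n)")
      case True
      then show ?thesis using step[OF a b] none by metis
    next
      case Fa: False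
      show ?thesis
      proof (cases "\<exists>x\<in>X. (x \<le> n) = (b x \<le> n)")
        case True
        then show ?thesis using step[OF b a] none by metis
      next
        case False
        \<comment> \<open>With no arc inside a side, both matchings join the two sides completely
          and so coincide.\<close>
        then have "a x0 = b x0"
          using transversal_matching_unique[OF a b, of n] Fa ne(1) by (metis not_le)
        then show ?thesis using ne by simp
      qed
    qed
  qed
qed

section \<open>Contracting only points up to \<open>n\<close>\<close>

text \<open>For a reduced diagram: all remaining lower points are ends of transversals.\<close>

definition joins_outside :: "nat set \<Rightarrow> nat \<Rightarrow> (nat \<Rightarrow> nat) \<Rightarrow> bool" where
  "joins_outside X n f \<longleftrightarrow> (\<forall>w\<in>X. n < w \<longrightarrow> f w \<le> n)"

text \<open>The first alternative survives every contraction inside \<open>{..n}\<close>.\<close>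

definition separated_above :: "nat set \<Rightarrow> nat \<Rightarrow> (nat \<Rightarrow> nat) \<Rightarrow> (nat \<Rightarrow> nat) \<Rightarrow> bool" where
  "separated_above X n a b \<longleftrightarrow>
    (\<exists>w\<in>X. n < w \<and> n < a w \<and> n < b w \<and> a w \<noteq> b w) \<or>
    (\<exists>x\<in>X. a x \<noteq> b x) \<and> (joins_outside X n a \<or> joins_outside X n b)"

lemma separated_above_sym: "separated_above X n a b = separated_above X n b a"
proof -
  have "separated_above X n b a" if "separated_above X n a b" for a b
  proof -
    from that consider w where "w \<in> X" "n < w" "n < a w" "n < b w" "a w \<noteq> b w"
      | x where "x \<in> X" "a x \<noteq> b x" "joins_outside X n a \<or> joins_outside X n b"
      unfolding separated_above_def by blast
    then show ?thesis
    proof cases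
      case 1
      then show ?thesis unfolding separated_above_def by (intro disjI1 bexI[of _ w]) auto
    next
      case 2
      then have "\<exists>x\<in>X. b x \<noteq> a x" by (intro bexI[of _ x]) auto
      then show ?thesis unfolding separated_above_def using 2(3) by blast
    qed
  qed
  then show ?thesis by blast
qed

text \<open>At most four points beyond \<open>n\<close> leave at least two points to contract. Arcs
  beyond \<open>n\<close> that conflict can no longer be destroyed, so it is enough either to keep
  the matchings different with one of them satisfying \<open>joins_outside\<close>, or to create
  such a conflict.\<close>

lemma contract_step_below:
  assumes a: "nc_matching X a" and b: "nc_matching X b"
    and sep: "separated_above X n a b"
    and card: "card X \<ge> 6" "card {x \<in> X. n < x} \<le> 4"
  shows "\<exists>p q. consecutive X p q \<and> p \<le> n \<and> q \<le> n \<and>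
    separated_above (X - {p, q}) n (contract p q a) (contract p q b)"
proof -
  let ?V = "{x \<in> X. x \<le> n}" and ?W = "{x \<in> X. n < x}"
  have ma: "matching_on X a" and mb: "matching_on X b" using a b by (auto simp: nc_matching_def)
  have fin: "finite X" using ma by (simp add: matching_on_def)
  have XVW: "card X = card ?V + card ?W"
    using fin by (subst card_Un_disjoint[symmetric]) (auto intro: arg_cong[where f=card])
  have V_cons: "consecutive X p q" "p \<le> n" "q \<le> n" "p \<in> X" "q \<in> X" "p \<noteq> q" if "consecutive ?V p q" for p q
    using that by (auto simp: consecutive_def)
  have fixed: "contract p q f w = f w" if "matching_on X f" "p \<in> X" "q \<in> X" "p \<le> n" "q \<le> n" "w \<in> X" "n < f w" for p q f w
    using that matching_onD[OF that(1)] by (intro contract_other[OF that(1)]) (auto simp: not_le)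
  have conflict: ?thesis if w: "w \<in> X" "n < w" "n < a w" "n < b w" "a w \<noteq> b w" for w
  proof -
    have "card ?V \<ge> 2" using card XVW by simp
    then have "?V \<noteq> {}" by fastforce
    then obtain x where x: "x \<in> ?V" by blast
    have "card (?V - {x}) \<noteq> 0" using x fin \<open>card ?V \<ge> 2\<close> by (subst card_Diff_singleton) auto
    then have "?V - {x} \<noteq> {}" by (metis card.empty)
    then obtain y where "y \<in> ?V" "x \<noteq> y" by blast
    then obtain p q where pq: "consecutive ?V p q"
      using consecutive_commonE[of x ?V y "\<lambda>z. z = x"] x by blast
    note P = V_cons[OF pq]
    have "contract p q a w = a w" "contract p q b w = b w"
      using fixed[OF ma P(4,5,2,3)] fixed[OF mb P(4,5,2,3)] w by auto
    then show ?thesis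
      using P w by (intro exI[of _ p] exI[of _ q]) (auto simp: separated_above_def)
  qed
  have arc: "\<exists>p q. consecutive X p q \<and> p \<le> n \<and> q \<le> n \<and> p \<in> X \<and> q \<in> X \<and> p \<noteq> q \<and> f p = q"
    if f: "nc_matching X f" "x \<in> X" "x \<le> n" "f x \<le> n" for f x
  proof -
    have fX: "f x \<in> X" using f matching_onD by (auto simp: nc_matching_def)
    obtain p q where "consecutive X p q" "p \<in> ?V" "q \<in> ?V" "f p = q"
      by (rule innermost_arcE[OF f(1), of ?V x]) (use f fX in auto)
    then show ?thesis by (force simp: consecutive_def)
  qed
  have jo_arc: "joins_outside (X - {p, q}) n (contract p q f)" if "f p = q" "joins_outside X n f" for f p q
    using that by (auto simp: joins_outside_def contract_arc)
  have jo_contract: "joins_outside (X - {p, q}) n (contract p q f)"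
    if m: "matching_on X f" and pq: "p \<in> X" "q \<in> X" "p \<noteq> q" "f p \<noteq> q" "p \<le> n" "q \<le> n" "f p \<le> n \<or> f q \<le> n" "joins_outside X n f"
    for f p q
    unfolding joins_outside_def
  proof (intro ballI impI)
    fix w assume w: "w \<in> X - {p, q}" "n < w"
    show "contract p q f w \<le> n"
      using contract_partner[OF m pq(1-4)] contract_other[OF m, of w p q] w pq
      by (cases "w = f p \<or> w = f q") (auto simp: joins_outside_def)
  qed
  \<comment> \<open>An innermost arc \<open>p\<close>, \<open>q\<close> of \<open>a\<close> up to
    \<open>n\<close> is contracted. If that makes the matchings equal, they already agreed off four
    points, so some point up to \<open>n\<close> is common while \<open>p\<close> is not, and
    neighbours \<open>r\<close>, \<open>s\<close> of different kind are contracted instead. If this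
    spoils \<open>joins_outside\<close> for both, each gets an arc beyond \<open>n\<close> from the
    same point but with a different other end, which is a conflict.\<close>
  have both: ?thesis if ne: "x0 \<in> X" "a x0 \<noteq> b x0" and ja: "joins_outside X n a" and jb: "joins_outside X n b"
    and v: "v \<in> X" "v \<le> n" "a v \<le> n" and a: "nc_matching X a" and b: "nc_matching X b"
    and goal: "\<And>p q. consecutive X p q \<Longrightarrow> p \<le> n \<Longrightarrow> q \<le> n \<Longrightarrow> separated_above (X - {p, q}) n (contract p q a) (contract p q b) \<Longrightarrow> ?thesis"
    for a b x0 v
  proof -
    have ma: "matching_on X a" and mb: "matching_on X b" using a b by (auto simp: nc_matching_def)
    obtain p q where pq: "consecutive X p q" "p \<le> n" "q \<le> n" "p \<in> X" "q \<in> X" "p \<noteq> q" "a p = q"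
      using arc[OF a v] by blast
    show ?thesis
    proof (cases "\<exists>x\<in>X - {p, q}. contract p q a x \<noteq> contract p q b x")
      case True
      then show ?thesis using goal[OF pq(1-3)] jo_arc[of a p q] pq ja by (auto simp: separated_above_def)
    next
      case False
      then have eq: "\<And>x. x \<in> X - {p, q} \<Longrightarrow> contract p q a x = contract p q b x" by blast
      note common = contract_eq_common[of X b a p q, OF mb pq(7) eq]
      have bp: "b p \<noteq> q"
      proof
        assume "b p = q"
        then have "a x = b x" if "x \<in> X - {p, q}" for x using eq[OF that] pq by (simp add: contract_arc)
        moreover have "a p = b p" "a q = b q" using \<open>b p = q\<close> pq matching_onD[OF ma pq(4)] matching_onD[OF mb pq(4)] by auto
        ultimately show False using ne by (cases "x0 \<in> {p, q}") auto
      qed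
      have "card (X - {p, q, b p, b q}) \<ge> card X - card {p, q, b p, b q}" by (intro diff_card_le_card_Diff) simp
      moreover have "card {p, q, b p, b q} \<le> 4" by (simp add: card_insert_if)
      ultimately have "card (X - {p, q, b p, b q}) \<noteq> 0" using card(1) by linarith
      then have "X - {p, q, b p, b q} \<noteq> {}" by (metis card.empty)
      then obtain y where y: "y \<in> X - {p, q, b p, b q}" by blast
      then have y: "y \<in> X" "a y = b y" using common by auto
      have "\<exists>v. v \<in> ?V \<and> a v = b v"
      proof (cases "y \<le> n")
        case False
        then have "a y \<le> n" using ja y by (auto simp: joins_outside_def)
        moreover have "b (a y) = a (a y)" "a y \<in> X" using y matching_onD[OF ma y(1)] matching_onD[OF mb y(1)] by auto
        ultimately show ?thesis by (intro exI[of _ "a y"]) auto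
      qed (use y in blast)
      then obtain v where v: "v \<in> ?V" "a v = b v" by blast
      obtain r s where rs: "consecutive ?V r s" "(a r = b r) \<noteq> (a s = b s)"
        using consecutive_commonE[of v ?V p "\<lambda>x. a x = b x"] v pq bp by auto
      note P = V_cons[OF rs(1)]
      have neq: "\<exists>x\<in>X - {r, s}. contract r s a x \<noteq> contract r s b x"
        using contract_neq_common'[OF ma mb P(4-6) rs(2)] .
      show ?thesis
      proof (cases "joins_outside (X - {r, s}) n (contract r s a) \<or> joins_outside (X - {r, s}) n (contract r s b)")
        case True
        then show ?thesis using goal[OF P(1-3)] neq by (auto simp: separated_above_def)
      next
        case F: False
        have jo: "a r \<noteq> s" "b r \<noteq> s" "n < a r" "n < a s" "n < b r" "n < b s"
          using F jo_arc[OF _ ja, of r s] jo_arc[OF _ jb, of r s] jo_contract[OF ma P(4-6) _ P(2,3) _ ja]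
            jo_contract[OF mb P(4-6) _ P(2,3) _ jb] not_le by blast+
        obtain c d where cd: "c = r \<and> d = s \<or> c = s \<and> d = r" "a c = b c" "a d \<noteq> b d" using rs(2) by blast
        then have cd': "c \<in> X" "d \<in> X" "c \<noteq> d" "contract r s a = contract c d a" "contract r s b = contract c d b"
          "{r, s} = {c, d}"
          using P contract_commute[OF ma P(4-6)] contract_commute[OF mb P(4-6)] by auto
        note cn = contract_neq_common[OF ma mb cd'(1-3) cd(2,3)]
        have "n < a c" "n < a d" "n < b d" using cd jo by auto
        then have "separated_above (X - {r, s}) n (contract r s a) (contract r s b)"
          unfolding cd' separated_above_def using cn cd by (intro disjI1 bexI[of _ "a c"]) auto
        then show ?thesis by (rule goal[OF P(1-3)])
      qed
    qed
  qed
  \<comment> \<open>\<open>a\<close> has an arc beyond \<open>n\<close> at \<open>w\<close>, and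
    \<open>b\<close> has none there. An arc of \<open>b\<close> up to \<open>n\<close> can be
    contracted without changing \<open>b\<close>. If there is none, \<open>b\<close> is a bijection
    between the two sides, each with at least three points; contracting a \<open>b\<close>-partner
    of \<open>w\<close> or \<open>a w\<close> with a neighbour that is neither gives
    \<open>b\<close> an arc in conflict with the arc of \<open>a\<close>.\<close>
  have one: ?thesis if jb: "joins_outside X n b" and na: "\<not> joins_outside X n a"
     and a: "nc_matching X a" and b: "nc_matching X b"
    and goal: "\<And>p q. consecutive X p q \<Longrightarrow> p \<le> n \<Longrightarrow> q \<le> n \<Longrightarrow> separated_above (X - {p, q}) n (contract p q a) (contract p q b) \<Longrightarrow> ?thesis"
    for a b
  proof -
    have ma: "matching_on X a" and mb: "matching_on X b" using a b by (auto simp: nc_matching_def)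
    obtain w where w: "w \<in> X" "n < w" "n < a w" using na by (auto simp: joins_outside_def not_le)
    have aw: "a w \<in> X" "a (a w) = w" "a w \<noteq> w" using matching_onD[OF ma w(1)] by auto
    show ?thesis
    proof (cases "\<exists>v\<in>?V. b v \<le> n")
      case True
      then obtain p q where pq: "consecutive X p q" "p \<le> n" "q \<le> n" "p \<in> X" "q \<in> X" "p \<noteq> q" "b p = q"
        using arc[OF b] by blast
      have "contract p q a w = a w" "contract p q b w = b w"
        using fixed[OF ma pq(4,5,2,3) w(1,3)] pq by (auto simp: contract_arc)
      moreover have "b w \<le> n" "w \<in> X - {p, q}" using jb w pq by (auto simp: joins_outside_def)
      ultimately have "\<exists>x\<in>X - {p, q}. contract p q a x \<noteq> contract p q b x" using w by (intro bexI[of _ w]) auto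
      then show ?thesis using goal[OF pq(1-3)] jo_arc[OF pq(7) jb] by (auto simp: separated_above_def)
    next
      case False
      then have bV: "\<And>v. v \<in> X \<Longrightarrow> v \<le> n \<Longrightarrow> n < b v" by auto
      have bW: "\<And>v. v \<in> X \<Longrightarrow> n < v \<Longrightarrow> b v \<le> n" using jb by (auto simp: joins_outside_def)
      have "bij_betw b ?V ?W"
        by (rule bij_betw_byWitness[where f'=b]) (use bV bW matching_onD[OF mb] in auto)
      then have "card ?V \<ge> 3" using XVW card bij_betw_same_card by fastforce
      moreover have "card {b w, b (a w)} \<le> 2" by (simp add: card_insert_if)
      ultimately have "\<not> ?V \<subseteq> {b w, b (a w)}"
        by (metis (no_types, lifting) card_mono finite.emptyI finite.insertI le_trans not_less_eq_eq numeral_2_eq_2 numeral_3_eq_3)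
      then obtain v where v: "v \<in> ?V" "v \<notin> {b w, b (a w)}" by blast
      have bw: "b w \<in> ?V" using bW w matching_onD[OF mb w(1)] by auto
      obtain r s where rs: "consecutive ?V r s" "(r \<in> {b w, b (a w)}) \<noteq> (s \<in> {b w, b (a w)})"
        using consecutive_commonE[OF bw v(1), of "\<lambda>x. x \<in> {b w, b (a w)}"] v by auto
      note P = V_cons[OF rs(1)]
      obtain c d where cd: "c = r \<and> d = s \<or> c = s \<and> d = r" "c \<in> {b w, b (a w)}" "d \<notin> {b w, b (a w)}" using rs(2) by blast
      then have cd': "c \<in> X" "d \<in> X" "c \<noteq> d" "c \<le> n" "d \<le> n" "contract r s a = contract c d a" "contract r s b = contract c d b"
          "{r, s} = {c, d}"
        using P contract_commute[OF ma P(4-6)] contract_commute[OF mb P(4-6)] by auto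
      have bc: "b c \<in> {w, a w}" "n < b c" "n < b d" "b d \<notin> {w, a w}"
        using cd(2,3) matching_onD[OF mb w(1)] matching_onD[OF mb aw(1)] bV cd' matching_onD[OF mb cd'(2)] by auto
      have bX: "b c \<in> X" "a (b c) \<in> {w, a w}" "n < a (b c)" using bc aw w by auto
      have "contract c d b (b c) = b d"
        using contract_partner[OF mb cd'(1-3)] bV[OF cd'(1,4)] cd'(5) by auto
      moreover have "contract c d a (b c) = a (b c)"
        using fixed[OF ma cd'(1,2,4,5) bX(1,3)] .
      ultimately have "separated_above (X - {r, s}) n (contract r s a) (contract r s b)"
        unfolding cd' separated_above_def using bc bX cd'
        by (intro disjI1 bexI[of _ "b c"]) auto
      then show ?thesis by (rule goal[OF P(1-3)])
    qed
  qed
  from sep consider (conf) w where "w \<in> X" "n < w" "n < a w" "n < b w" "a w \<noteq> b w"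
    | (ab) x0 where "x0 \<in> X" "a x0 \<noteq> b x0" "joins_outside X n a" "joins_outside X n b"
    | (b) "joins_outside X n b" "\<not> joins_outside X n a"
    | (a) "joins_outside X n a" "\<not> joins_outside X n b"
    unfolding separated_above_def by blast
  then show ?thesis
  proof cases
    case conf
    then show ?thesis by (rule conflict)
  next
    case ab
    have goal: ?thesis if "consecutive X p q" "p \<le> n" "q \<le> n" "separated_above (X - {p, q}) n (contract p q b) (contract p q a)" for p q
      using that separated_above_sym by blast
    show ?thesis
    proof (cases "\<exists>v\<in>?V. a v \<le> n")
      case True
      then show ?thesis using both[OF ab] a b ab by blast
    next
      case Fa: False
      show ?thesis
      proof (cases "\<exists>v\<in>?V. b v \<le> n")
        case True
        then show ?thesis using both[OF ab(1) ab(2)[symmetric] ab(4,3)] a b goal ab by blast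
      next
        case False
        then have "(a x \<le> n) = (n < x)" "(b x \<le> n) = (n < x)" if "x \<in> X" for x
          using Fa ab that by (cases "n < x"; auto simp: joins_outside_def not_less)+
        then have "a x0 = b x0"
          using transversal_matching_unique[OF a b, of n x0] ab(1) by blast
        then show ?thesis using ab by simp
      qed
    qed
  next
    case b
    then show ?thesis using one[OF b \<open>nc_matching X a\<close> \<open>nc_matching X b\<close>] by blast
  next
    case a
    show ?thesis using one[OF a \<open>nc_matching X b\<close> \<open>nc_matching X a\<close>] separated_above_sym by blast
  qed
qed

section \<open>Half diagrams\<close>

text \<open>The fixed points of a half diagram are its free ends; no arc may pass over a free end.\<close>

definition half_diagram :: "nat \<Rightarrow> (nat \<Rightarrow> nat) \<Rightarrow> bool" where
  "half_diagram n h \<longleftrightarrow> (\<forall>x\<in>{1..n}. h x \<in> {1..n} \<and> h (h x) = x \<and>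
     (\<forall>y. x < y \<and> y < h x \<longrightarrow> x < h y \<and> h y < h x \<and> h y \<noteq> y))"

definition defects :: "nat \<Rightarrow> (nat \<Rightarrow> nat) \<Rightarrow> nat set" where
  "defects n h = {x \<in> {1..n}. h x = x}"

text \<open>Contraction from above and from below at once: the arcs on \<open>{1..n}\<close> act
  from above, the remaining ones from below.\<close>

definition two_sided :: "nat \<Rightarrow> (nat \<Rightarrow> nat) \<Rightarrow> bool" where
  "two_sided n h \<longleftrightarrow> half_diagram (2 * n) h \<and> (\<forall>x\<in>{1..2*n}. (h x \<le> n) = (x \<le> n))"

text \<open>\<open>a'\<close> is what remains on the free ends of \<open>h\<close> after \<open>a\<close> is contracted along the arcs of \<open>h\<close>.\<close>

definition reduces_to :: "nat \<Rightarrow> (nat \<Rightarrow> nat) \<Rightarrow> (nat \<Rightarrow> nat) \<Rightarrow> (nat \<Rightarrow> nat) \<Rightarrow> bool" where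
  "reduces_to n h a a' \<longleftrightarrow> (\<forall>c. coloring (defects (2 * n) h) a' c \<longleftrightarrow>
     (\<exists>c'. (\<forall>x\<in>defects (2 * n) h. c' x = c x) \<and> coloring {1..2*n} a c' \<and> coloring {1..2*n} h c'))"

lemma half_diagramD:
  assumes "half_diagram n h" "x \<in> {1..n}"
  shows "h x \<in> {1..n}" "h (h x) = x"
    "x < y \<Longrightarrow> y < h x \<Longrightarrow> x < h y" "x < y \<Longrightarrow> y < h x \<Longrightarrow> h y < h x" "x < y \<Longrightarrow> y < h x \<Longrightarrow> h y \<noteq> y"
  using bspec[OF assms(1)[unfolded half_diagram_def] assms(2)] by blast+

lemma half_diagram_join:
  assumes h: "half_diagram n h" and pq: "consecutive (defects n h) p q"
  shows "half_diagram n (h(p := q, q := p))" "defects n (h(p := q, q := p)) = defects n h - {p, q}"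
proof -
  let ?k = "h(p := q, q := p)"
  have P: "p \<in> {1..n}" "q \<in> {1..n}" "p < q" "h p = p" "h q = q"
    using pq by (auto simp: consecutive_def defects_def)
  have btw: "h z \<noteq> z" if "z \<in> {1..n}" "p < z" "z < q" for z
    using pq that unfolding consecutive_def defects_def by blast
  note D = half_diagramD[OF h]
  have fixq: "h x = p \<longleftrightarrow> x = p" "h x = q \<longleftrightarrow> x = q" if "x \<in> {1..n}" for x
    using D(2)[OF that] P by auto
  show "defects n ?k = defects n h - {p, q}"
    using P by (auto simp: defects_def)
  show "half_diagram n ?k"
    unfolding half_diagram_def
  proof (intro ballI conjI allI impI)
    fix x assume x: "x \<in> {1..n}"
    show "?k x \<in> {1..n}" using D(1)[OF x] P by auto
    show "?k (?k x) = x" using D(2)[OF x] fixq[OF x] P by auto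
    fix y assume xy: "x < y \<and> y < ?k x"
    have "x < ?k y \<and> ?k y < ?k x \<and> ?k y \<noteq> y"
    proof (cases "x = p")
      case True
      then have y: "p < y" "y < q" "y \<in> {1..n}" using xy P by auto
      then have ne: "h y \<noteq> y" using btw by auto
      have hy: "h y \<in> {1..n}" "h (h y) = y" using D[OF y(3)] by auto
      have "\<not> h y < p" using D(5)[OF hy(1), of p] hy y P by auto
      moreover have "\<not> q < h y" using D(5)[OF y(3), of q] y P by auto
      moreover have "h y \<noteq> p" "h y \<noteq> q" using fixq[OF y(3)] y by auto
      ultimately show ?thesis using True y ne P by auto
    next
      case False
      then have "x \<noteq> q" using xy P by auto
      then have k: "?k x = h x" using False by simp
      then have y: "x < h y" "h y < h x" "h y \<noteq> y" using D(3-5)[OF x, of y] xy by auto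
      then have "y \<noteq> p" "y \<noteq> q" using P by auto
      then show ?thesis using y k by simp
    qed
    then show "x < ?k y" "?k y < ?k x" "?k y \<noteq> y" by auto
  qed
qed

text \<open>Contracting in the reduced matching and adding an arc to \<open>h\<close> impose the
  same extra condition, equal colours at \<open>p\<close> and \<open>q\<close>.\<close>

lemma reduces_to_join:
  assumes h: "half_diagram (2 * n) h" and pq: "consecutive (defects (2 * n) h) p q"
    and m: "matching_on (defects (2 * n) h) a'" and r: "reduces_to n h a a'"
  shows "reduces_to n (h(p := q, q := p)) a (contract p q a')"
proof -
  let ?X = "defects (2 * n) h" and ?k = "h(p := q, q := p)"
  have P: "p \<in> ?X" "q \<in> ?X" "p \<noteq> q" using pq by (auto simp: consecutive_def)
  then have P': "h p = p" "h q = q" "p \<in> {1..2*n}" "q \<in> {1..2*n}" by (auto simp: defects_def)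
  have k: "coloring {1..2*n} ?k c \<longleftrightarrow> coloring {1..2*n} h c \<and> c p = c q" for c
  proof
    assume c: "coloring {1..2*n} ?k c"
    then have "c (?k p) = c p" using P' by (auto simp: coloring_def simp del: fun_upd_apply)
    then have pq: "c p = c q" using P by auto
    moreover have "c (h x) = c x" if "x \<in> {1..2*n}" for x
    proof (cases "x \<in> {p, q}")
      case False
      then have "?k x = h x" by simp
      then show ?thesis using c that unfolding coloring_def by metis
    qed (use P' in auto)
    ultimately show "coloring {1..2*n} h c \<and> c p = c q" by (simp add: coloring_def)
  qed (auto simp: coloring_def)
  show ?thesis
    unfolding reduces_to_def half_diagram_join(2)[OF h pq] coloring_contract[OF m P] k
  proof (intro allI iffI)
    fix c
    assume "\<exists>c'. (\<forall>x\<in>?X - {p, q}. c' x = c x) \<and> coloring ?X a' c' \<and> c' p = c' q"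
    then obtain c1 where c1: "\<forall>x\<in>?X - {p, q}. c1 x = c x" "coloring ?X a' c1" "c1 p = c1 q" by blast
    then obtain c2 where "\<forall>x\<in>?X. c2 x = c1 x" "coloring {1..2*n} a c2" "coloring {1..2*n} h c2"
      using r unfolding reduces_to_def by blast
    then show "\<exists>c'. (\<forall>x\<in>?X - {p, q}. c' x = c x) \<and> coloring {1..2*n} a c' \<and> coloring {1..2*n} h c' \<and> c' p = c' q"
      using c1 P by (intro exI[of _ c2]) auto
  next
    fix c
    assume "\<exists>c'. (\<forall>x\<in>?X - {p, q}. c' x = c x) \<and> coloring {1..2*n} a c' \<and> coloring {1..2*n} h c' \<and> c' p = c' q"
    then obtain c1 where "\<forall>x\<in>?X - {p, q}. c1 x = c x" "coloring {1..2*n} a c1" "coloring {1..2*n} h c1" "c1 p = c1 q" by blast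
    then show "\<exists>c'. (\<forall>x\<in>?X - {p, q}. c' x = c x) \<and> coloring ?X a' c' \<and> c' p = c' q"
      using r unfolding reduces_to_def by (intro exI[of _ c1]) auto
  qed
qed

text \<open>Shared by two-sided and one-sided separation, which differ only in \<open>Inv\<close>.
  By parity, more than four points are at least six, as the contraction steps demand; each
  contracted pair becomes an arc of \<open>h\<close>.\<close>

lemma reduce_to_four:
  fixes n :: nat
  assumes step: "\<And>h X a b. nc_matching X a \<Longrightarrow> nc_matching X b \<Longrightarrow> Inv h X a b \<Longrightarrow> card X \<ge> 6 \<Longrightarrow>
      \<exists>p q. consecutive X p q \<and> (p \<le> n \<longleftrightarrow> q \<le> n) \<and>
        Inv (h(p := q, q := p)) (X - {p, q}) (contract p q a) (contract p q b)"
    and init: "two_sided n h" "X = defects (2 * n) h" "nc_matching X a" "nc_matching X b" "Inv h X a b"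
      "reduces_to n h f a" "reduces_to n h g b" "card X \<ge> 4"
  shows "\<exists>h a b. two_sided n h \<and> card (defects (2 * n) h) = 4 \<and> nc_matching (defects (2 * n) h) a \<and>
    nc_matching (defects (2 * n) h) b \<and> Inv h (defects (2 * n) h) a b \<and> reduces_to n h f a \<and> reduces_to n h g b"
  using init
proof (induction "card X" arbitrary: X h a b rule: less_induct)
  case less
  have ma: "matching_on X a" and mb: "matching_on X b" using less.prems by (auto simp: nc_matching_def)
  show ?case
  proof (cases "card X = 4")
    case True
    then show ?thesis using less.prems by blast
  next
    case False
    then have "card X \<ge> 6" using even_card_matching[OF ma] less.prems(8) by presburger
    then obtain p q where pq: "consecutive X p q" "p \<le> n \<longleftrightarrow> q \<le> n"
      "Inv (h(p := q, q := p)) (X - {p, q}) (contract p q a) (contract p q b)"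
      using step[OF less.prems(3-5)] by blast
    let ?k = "h(p := q, q := p)"
    have h: "half_diagram (2 * n) h" using less.prems by (simp add: two_sided_def)
    note pq' = pq(1)[unfolded less.prems(2)]
    have P: "p \<in> X" "q \<in> X" "p \<noteq> q" using pq by (auto simp: consecutive_def)
    have fin: "finite X" using ma by (simp add: matching_on_def)
    have card: "card (X - {p, q}) = card X - 2" using P fin by (subst card_Diff_subset) auto
    have k: "two_sided n ?k"
      using half_diagram_join(1)[OF h pq'] less.prems(1) pq(2) by (auto simp: two_sided_def)
    show ?thesis
    proof (rule less.hyps[OF _ k])
      show "card (X - {p, q}) < card X" "4 \<le> card (X - {p, q})" using card \<open>card X \<ge> 6\<close> by auto
      show "X - {p, q} = defects (2 * n) ?k" using half_diagram_join(2)[OF h pq'] less.prems by simp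
      show "nc_matching (X - {p, q}) (contract p q a)" "nc_matching (X - {p, q}) (contract p q b)"
        using nc_contract[OF _ pq(1)] less.prems by auto
      show "Inv ?k (X - {p, q}) (contract p q a) (contract p q b)" by (rule pq(3))
      show "reduces_to n ?k f (contract p q a)" "reduces_to n ?k g (contract p q b)"
        using reduces_to_join[OF h pq'] ma mb less.prems by auto
    qed
  qed
qed

text \<open>Vertex \<open>x\<close> sits at position \<open>x\<close> and vertex \<open>x'\<close> at position \<open>2n + 1 - x\<close>.\<close>

definition join_colors :: "nat \<Rightarrow> (nat \<Rightarrow> bool) \<Rightarrow> (nat \<Rightarrow> bool) \<Rightarrow> nat \<Rightarrow> bool" where
  "join_colors n a b x = (if x \<le> n then a x else b (2 * n + 1 - x))"

text \<open>The colourings constant on arcs form a vector space over the field with two elements.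
  Read as a relation from the upper row to the lower row, it turns products of diagrams into
  composition.\<close>

definition color_rel :: "nat \<Rightarrow> (nat \<Rightarrow> nat) \<Rightarrow> ((nat \<Rightarrow> bool) \<times> (nat \<Rightarrow> bool)) set" where
  "color_rel n f = {(a, b). coloring {1..2*n} f (join_colors n a b)}"

text \<open>The colour relation of the projection whose two halves are both \<open>h\<close>: free
  ends are joined straight down.\<close>

definition half_rel :: "nat \<Rightarrow> (nat \<Rightarrow> nat) \<Rightarrow> ((nat \<Rightarrow> bool) \<times> (nat \<Rightarrow> bool)) set" where
  "half_rel n h = {(a, b). coloring {1..n} h a \<and> coloring {1..n} h b \<and> (\<forall>x\<in>defects n h. a x = b x)}"

text \<open>In boundary positions, exchanging the rows is reversal of \<open>{1..2*n}\<close>; this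
  is the involution on matchings.\<close>

abbreviation mirror :: "nat \<Rightarrow> (nat \<Rightarrow> nat) \<Rightarrow> nat \<Rightarrow> nat" where
  "mirror n f x \<equiv> 2 * n + 1 - f (2 * n + 1 - x)"

lemma half_diagram_upper: "two_sided n h \<Longrightarrow> half_diagram n h"
proof -
  assume "two_sided n h"
  then have h: "half_diagram (2 * n) h" and s: "\<And>x. x \<in> {1..2*n} \<Longrightarrow> (h x \<le> n) = (x \<le> n)"
    by (auto simp: two_sided_def)
  note D = half_diagramD[OF h]
  show "half_diagram n h"
    unfolding half_diagram_def
  proof (rule ballI)
    fix x assume "x \<in> {1..n}"
    then have "x \<in> {1..2*n}" "x \<le> n" by auto
    then show "h x \<in> {1..n} \<and> h (h x) = x \<and> (\<forall>y. x < y \<and> y < h x \<longrightarrow> x < h y \<and> h y < h x \<and> h y \<noteq> y)"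
      using D[of x] s[of x] by auto
  qed
qed

lemma half_diagram_mirror:
  assumes "two_sided n h"
  shows "half_diagram n (mirror n h)"
proof -
  have h: "half_diagram (2 * n) h" and s: "\<And>x. x \<in> {1..2*n} \<Longrightarrow> (h x \<le> n) = (x \<le> n)"
    using assms by (auto simp: two_sided_def)
  note D = half_diagramD[OF h]
  have k: "h (2 * n + 1 - x) \<in> {n+1..2*n}" if "x \<in> {1..n}" for x
  proof -
    have "2 * n + 1 - x \<in> {1..2*n}" "\<not> 2 * n + 1 - x \<le> n" using that by auto
    then show ?thesis using D(1)[of "2 * n + 1 - x"] s[of "2 * n + 1 - x"] by auto
  qed
  show ?thesis
    unfolding half_diagram_def
  proof (intro ballI conjI allI impI)
    fix x assume x: "x \<in> {1..n}"
    have flip: "2 * n + 1 - x \<in> {1..2*n}" using x by auto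
    have hx: "h (2 * n + 1 - x) \<in> {1..2*n}" "h (h (2 * n + 1 - x)) = 2 * n + 1 - x"
      using D(1,2)[OF flip] by auto
    show "mirror n h x \<in> {1..n}" using k[OF x] by auto
    show "mirror n h (mirror n h x) = x" using hx x k[OF x] by auto
    fix y assume y: "x < y \<and> y < mirror n h x"
    let ?y = "2 * n + 1 - y" and ?u = "h (2 * n + 1 - x)"
    have u: "?u \<in> {1..2*n}" "?u < ?y" "?y < h ?u" using hx y x k[OF x] by auto
    have "?u < h ?y" "h ?y < h ?u" "h ?y \<noteq> ?y"
      using D(3-5)[OF u(1) u(2,3)] by auto
    moreover have yn: "y \<in> {1..n}" using y k[OF x] x by auto
    moreover have "n + 1 \<le> h ?y" "h ?y \<le> 2 * n" using k[OF yn] by auto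
    ultimately show "x < mirror n h y" "mirror n h y < mirror n h x" "mirror n h y \<noteq> y"
      using hx(2) y by auto linarith+
  qed
qed

lemma card_defects_two_sided:
  assumes "two_sided n h"
  shows "card (defects (2 * n) h) = card (defects n h) + card (defects n (mirror n h))"
proof -
  have s: "\<And>x. x \<in> {1..2*n} \<Longrightarrow> h x \<in> {1..2*n}"
    using assms by (auto simp: two_sided_def dest: half_diagramD)
  let ?r = "\<lambda>x. 2 * n + 1 - x"
  have "x \<in> defects n h \<union> ?r ` defects n (mirror n h)" if x: "x \<in> defects (2 * n) h" for x
  proof (cases "x \<le> n")
    case False
    then have "?r x \<in> defects n (mirror n h)" "x = ?r (?r x)" using x by (auto simp: defects_def)
    then show ?thesis by blast
  qed (use x in \<open>auto simp: defects_def\<close>)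
  moreover have "?r y \<in> defects (2 * n) h" if y: "y \<in> defects n (mirror n h)" for y
  proof -
    have "?r y \<in> {1..2*n}" using y by (auto simp: defects_def)
    moreover have "?r (h (?r y)) = y" using y unfolding defects_def by blast
    ultimately show ?thesis using s[of "?r y"] by (auto simp: defects_def)
  qed
  ultimately have "defects (2 * n) h = defects n h \<union> ?r ` defects n (mirror n h)"
    by (auto simp: defects_def)
  moreover have le: "x \<le> n" if "x \<in> defects n k" for x k using that by (simp add: defects_def)
  moreover have "inj_on ?r (defects n (mirror n h))"
  proof (rule inj_onI)
    fix x y assume xy: "x \<in> defects n (mirror n h)" "y \<in> defects n (mirror n h)" "?r x = ?r y"
    then have "x \<le> n" "y \<le> n" using le by blast+
    then show "x = y" using xy(3) by linarith
  qed
  moreover have "finite (defects n k)" for k by (simp add: defects_def)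
  moreover have "defects n h \<inter> ?r ` defects n (mirror n h) = {}"
  proof -
    have "?r y \<notin> defects n h" if "y \<in> defects n (mirror n h)" for y
      using le[OF that] le[of "?r y" h] by (auto simp: defects_def)
    then show ?thesis by blast
  qed
  ultimately show ?thesis by (simp add: card_Un_disjoint card_image)
qed

text \<open>Each outer half relation forces constancy on its arcs and passes on nothing but the
  colours at its free ends. What the sandwich retains of \<open>f\<close> is therefore exactly its
  contraction \<open>a\<close>.\<close>

lemma color_rel_half_rel:
  assumes h: "two_sided n h" and f: "matching_on {1..2*n} f" and red: "reduces_to n h f a"
  shows "coloring (defects (2 * n) h) a c \<longleftrightarrow>
    (\<exists>(u, v) \<in> half_rel n h O color_rel n f O half_rel n (mirror n h).
      \<forall>x\<in>defects (2 * n) h. join_colors n u v x = c x)" (is "?L \<longleftrightarrow> ?R")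
proof
  have hd: "half_diagram (2 * n) h" and s: "\<And>x. x \<in> {1..2*n} \<Longrightarrow> (h x \<le> n) = (x \<le> n)"
    using h by (auto simp: two_sided_def)
  note D = half_diagramD[OF hd]
  {
    assume ?L
    then obtain c' where c': "\<forall>x\<in>defects (2 * n) h. c' x = c x" "coloring {1..2*n} f c'" "coloring {1..2*n} h c'"
      using red unfolding reduces_to_def by blast
    let ?v = "\<lambda>x. c' (2 * n + 1 - x)"
    have eq: "join_colors n c' ?v x = c' x" if "x \<in> {1..2*n}" for x
      using that by (auto simp: join_colors_def)
    have fr: "coloring {1..2*n} f (join_colors n c' ?v)"
      using c'(2) eq matching_onD(1)[OF f] by (simp add: coloring_def)
    have "(c', ?v) \<in> color_rel n f" using fr by (simp add: color_rel_def)
    moreover have "(c', c') \<in> half_rel n h"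
      using c'(3) by (auto simp: half_rel_def coloring_def)
    moreover have "(?v, ?v) \<in> half_rel n (mirror n h)"
    proof -
      have "c' (2 * n + 1 - mirror n h x) = c' (2 * n + 1 - x)" if "x \<in> {1..n}" for x
      proof -
        have "2 * n + 1 - x \<in> {1..2*n}" using that by auto
        moreover have "2 * n + 1 - mirror n h x = h (2 * n + 1 - x)"
          using D(1)[OF calculation] by auto
        ultimately show ?thesis using c'(3) unfolding coloring_def by metis
      qed
      then show ?thesis by (auto simp: half_rel_def coloring_def)
    qed
    ultimately have "(c', ?v) \<in> half_rel n h O color_rel n f O half_rel n (mirror n h)" by blast
    moreover have "\<forall>x\<in>defects (2 * n) h. join_colors n c' ?v x = c x"
      using c'(1) eq by (auto simp: defects_def)
    ultimately show ?R by blast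
  }
  assume ?R
  then obtain u v u' v' where uv: "(u, u') \<in> half_rel n h" "(u', v') \<in> color_rel n f" "(v', v) \<in> half_rel n (mirror n h)"
    and c: "\<forall>x\<in>defects (2 * n) h. join_colors n u v x = c x" by blast
  let ?c = "join_colors n u' v'"
  have "?c x = c x" if x: "x \<in> defects (2 * n) h" for x
  proof (cases "x \<le> n")
    case True
    then have "x \<in> defects n h" using x by (auto simp: defects_def)
    then have "u x = u' x" using uv(1) unfolding half_rel_def by blast
    then show ?thesis using c[rule_format, OF x] True by (simp add: join_colors_def)
  next
    case False
    then have "2 * n + 1 - x \<in> defects n (mirror n h)" using x by (auto simp: defects_def)
    then have "v' (2 * n + 1 - x) = v (2 * n + 1 - x)" using uv(3) unfolding half_rel_def by blast
    then show ?thesis using c[rule_format, OF x] False by (simp add: join_colors_def)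
  qed
  moreover have "coloring {1..2*n} f ?c" using uv(2) by (simp add: color_rel_def)
  moreover have "coloring {1..2*n} h ?c"
    unfolding coloring_def
  proof
    fix x assume x: "x \<in> {1..2*n}"
    show "?c (h x) = ?c x"
    proof (cases "x \<le> n")
      case True
      then have "x \<in> {1..n}" using x by auto
      then have "u' (h x) = u' x" using uv(1) unfolding half_rel_def coloring_def by blast
      then show ?thesis using True s[OF x] by (simp add: join_colors_def)
    next
      case False
      let ?y = "2 * n + 1 - x"
      have "?y \<in> {1..n}" "2 * n + 1 - ?y = x" using x False by auto
      then have "v' (mirror n h ?y) = v' ?y" using uv(3) unfolding half_rel_def coloring_def by blast
      then show ?thesis using False s[OF x] \<open>2 * n + 1 - ?y = x\<close> by (simp add: join_colors_def)
    qed
  qed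
  ultimately show ?L using red unfolding reduces_to_def by blast
qed

text \<open>Turns a difference between contracted matchings into a difference between products with
  projections.\<close>

lemma separating_halves:
  assumes h: "two_sided n h" and fg: "matching_on {1..2*n} f" "matching_on {1..2*n} g"
    and red: "reduces_to n h f a" "reduces_to n h g b"
    and ab: "nc_matching (defects (2 * n) h) a" "nc_matching (defects (2 * n) h) b"
    and ne: "x \<in> defects (2 * n) h" "a x \<noteq> b x"
  shows "half_rel n h O color_rel n f O half_rel n (mirror n h) \<noteq> half_rel n h O color_rel n g O half_rel n (mirror n h)"
proof
  assume "half_rel n h O color_rel n f O half_rel n (mirror n h) = half_rel n h O color_rel n g O half_rel n (mirror n h)"
  then have "coloring (defects (2 * n) h) a c = coloring (defects (2 * n) h) b c" for c
    using color_rel_half_rel[OF h fg(1) red(1)] color_rel_half_rel[OF h fg(2) red(2)] by simp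
  then show False using matching_eqI[of "defects (2 * n) h" a b x] ab ne by (simp add: nc_matching_def)
qed

section \<open>Matchings of \<open>2n\<close> points\<close>

text \<open>Ends of transversals become the free ends. The lower half is
  \<open>upper n (mirror n f)\<close>, numbered like the upper row.\<close>

definition upper :: "nat \<Rightarrow> (nat \<Rightarrow> nat) \<Rightarrow> nat \<Rightarrow> nat" where
  "upper n f x = (if f x \<le> n then f x else x)"

definition tl_matching :: "nat \<Rightarrow> (nat \<Rightarrow> nat) \<Rightarrow> bool" where
  "tl_matching n f \<longleftrightarrow> nc_matching {1..2*n} f"

lemma tl_matchingD:
  assumes "tl_matching n f" "x \<in> {1..2*n}"
  shows "f x \<in> {1..2*n}" "f (f x) = x" "f x \<noteq> x"
  using assms matching_onD[of "{1..2*n}" f x] by (simp_all add: tl_matching_def nc_matching_def)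

lemma tl_matching_on: "tl_matching n f \<Longrightarrow> matching_on {1..2*n} f"
  by (simp add: tl_matching_def nc_matching_def)

lemma mirror_mirror:
  assumes "tl_matching n f" "x \<in> {1..2*n}"
  shows "mirror n (mirror n f) x = f x"
proof -
  have "2 * n + 1 - (2 * n + 1 - x) = x" "f x \<le> 2 * n" using assms tl_matchingD(1)[OF assms] by auto
  then show ?thesis by simp
qed

lemma tl_matching_mirror:
  assumes "tl_matching n f"
  shows "tl_matching n (mirror n f)"
proof -
  note D = tl_matchingD[OF assms]
  have r: "2 * n + 1 - x \<in> {1..2*n}" "2 * n + 1 - (2 * n + 1 - x) = x" if "x \<in> {1..2*n}" for x
    using that by auto
  have m: "mirror n f x \<in> {1..2*n} \<and> mirror n f (mirror n f x) = x \<and> mirror n f x \<noteq> x"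
    if x: "x \<in> {1..2*n}" for x
  proof -
    have "f (2 * n + 1 - x) \<in> {1..2*n}" "f (f (2 * n + 1 - x)) = 2 * n + 1 - x" "f (2 * n + 1 - x) \<noteq> 2 * n + 1 - x"
      using D r x by blast+
    then show ?thesis using r[OF x] r[of "f (2 * n + 1 - x)"] by metis
  qed
  moreover have "\<not> (x < y \<and> y < mirror n f x \<and> mirror n f x < mirror n f y)"
    if x: "x \<in> {1..2*n}" and y: "y \<in> {1..2*n}" for x y
  proof
    assume A: "x < y \<and> y < mirror n f x \<and> mirror n f x < mirror n f y"
    let ?x = "2 * n + 1 - x" and ?y = "2 * n + 1 - y"
    have F: "f ?x \<in> {1..2*n}" "f (f ?x) = ?x" "f ?y \<in> {1..2*n}" "f (f ?y) = ?y"
      using D r x y by blast+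
    have b: "1 \<le> x" "x \<le> 2 * n" "1 \<le> y" "y \<le> 2 * n" "1 \<le> f ?x" "f ?x \<le> 2 * n" "1 \<le> f ?y" "f ?y \<le> 2 * n"
      using x y F(1,3) by simp_all
    have "f ?y < f ?x" "f ?x < ?y" "?y < ?x"
      using A b by linarith+
    moreover have "\<not> (f ?y < f ?x \<and> f ?x < f (f ?y) \<and> f (f ?y) < f (f ?x))"
      using bspec[OF bspec[OF conjunct2[OF assms[unfolded tl_matching_def nc_matching_def]] F(3)] F(1)] .
    ultimately show False using F by simp
  qed
  ultimately show ?thesis unfolding tl_matching_def nc_matching_def matching_on_def by blast
qed

lemma half_diagram_upper_part:
  assumes "tl_matching n f" shows "half_diagram n (upper n f)"
proof -
  note D = tl_matchingD[OF assms]
  show ?thesis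
    unfolding half_diagram_def
  proof (rule ballI)
    fix x assume "x \<in> {1..n}"
    then have x: "x \<in> {1..2*n}" "x \<le> n" by auto
    have fx: "f x \<in> {1..2*n}" "f (f x) = x" using D[OF x(1)] by auto
    have "x < upper n f y \<and> upper n f y < upper n f x \<and> upper n f y \<noteq> y" if y: "x < y" "y < upper n f x" for y
    proof -
      have u: "upper n f x = f x" "f x \<le> n" using y by (auto simp: upper_def split: if_splits)
      then have Y: "y \<in> {1..2*n}" using y x by auto
      have "x < f y" "f y < f x" 
        using nc_matchingD[of "{1..2*n}" f x y] assms x(1) Y y u by (auto simp: tl_matching_def)
      then show ?thesis using u D[OF Y] by (auto simp: upper_def)
    qed
    then show "upper n f x \<in> {1..n} \<and> upper n f (upper n f x) = x \<and>
        (\<forall>y. x < y \<and> y < upper n f x \<longrightarrow> x < upper n f y \<and> upper n f y < upper n f x \<and> upper n f y \<noteq> y)"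
      using fx x by (auto simp: upper_def)
  qed
qed

lemma lower_arcs_eq:
  assumes f: "tl_matching n f" and g: "tl_matching n g"
    and lo: "\<And>x. x \<in> {1..n} \<Longrightarrow> upper n (mirror n f) x = upper n (mirror n g) x"
    and x: "x \<in> {n+1..2*n}"
  shows "n < f x \<longleftrightarrow> n < g x" "n < f x \<Longrightarrow> f x = g x"
proof -
  let ?y = "2 * n + 1 - x"
  have y: "?y \<in> {1..n}" "2 * n + 1 - ?y = x" "x \<in> {1..2*n}" using x by auto
  have fg: "f x \<in> {1..2*n}" "g x \<in> {1..2*n}" "f x \<noteq> x" "g x \<noteq> x"
    using tl_matchingD[OF f y(3)] tl_matchingD[OF g y(3)] by auto
  have "upper n (mirror n f) ?y = upper n (mirror n g) ?y" using lo[OF y(1)] .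
  then have "(if 2 * n + 1 - f x \<le> n then 2 * n + 1 - f x else ?y) = (if 2 * n + 1 - g x \<le> n then 2 * n + 1 - g x else ?y)"
    unfolding upper_def y(2) .
  moreover have "f x \<le> 2 * n" "g x \<le> 2 * n" "1 \<le> f x" "1 \<le> g x" "n + 1 \<le> x" "x \<le> 2 * n" using fg x by auto
  ultimately show "n < f x \<longleftrightarrow> n < g x" "n < f x \<Longrightarrow> f x = g x"
    using fg(3,4) by (simp_all split: if_splits) linarith+
qed

text \<open>Arcs inside a row are read off the halves. The points left over are the same for both
  matchings, and there is only one noncrossing way to join them across.\<close>

lemma tl_matching_eqI:
  assumes f: "tl_matching n f" and g: "tl_matching n g"
    and up: "\<And>x. x \<in> {1..n} \<Longrightarrow> upper n f x = upper n g x"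
    and lo: "\<And>x. x \<in> {1..n} \<Longrightarrow> upper n (mirror n f) x = upper n (mirror n g) x"
    and x: "x \<in> {1..2*n}"
  shows "f x = g x"
proof -
  note F = tl_matchingD[OF f] and G = tl_matchingD[OF g]
  have low: "f x \<le> n \<longleftrightarrow> g x \<le> n" "f x \<le> n \<Longrightarrow> f x = g x" if "x \<in> {1..n}" for x
    using up[OF that] F(3)[of x] G(3)[of x] that by (auto simp: upper_def split: if_splits)
  note high = lower_arcs_eq[OF f g lo]
  let ?X = "{x \<in> {1..2*n}. (f x \<le> n) = (n < x)}"
  have same: "(f x \<le> n) = (g x \<le> n)" if "x \<in> {1..2*n}" for x
    using low(1)[of x] high(1)[of x] that by (cases "x \<le> n") auto
  have X: "?X = {x \<in> {1..2*n}. (g x \<le> n) = (n < x)}"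
    using same by auto
  have sub: "nc_matching {x \<in> {1..2*n}. (f x \<le> n) = (n < x)} f" if f: "tl_matching n f" for f
  proof -
    note D = tl_matchingD[OF f]
    have "matching_on {x \<in> {1..2*n}. (f x \<le> n) = (n < x)} f"
      unfolding matching_on_def
    proof (intro conjI ballI)
      fix x assume x: "x \<in> {x \<in> {1..2*n}. (f x \<le> n) = (n < x)}"
      then have "x \<in> {1..2*n}" by simp
      note d = D[OF this]
      show "f x \<in> {x \<in> {1..2*n}. (f x \<le> n) = (n < x)}" "f (f x) = x" "f x \<noteq> x" using d x by auto
    qed simp
    then show ?thesis using f unfolding tl_matching_def nc_matching_def by blast
  qed
  show ?thesis
  proof (cases "x \<in> ?X")
    case True
    show ?thesis
      by (rule transversal_matching_unique[where n = n and b = g, OF sub[OF f] _ _ _ True])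
        (use sub[OF g] X in auto)
  next
    case False
    show ?thesis
    proof (cases "x \<le> n")
      case True
      then show ?thesis using low(2)[of x] x False by auto
    next
      case F2: False
      then show ?thesis using high(2)[of x] x False by auto
    qed
  qed
qed

section \<open>Calculus of colour relations\<close>

lemma half_rel_cong:
  assumes "\<And>x. x \<in> {1..n} \<Longrightarrow> h x = k x"
  shows "half_rel n h = half_rel n k"
  using assms by (auto simp: half_rel_def coloring_def defects_def)

lemma half_rel_converse: "(half_rel n h)\<inverse> = half_rel n h"
  by (auto simp: half_rel_def)

lemma half_rel_idem: "half_rel n h O half_rel n h = half_rel n h"
proof
  show "half_rel n h O half_rel n h \<subseteq> half_rel n h" by (auto simp: half_rel_def)
  show "half_rel n h \<subseteq> half_rel n h O half_rel n h"
  proof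
    fix p assume p: "p \<in> half_rel n h"
    then have "(fst p, fst p) \<in> half_rel n h" by (auto simp: half_rel_def)
    then show "p \<in> half_rel n h O half_rel n h" using p by (metis prod.collapse relcomp.relcompI)
  qed
qed

lemma color_rel_mirror:
  assumes "tl_matching n f"
  shows "color_rel n (mirror n f) = (color_rel n f)\<inverse>"
proof -
  have j: "join_colors n b a x = join_colors n a b (2 * n + 1 - x)" if "x \<in> {1..2*n}" for a b x
    using that by (auto simp: join_colors_def)
  have *: "(b, a) \<in> color_rel n (mirror n f)" if "(a, b) \<in> color_rel n f" "tl_matching n f" for a b f
  proof -
    have "join_colors n b a (mirror n f x) = join_colors n b a x" if x: "x \<in> {1..2*n}" for x
    proof -
      have y: "2 * n + 1 - x \<in> {1..2*n}" using x by auto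
      then have "mirror n f x \<in> {1..2*n}" "2 * n + 1 - mirror n f x = f (2 * n + 1 - x)"
        using tl_matchingD(1)[OF \<open>tl_matching n f\<close> y] by auto
      moreover have "join_colors n a b (f (2 * n + 1 - x)) = join_colors n a b (2 * n + 1 - x)"
        using \<open>(a, b) \<in> color_rel n f\<close> y unfolding color_rel_def coloring_def by blast
      ultimately show ?thesis using j x by metis
    qed
    then show ?thesis by (simp add: color_rel_def coloring_def)
  qed
  have cong: "color_rel n (mirror n (mirror n f)) = color_rel n f"
    using mirror_mirror[OF assms] by (simp add: color_rel_def coloring_def)
  show ?thesis
    using *[OF _ assms] *[OF _ tl_matching_mirror[OF assms]] cong by auto
qed

text \<open>A colouring of the upper row extends to the lower row iff it is constant on upper arcs,
  and two of them have a common extension iff they agree at the ends of transversals.\<close>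

lemma color_rel_converse_comp:
  assumes f: "tl_matching n f"
  shows "color_rel n f O (color_rel n f)\<inverse> = half_rel n (upper n f)"
proof -
  note D = tl_matchingD[OF f]
  have dir1: "(a, c) \<in> half_rel n (upper n f)" if ab: "(a, b) \<in> color_rel n f" and cb: "(c, b) \<in> color_rel n f" for a b c
  proof -
    have j: "join_colors n a b (f x) = join_colors n a b x" "join_colors n c b (f x) = join_colors n c b x" if "x \<in> {1..n}" for x
      using ab cb that unfolding color_rel_def coloring_def by auto
    have 1: "a (upper n f x) = a x \<and> c (upper n f x) = c x" if "x \<in> {1..n}" for x
      using j[OF that] that by (auto simp: upper_def join_colors_def)
    have 2: "a x = c x" if "x \<in> defects n (upper n f)" for x
    proof -
      have x: "x \<in> {1..n}" "f x \<noteq> x" using that D(3)[of x] by (auto simp: defects_def)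
      then have "\<not> f x \<le> n" using that by (auto simp: defects_def upper_def split: if_splits)
      then show ?thesis using j[OF x(1)] x by (simp add: join_colors_def)
    qed
    show ?thesis using 1 2 by (simp add: half_rel_def coloring_def)
  qed
  have dir2: "\<exists>b. (a, b) \<in> color_rel n f \<and> (c, b) \<in> color_rel n f" if ac: "(a, c) \<in> half_rel n (upper n f)" for a c
  proof -
    \<comment> \<open>Transversals carry the colours of \<open>a\<close> down; lower arcs get the
      default colour \<open>False\<close>.\<close>
    let ?b = "\<lambda>y. f (2 * n + 1 - y) \<le> n \<and> a (f (2 * n + 1 - y))"
    have eq: "a x = c x" if "x \<in> {1..n}" "n < f x" for x
      using ac that by (auto simp: half_rel_def defects_def upper_def)
    have up: "a (f x) = a x" "c (f x) = c x" if "x \<in> {1..n}" "f x \<le> n" for x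
    proof -
      have "a (upper n f x) = a x" "c (upper n f x) = c x" using ac that(1) unfolding half_rel_def coloring_def by blast+
      then show "a (f x) = a x" "c (f x) = c x" using that by (simp_all add: upper_def)
    qed
    have col: "(d, ?b) \<in> color_rel n f" if d: "\<And>x. x \<in> {1..n} \<Longrightarrow> n < f x \<Longrightarrow> d x = a x"
      "\<And>x. x \<in> {1..n} \<Longrightarrow> f x \<le> n \<Longrightarrow> d (f x) = d x" for d
    proof -
      have "join_colors n d ?b (f x) = join_colors n d ?b x" if x: "x \<in> {1..2*n}" for x
      proof -
        have fx: "f x \<in> {1..2*n}" "f (f x) = x" using D x by auto
        have r: "2 * n + 1 - (2 * n + 1 - x) = x" "2 * n + 1 - (2 * n + 1 - f x) = f x" using x fx by auto
        show ?thesis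
        proof (cases "x \<le> n")
          case True
          then show ?thesis using d[of x] x fx r by (cases "f x \<le> n") (auto simp: join_colors_def)
        next
          case False
          then show ?thesis using d(1)[of "f x"] x fx r by (cases "f x \<le> n") (auto simp: join_colors_def)
        qed
      qed
      then show ?thesis by (simp add: color_rel_def coloring_def)
    qed
    have "(a, ?b) \<in> color_rel n f" by (rule col) (use up in auto)
    moreover have "(c, ?b) \<in> color_rel n f" by (rule col) (use eq up in auto)
    ultimately show ?thesis by blast
  qed
  show ?thesis
  proof (rule Set.set_eqI)
    fix p :: "(nat \<Rightarrow> bool) \<times> (nat \<Rightarrow> bool)"
    obtain a c where p: "p = (a, c)" by (cases p)
    show "p \<in> color_rel n f O (color_rel n f)\<inverse> \<longleftrightarrow> p \<in> half_rel n (upper n f)"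
      unfolding p using dir1[of a _ c] dir2[of a c] by blast
  qed
qed

text \<open>The sum of three colourings over the field with two elements is again a colouring. This
  yields regularity of the monoid.\<close>

lemma color_rel_difunctional:
  assumes "(a, b) \<in> color_rel n f" "(c, b) \<in> color_rel n f" "(c, d) \<in> color_rel n f"
  shows "(a, d) \<in> color_rel n f"
proof -
  have "join_colors n a d x = (join_colors n a b x \<noteq> (join_colors n c b x \<noteq> join_colors n c d x))" for x
    by (auto simp: join_colors_def)
  then show ?thesis using assms by (simp add: color_rel_def coloring_def)
qed

text \<open>Every colouring of the product has equal colours at \<open>x\<close> and
  \<open>f x\<close>; testing this with the indicator of the arc of \<open>k\<close> at
  \<open>x\<close> identifies that arc.\<close>

lemma upper_comp:
  assumes f: "tl_matching n f" and k: "tl_matching n k" and rel: "color_rel n k = color_rel n f O color_rel n g"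
    and x: "x \<in> {1..n}" "f x \<le> n"
  shows "k x = f x"
proof -
  have all: "a x = a (f x)" if ab: "(a, b) \<in> color_rel n k" for a b
  proof -
    obtain m where "(a, m) \<in> color_rel n f" using ab unfolding rel by blast
    then have "join_colors n a m (f x) = join_colors n a m x"
      using x unfolding color_rel_def coloring_def by auto
    then show ?thesis using x by (simp add: join_colors_def)
  qed
  let ?c = "\<lambda>z. z = x \<or> z = k x"
  have x2: "x \<in> {1..2*n}" using x by auto
  have j: "join_colors n ?c (\<lambda>z. ?c (2 * n + 1 - z)) z = ?c z" if "z \<in> {1..2*n}" for z
    using that by (auto simp: join_colors_def)
  have "?c (k y) = ?c y" if "y \<in> {1..2*n}" for y
    using tl_matchingD[OF k] that x2 by metis
  then have "(?c, \<lambda>z. ?c (2 * n + 1 - z)) \<in> color_rel n k"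
    unfolding color_rel_def coloring_def using j tl_matchingD(1)[OF k] by simp
  then have "?c (f x)" using all by blast
  then show ?thesis using tl_matchingD(3)[OF f x2] by auto
qed

lemma defects_upper:
  assumes "tl_matching n f"
  shows "defects n (upper n f) = {x \<in> {1..n}. n < f x}"
proof -
  have "upper n f x = x \<longleftrightarrow> n < f x" if "x \<in> {1..n}" for x
    using tl_matchingD(3)[OF assms, of x] that by (auto simp: upper_def)
  then show ?thesis unfolding defects_def by blast
qed

text \<open>Both numbers count the transversals, by their lower and by their upper ends.\<close>

lemma card_defects_mirror:
  assumes "tl_matching n f"
  shows "card (defects n (upper n (mirror n f))) = card (defects n (upper n f))"
proof -
  note D = tl_matchingD[OF assms] and M = tl_matchingD[OF tl_matching_mirror[OF assms]]
  have "bij_betw (\<lambda>x. 2 * n + 1 - f x) {x \<in> {1..n}. n < f x} {x \<in> {1..n}. n < mirror n f x}"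
  proof (rule bij_betw_byWitness[where f' = "\<lambda>x. f (2 * n + 1 - x)"])
    have A: "2 * n + 1 - f x \<in> {1..n}" "2 * n + 1 - (2 * n + 1 - f x) = f x" "f (f x) = x" 
      if x: "x \<in> {1..n}" "n < f x" for x
    proof -
      have "f x \<in> {1..2*n}" "f (f x) = x" using D[of x] x by auto
      then show "2 * n + 1 - f x \<in> {1..n}" "2 * n + 1 - (2 * n + 1 - f x) = f x" "f (f x) = x" using x by auto
    qed
    have B: "f (2 * n + 1 - y) \<in> {1..n}" "f (f (2 * n + 1 - y)) = 2 * n + 1 - y" "2 * n + 1 - (2 * n + 1 - y) = y" 
      if y: "y \<in> {1..n}" "n < mirror n f y" for y
    proof -
      have "2 * n + 1 - y \<in> {1..2*n}" "2 * n + 1 - (2 * n + 1 - y) = y" using y by auto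
      moreover note D[OF this(1)]
      ultimately show "f (2 * n + 1 - y) \<in> {1..n}" "f (f (2 * n + 1 - y)) = 2 * n + 1 - y" "2 * n + 1 - (2 * n + 1 - y) = y"
        using y(2) by simp_all
    qed
    show "\<forall>a\<in>{x \<in> {1..n}. n < f x}. f (2 * n + 1 - (2 * n + 1 - f a)) = a"
      using A(2,3) by simp
    show "\<forall>a'\<in>{x \<in> {1..n}. n < mirror n f x}. 2 * n + 1 - f (f (2 * n + 1 - a')) = a'"
      using B by simp
    have "n < mirror n f (2 * n + 1 - f x)" if "x \<in> {1..n}" "n < f x" for x
      using A[OF that] that(1) by simp linarith
    then show "(\<lambda>x. 2 * n + 1 - f x) ` {x \<in> {1..n}. n < f x} \<subseteq> {x \<in> {1..n}. n < mirror n f x}"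
      using A(1) by blast
    have "n < f (f (2 * n + 1 - y))" if "y \<in> {1..n}" "n < mirror n f y" for y
      using B[OF that] that(1) by simp linarith
    then show "(\<lambda>x. f (2 * n + 1 - x)) ` {x \<in> {1..n}. n < mirror n f x} \<subseteq> {x \<in> {1..n}. n < f x}"
      using B(1) by blast
  qed
  then show ?thesis
    using bij_betw_same_card defects_upper[OF assms] defects_upper[OF tl_matching_mirror[OF assms]] by metis
qed

section \<open>Products, and diagrams with prescribed halves\<close>

lemma nc_matching_transport:
  assumes f: "nc_matching V f" and fin: "finite X"
    and s: "\<And>x. x \<in> X \<Longrightarrow> s x \<in> V" "\<And>x y. x \<in> X \<Longrightarrow> y \<in> X \<Longrightarrow> x < y \<Longrightarrow> s x < s y"
    and t: "\<And>v. v \<in> V \<Longrightarrow> t v \<in> X" "\<And>v. v \<in> V \<Longrightarrow> s (t v) = v" "\<And>x. x \<in> X \<Longrightarrow> t (s x) = x"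
  shows "nc_matching X (\<lambda>x. t (f (s x)))"
proof -
  have m: "matching_on V f" using f by (simp add: nc_matching_def)
  have fs: "f (s x) \<in> V" "f (f (s x)) = s x" "f (s x) \<noteq> s x" if "x \<in> X" for x
    using matching_onD[OF m s(1)[OF that]] by auto
  have g: "s (t (f (s x))) = f (s x)" if "x \<in> X" for x using t(2) fs(1)[OF that] by simp
  have "matching_on X (\<lambda>x. t (f (s x)))"
    unfolding matching_on_def
  proof (intro conjI ballI fin)
    fix x assume x: "x \<in> X"
    show "t (f (s x)) \<in> X" using t(1) fs(1)[OF x] by simp
    show "t (f (s (t (f (s x))))) = x" using g[OF x] fs(2)[OF x] t(3)[OF x] by simp
    show "t (f (s x)) \<noteq> x" using g[OF x] fs(3)[OF x] by metis
  qed
  moreover have "\<not> (x < y \<and> y < t (f (s x)) \<and> t (f (s x)) < t (f (s y)))" if x: "x \<in> X" and y: "y \<in> X" for x y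
  proof
    assume A: "x < y \<and> y < t (f (s x)) \<and> t (f (s x)) < t (f (s y))"
    have X: "t (f (s x)) \<in> X" "t (f (s y)) \<in> X" using t(1) fs(1) x y by auto
    have "s x < s y" using s(2)[OF x y] A by simp
    moreover have "s y < f (s x)" using s(2)[OF y X(1)] A g[OF x] by simp
    moreover have "f (s x) < f (s y)" using s(2)[OF X] A g[OF x] g[OF y] by simp
    ultimately show False using f s(1)[OF x] s(1)[OF y] unfolding nc_matching_def by blast
  qed
  ultimately show ?thesis by (simp add: nc_matching_def)
qed

lemma tl_matching_no_cross:
  assumes "tl_matching n f" "x \<in> {1..2*n}" "y \<in> {1..2*n}"
  shows "\<not> (x < y \<and> y < f x \<and> f x < f y)"
  using bspec[OF bspec[OF conjunct2[OF assms(1)[unfolded tl_matching_def nc_matching_def]] assms(2)] assms(3)] .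

text \<open>The lower vertex \<open>i\<close> of the left factor sits at
  \<open>2 * n + 1 - i\<close>, the upper vertex \<open>i\<close> of the right factor at
  \<open>2 * n + i\<close>. These pairs are nested around the middle, so removing them in the order
  of \<open>i\<close> always contracts two neighbours.\<close>

lemma contract_middle:
  assumes F: "nc_matching {1..4*n} F" and "j \<le> n"
  shows "\<exists>F'. nc_matching ({1..2*n-j} \<union> {2*n+j+1..4*n}) F' \<and>
    (\<forall>c. coloring ({1..2*n-j} \<union> {2*n+j+1..4*n}) F' c \<longleftrightarrow>
      (\<exists>c'. (\<forall>x\<in>{1..2*n-j} \<union> {2*n+j+1..4*n}. c' x = c x) \<and> coloring {1..4*n} F c' \<and>
        (\<forall>i\<in>{1..j}. c' (2 * n + 1 - i) = c' (2 * n + i))))"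
  using \<open>j \<le> n\<close>
proof (induction j)
  case 0
  have V: "{1..2*n-0} \<union> {2*n+0+1..4*n} = {1..4*n}" by auto
  have "coloring {1..4*n} F c \<longleftrightarrow> (\<exists>c'. (\<forall>x\<in>{1..4*n}. c' x = c x) \<and> coloring {1..4*n} F c' \<and>
      (\<forall>i\<in>{1..0}. c' (2 * n + 1 - i) = c' (2 * n + i)))" for c
  proof
    assume "\<exists>c'. (\<forall>x\<in>{1..4*n}. c' x = c x) \<and> coloring {1..4*n} F c' \<and>
      (\<forall>i\<in>{1..0}. c' (2 * n + 1 - i) = c' (2 * n + i))"
    then obtain c' where c': "\<forall>x\<in>{1..4*n}. c' x = c x" "coloring {1..4*n} F c'" by blast
    have "F x \<in> {1..4*n}" if "x \<in> {1..4*n}" for x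
      using F that matching_onD(1) unfolding nc_matching_def by blast
    then show "coloring {1..4*n} F c" using c' by (simp add: coloring_def)
  next
    assume "coloring {1..4*n} F c"
    then show "\<exists>c'. (\<forall>x\<in>{1..4*n}. c' x = c x) \<and> coloring {1..4*n} F c' \<and>
      (\<forall>i\<in>{1..0}. c' (2 * n + 1 - i) = c' (2 * n + i))"
      by (intro exI[of _ c]) auto
  qed
  then show ?case unfolding V using F by blast
next
  case (Suc j)
  let ?V = "{1..2*n-j} \<union> {2*n+j+1..4*n}" and ?p = "2 * n - j" and ?q = "2 * n + j + 1"
  obtain F' where F': "nc_matching ?V F'"
    "\<And>c. coloring ?V F' c \<longleftrightarrow> (\<exists>c'. (\<forall>x\<in>?V. c' x = c x) \<and> coloring {1..4*n} F c' \<and>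
        (\<forall>i\<in>{1..j}. c' (2 * n + 1 - i) = c' (2 * n + i)))"
    using Suc.IH[OF Suc_leD[OF Suc.prems]] by blast
  have pq: "consecutive ?V ?p ?q" using Suc.prems by (auto simp: consecutive_def)
  have V: "{1..2*n-Suc j} \<union> {2*n+Suc j+1..4*n} = ?V - {?p, ?q}" using Suc.prems by auto
  have m: "matching_on ?V F'" using F' by (simp add: nc_matching_def)
  have P: "?p \<in> ?V" "?q \<in> ?V" "?p \<noteq> ?q" using Suc.prems by auto
  have set: "{1..Suc j} = insert (Suc j) {1..j}" by auto
  have ends: "2 * n + 1 - Suc j = ?p" "2 * n + Suc j = ?q" using Suc.prems by auto
  have "coloring (?V - {?p, ?q}) (contract ?p ?q F') c \<longleftrightarrow>
      (\<exists>c'. (\<forall>x\<in>?V - {?p, ?q}. c' x = c x) \<and> coloring {1..4*n} F c' \<and>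
        (\<forall>i\<in>{1..Suc j}. c' (2 * n + 1 - i) = c' (2 * n + i)))" (is "?L \<longleftrightarrow> ?R") for c
  proof
    assume ?L
    then obtain c1 where c1: "\<forall>x\<in>?V - {?p, ?q}. c1 x = c x" "coloring ?V F' c1" "c1 ?p = c1 ?q"
      using coloring_contract[OF m P] by blast
    then obtain c2 where c2: "\<forall>x\<in>?V. c2 x = c1 x" "coloring {1..4*n} F c2"
        "\<forall>i\<in>{1..j}. c2 (2 * n + 1 - i) = c2 (2 * n + i)" using F'(2) by blast
    have "\<forall>i\<in>{1..Suc j}. c2 (2 * n + 1 - i) = c2 (2 * n + i)"
      using c2 c1 P unfolding set ball_simps ends by auto
    then show ?R using c1 c2 by (intro exI[of _ c2]) auto
  next
    assume ?R
    then obtain c1 where c1: "\<forall>x\<in>?V - {?p, ?q}. c1 x = c x" "coloring {1..4*n} F c1"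
        "\<forall>i\<in>{1..Suc j}. c1 (2 * n + 1 - i) = c1 (2 * n + i)" by blast
    have "c1 (2 * n + 1 - Suc j) = c1 (2 * n + Suc j)" using bspec[OF c1(3), of "Suc j"] by simp
    then have "c1 ?p = c1 ?q" unfolding ends .
    moreover have "\<forall>i\<in>{1..j}. c1 (2 * n + 1 - i) = c1 (2 * n + i)" using c1(3) by simp
    then have "coloring ?V F' c1" using F'(2)[of c1] c1(2) by blast
    ultimately show ?L using coloring_contract[OF m P] c1(1) by blast
  qed
  then show ?case unfolding V using nc_contract[OF F'(1) pq] by blast
qed

text \<open>The product: both diagrams are put side by side on \<open>4n\<close> points and the arcs meeting in the
  middle are contracted one after the other, which never creates a crossing.\<close>

lemma tl_product:
  assumes f: "tl_matching n f" and g: "tl_matching n g"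
  shows "\<exists>k. tl_matching n k \<and> color_rel n k = color_rel n f O color_rel n g"
proof -
  note D = tl_matchingD[OF f] and E = tl_matchingD[OF g]
  define F where "F x = (if x \<le> 2 * n then f x else 2 * n + g (x - 2 * n))" for x
  have low: "F x = f x" "F x \<in> {1..2*n}" "F (F x) = x" "F x \<noteq> x" if "x \<in> {1..2*n}" for x
    using D[OF that] that by (auto simp: F_def)
  have high: "F (2 * n + x) = 2 * n + g x" "g x \<in> {1..2*n}" "F (F (2 * n + x)) = 2 * n + x" "g x \<noteq> x" if "x \<in> {1..2*n}" for x
    using E[OF that] that by (auto simp: F_def)
  have split: "x \<in> {1..2*n} \<or> (\<exists>y\<in>{1..2*n}. x = 2 * n + y)" if "x \<in> {1..4*n}" for x
  proof (cases "x \<le> 2 * n")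
    case False
    then have "x - 2 * n \<in> {1..2*n}" "x = 2 * n + (x - 2 * n)" using that by auto
    then show ?thesis by blast
  qed (use that in auto)
  have mF: "F x \<in> {1..4*n} \<and> F (F x) = x \<and> F x \<noteq> x" if "x \<in> {1..4*n}" for x
    using split[OF that]
  proof (elim disjE bexE)
    assume x: "x \<in> {1..2*n}"
    then show ?thesis using low[OF x] by auto
  next
    fix y assume y: "y \<in> {1..2*n}" "x = 2 * n + y"
    show ?thesis using high[OF y(1)] unfolding y(2) by auto
  qed
  have "\<not> (x < y \<and> y < F x \<and> F x < F y)" if x: "x \<in> {1..4*n}" and y: "y \<in> {1..4*n}" for x y
  proof
    assume A: "x < y \<and> y < F x \<and> F x < F y"
    show False
      using split[OF x] split[OF y]
    proof (elim disjE bexE)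
      assume xy: "x \<in> {1..2*n}" "y \<in> {1..2*n}"
      then show False using A low(1)[OF xy(1)] low(1)[OF xy(2)] tl_matching_no_cross[OF f xy] by simp
    next
      fix y' assume "x \<in> {1..2*n}" "y' \<in> {1..2*n}" "y = 2 * n + y'"
      then show False using A low(2)[of x] by auto
    next
      fix x' assume "y \<in> {1..2*n}" "x' \<in> {1..2*n}" "x = 2 * n + x'"
      then show False using A by auto
    next
      fix x' y' assume xy: "x' \<in> {1..2*n}" "x = 2 * n + x'" "y' \<in> {1..2*n}" "y = 2 * n + y'"
      have "x' < y' \<and> y' < g x' \<and> g x' < g y'" using A high(1)[OF xy(1)] high(1)[OF xy(3)] unfolding xy(2,4) by auto
      then show False using tl_matching_no_cross[OF g xy(1,3)] by blast
    qed
  qed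
  then have F: "nc_matching {1..4*n} F" using mF by (simp add: nc_matching_def matching_on_def)
  have Fcol: "coloring {1..4*n} F c \<longleftrightarrow> coloring {1..2*n} f c \<and> coloring {1..2*n} g (\<lambda>x. c (2 * n + x))" for c
  proof
    assume c: "coloring {1..4*n} F c"
    have "c (f x) = c x" if x: "x \<in> {1..2*n}" for x
    proof -
      have "x \<in> {1..4*n}" using x by auto
      then show ?thesis using c low(1)[OF x] unfolding coloring_def by metis
    qed
    moreover have "c (2 * n + g x) = c (2 * n + x)" if x: "x \<in> {1..2*n}" for x
    proof -
      have "2 * n + x \<in> {1..4*n}" using x by auto
      then show ?thesis using c high(1)[OF x] unfolding coloring_def by metis
    qed
    ultimately show "coloring {1..2*n} f c \<and> coloring {1..2*n} g (\<lambda>x. c (2 * n + x))" by (simp add: coloring_def)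
  next
    assume c: "coloring {1..2*n} f c \<and> coloring {1..2*n} g (\<lambda>x. c (2 * n + x))"
    show "coloring {1..4*n} F c"
      unfolding coloring_def
    proof
      fix x assume "x \<in> {1..4*n}"
      from split[OF this] show "c (F x) = c x"
      proof (elim disjE bexE)
        assume x: "x \<in> {1..2*n}"
        show ?thesis using c x low(1)[OF x] by (simp add: coloring_def)
      next
        fix y assume y: "y \<in> {1..2*n}" "x = 2 * n + y"
        then show ?thesis using c high(1)[OF y(1)] by (simp add: coloring_def)
      qed
    qed
  qed
  let ?V = "{1..2*n-n} \<union> {2*n+n+1..4*n}"
  obtain F' where F': "nc_matching ?V F'"
    "\<And>c. coloring ?V F' c \<longleftrightarrow> (\<exists>c'. (\<forall>x\<in>?V. c' x = c x) \<and> coloring {1..4*n} F c' \<and>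
        (\<forall>i\<in>{1..n}. c' (2 * n + 1 - i) = c' (2 * n + i)))"
    using contract_middle[OF F order_refl] by blast
  \<comment> \<open>\<open>s\<close> and \<open>t\<close> renumber the outer points monotonically,
    closing the gap left by the two middle rows.\<close>
  define s where "s x = (if x \<le> n then x else x + 2 * n)" for x
  define t where "t x = (if x \<le> n then x else x - 2 * n)" for x
  have st: "\<And>x. x \<in> {1..2*n} \<Longrightarrow> s x \<in> ?V" "\<And>x y. x < y \<Longrightarrow> s x < s y"
    "\<And>v. v \<in> ?V \<Longrightarrow> t v \<in> {1..2*n}" "\<And>v. v \<in> ?V \<Longrightarrow> s (t v) = v" "\<And>x. t (s x) = x"
    by (auto simp: s_def t_def)
  define k where "k x = t (F' (s x))" for x
  have k: "tl_matching n k"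
    unfolding tl_matching_def k_def by (rule nc_matching_transport[OF F'(1)]) (use st in auto)
  have F'V: "F' v \<in> ?V" if "v \<in> ?V" for v
    using F'(1) that matching_onD(1) unfolding nc_matching_def by blast
  have kcol: "coloring {1..2*n} k c \<longleftrightarrow> coloring ?V F' (\<lambda>v. c (t v))" for c
  proof
    assume c: "coloring {1..2*n} k c"
    show "coloring ?V F' (\<lambda>v. c (t v))"
      unfolding coloring_def
    proof
      fix v assume v: "v \<in> ?V"
      then have "c (k (t v)) = c (t v)" using c st(3) unfolding coloring_def by blast
      then show "c (t (F' v)) = c (t v)" using st(4)[OF v] by (simp add: k_def)
    qed
  next
    assume c: "coloring ?V F' (\<lambda>v. c (t v))"
    show "coloring {1..2*n} k c"
      unfolding coloring_def k_def
    proof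
      fix x assume "x \<in> {1..2*n}"
      then have "c (t (F' (s x))) = c (t (s x))" using c st(1) unfolding coloring_def by blast
      then show "c (t (F' (s x))) = c x" using st(5) by simp
    qed
  qed
  have cong: "coloring {1..2*n} h c \<longleftrightarrow> coloring {1..2*n} h c'" if h: "tl_matching n h" and "\<And>x. x \<in> {1..2*n} \<Longrightarrow> c x = c' x" for h c c'
    using tl_matchingD(1)[OF h] that(2) by (simp add: coloring_def)
  have eq: "(a, b) \<in> color_rel n k \<longleftrightarrow> (a, b) \<in> color_rel n f O color_rel n g" for a b
  proof
    assume "(a, b) \<in> color_rel n k"
    then have "coloring ?V F' (\<lambda>v. join_colors n a b (t v))" using kcol[of "join_colors n a b"] by (simp add: color_rel_def)
    from iffD1[OF F'(2) this] obtain c where c: "\<forall>x\<in>?V. c x = join_colors n a b (t x)" "coloring {1..4*n} F c"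
       "\<forall>i\<in>{1..n}. c (2 * n + 1 - i) = c (2 * n + i)"
      by blast
    \<comment> \<open>The two copies of the middle row have equal colours, so either copy serves as
      intermediate colouring.\<close>
    let ?m = "\<lambda>i. c (2 * n + i)"
    have fc: "coloring {1..2*n} f c" "coloring {1..2*n} g (\<lambda>x. c (2 * n + x))" using Fcol[of c] c(2) by simp_all
    have jm: "join_colors n a ?m x = c x" if x: "x \<in> {1..2*n}" for x
    proof (cases "x \<le> n")
      case True
      then show ?thesis using c(1) x by (auto simp: join_colors_def t_def)
    next
      case False
      have "2 * n + 1 - x \<in> {1..n}" "2 * n + 1 - (2 * n + 1 - x) = x" using False x by auto
      then have "c x = c (2 * n + (2 * n + 1 - x))" using c(3) by metis
      then show ?thesis using False by (simp add: join_colors_def)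
    qed
    have "(a, ?m) \<in> color_rel n f" using iffD2[OF cong[OF f jm] fc(1)] by (simp add: color_rel_def)
    moreover have jm': "join_colors n ?m b x = c (2 * n + x)" if x: "x \<in> {1..2*n}" for x
    proof (cases "x \<le> n")
      case False
      have "2 * n + x \<in> ?V" "t (2 * n + x) = x" using False x by (auto simp: t_def)
      then show ?thesis using c(1) False by (simp add: join_colors_def)
    qed (simp add: join_colors_def)
    have "(?m, b) \<in> color_rel n g" using iffD2[OF cong[OF g jm'] fc(2)] by (simp add: color_rel_def)
    ultimately show "(a, b) \<in> color_rel n f O color_rel n g" by blast
  next
    assume "(a, b) \<in> color_rel n f O color_rel n g"
    then obtain m where m: "(a, m) \<in> color_rel n f" "(m, b) \<in> color_rel n g" by blast
    let ?c = "\<lambda>x. if x \<le> 2 * n then join_colors n a m x else join_colors n m b (x - 2 * n)"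
    have "coloring {1..2*n} f (join_colors n a m)" using m(1) by (simp add: color_rel_def)
    then have "coloring {1..2*n} f ?c" by (rule iffD1[OF cong[OF f], rotated]) simp
    moreover have "coloring {1..2*n} g (join_colors n m b)" using m(2) by (simp add: color_rel_def)
    then have "coloring {1..2*n} g (\<lambda>x. ?c (2 * n + x))" by (rule iffD1[OF cong[OF g], rotated]) simp
    ultimately have "coloring {1..4*n} F ?c" by (intro iffD2[OF Fcol] conjI)
    moreover have "?c (2 * n + 1 - i) = ?c (2 * n + i)" if "i \<in> {1..n}" for i
    proof -
      have "2 * n + 1 - i \<le> 2 * n" "\<not> 2 * n + 1 - i \<le> n" "2 * n + 1 - (2 * n + 1 - i) = i" "\<not> 2 * n + i \<le> 2 * n"
        using that by auto
      then show ?thesis using that by (simp add: join_colors_def)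
    qed
    moreover have "?c x = join_colors n a b (t x)" if "x \<in> ?V" for x
    proof (cases "x \<le> n")
      case False
      then have "\<not> x \<le> 2 * n" "\<not> x - 2 * n \<le> n" using that by auto
      then show ?thesis using False by (simp add: join_colors_def t_def)
    qed (simp add: join_colors_def t_def)
    ultimately have "coloring ?V F' (\<lambda>v. join_colors n a b (t v))"
      by (intro iffD2[OF F'(2)] exI[of _ ?c] conjI ballI)
    then show "(a, b) \<in> color_rel n k"
      using kcol[of "join_colors n a b"] by (simp add: color_rel_def)
  qed
  have "color_rel n k = color_rel n f O color_rel n g"
    by (rule equalityI; rule subrelI) (erule iffD1[OF eq], erule iffD2[OF eq])
  then show ?thesis using k by blast
qed

lemma even_card_paired:
  assumes "tl_matching n f"
  shows "even (n + card (defects n (upper n f)))"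
proof -
  note D = tl_matchingD[OF assms]
  have "matching_on {x \<in> {1..n}. f x \<le> n} f"
    unfolding matching_on_def
  proof (intro conjI ballI)
    fix x assume "x \<in> {x \<in> {1..n}. f x \<le> n}"
    then have "x \<in> {1..2*n}" "x \<in> {1..n}" "f x \<le> n" by auto
    then show "f x \<in> {x \<in> {1..n}. f x \<le> n}" "f (f x) = x" "f x \<noteq> x" using D[of x] by auto
  qed simp
  then have "even (card {x \<in> {1..n}. f x \<le> n})" by (rule even_card_matching)
  moreover have "card {x \<in> {1..n}. f x \<le> n} + card {x \<in> {1..n}. n < f x} = card {1..n}"
  proof -
    have "{1..n} = {x \<in> {1..n}. f x \<le> n} \<union> {x \<in> {1..n}. n < f x}" by auto
    then have "card {1..n} = card ({x \<in> {1..n}. f x \<le> n} \<union> {x \<in> {1..n}. n < f x})" by (rule arg_cong)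
    also have "\<dots> = card {x \<in> {1..n}. f x \<le> n} + card {x \<in> {1..n}. n < f x}"
      by (rule card_Un_disjoint) auto
    finally show ?thesis by simp
  qed
  ultimately show ?thesis unfolding defects_upper[OF assms] card_atLeastAtMost by presburger
qed

text \<open>The i-th free end of \<open>g\<close> is joined to the i-th free end of
  \<open>h\<close>. Lower positions run backwards, so this order preserving bijection gives nested
  transversals, which do not cross.\<close>

lemma tl_matching_halves_exist:
  assumes g: "half_diagram n g" and h: "half_diagram n h" and card: "card (defects n g) = card (defects n h)"
  shows "\<exists>f. tl_matching n f \<and> (\<forall>x\<in>{1..n}. upper n f x = g x \<and> upper n (mirror n f) x = h x)"
proof -
  have fin: "finite (defects n k)" for k by (simp add: defects_def)
  obtain e1 e2 where e1: "bij_betw e1 {..<card (defects n g)} (defects n g)" "strict_mono_on {..<card (defects n g)} e1"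
    and e2: "bij_betw e2 {..<card (defects n g)} (defects n h)" "strict_mono_on {..<card (defects n g)} e2"
  proof -
    obtain e1 where "bij_betw e1 {..<card (defects n g)} (defects n g)" "strict_mono_on {..<card (defects n g)} e1"
      by (rule ex_bij_betw_strict_mono_card[OF fin[of g]])
    moreover obtain e2 where "bij_betw e2 {..<card (defects n h)} (defects n h)" "strict_mono_on {..<card (defects n h)} e2"
      by (rule ex_bij_betw_strict_mono_card[OF fin[of h]])
    ultimately show ?thesis using that card by simp
  qed
  define \<phi> where "\<phi> x = e2 (the_inv_into {..<card (defects n g)} e1 x)" for x
  define \<psi> where "\<psi> x = e1 (the_inv_into {..<card (defects n g)} e2 x)" for x
  have \<phi>: "\<phi> x \<in> defects n h" "\<psi> (\<phi> x) = x" if x: "x \<in> defects n g" for x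
  proof -
    obtain i where i: "i \<in> {..<card (defects n g)}" "x = e1 i" using e1(1) x by (auto simp: bij_betw_def)
    then have "\<phi> x = e2 i" using e1(1) by (simp add: \<phi>_def bij_betw_def the_inv_into_f_f)
    then show "\<phi> x \<in> defects n h" "\<psi> (\<phi> x) = x" using e2(1) i by (auto simp: \<psi>_def bij_betw_def the_inv_into_f_f)
  qed
  have \<psi>: "\<psi> x \<in> defects n g" "\<phi> (\<psi> x) = x" if x: "x \<in> defects n h" for x
  proof -
    obtain i where i: "i \<in> {..<card (defects n g)}" "x = e2 i" using e2(1) x by (auto simp: bij_betw_def)
    then have "\<psi> x = e1 i" using e2(1) by (simp add: \<psi>_def bij_betw_def the_inv_into_f_f)
    then show "\<psi> x \<in> defects n g" "\<phi> (\<psi> x) = x" using e1(1) i by (auto simp: \<phi>_def bij_betw_def the_inv_into_f_f)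
  qed
  have mono: "\<phi> x < \<phi> y" if x: "x \<in> defects n g" and y: "y \<in> defects n g" and xy: "x < y" for x y
  proof -
    obtain i j where i: "i \<in> {..<card (defects n g)}" "x = e1 i" and j: "j \<in> {..<card (defects n g)}" "y = e1 j"
    proof -
      have "x \<in> e1 ` {..<card (defects n g)}" "y \<in> e1 ` {..<card (defects n g)}"
        using e1(1) x y by (simp_all add: bij_betw_def)
      then show ?thesis using that by blast
    qed
    then have "\<phi> x = e2 i" "\<phi> y = e2 j" using e1(1) by (simp_all add: \<phi>_def bij_betw_def the_inv_into_f_f)
    moreover have "i < j"
    proof (rule ccontr)
      assume "\<not> i < j"
      then have "j < i \<or> i = j" by linarith
      then show False using strict_mono_onD[OF e1(2) j(1) i(1)] i(2) j(2) xy by auto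
    qed
    ultimately show ?thesis using strict_mono_onD[OF e2(2) i(1) j(1)] by simp
  qed
  \<comment> \<open>\<open>low\<close> is indexed by the lower vertex, \<open>f\<close> by the
    boundary position.\<close>
  define low where "low j = (if h j \<noteq> j then 2 * n + 1 - h j else \<psi> j)" for j
  define f where "f x = (if x \<le> n then (if g x \<noteq> x then g x else 2 * n + 1 - \<phi> x) else low (2 * n + 1 - x))" for x
  note G = half_diagramD[OF g] and H = half_diagramD[OF h]
  have d: "x \<in> {1..n}" "k x = x" if "x \<in> defects n k" for x k using that by (auto simp: defects_def)
  have f_arc: "f x = g x" if "x \<le> n" "g x \<noteq> x" for x using that by (simp add: f_def)
  have f_def': "f x = 2 * n + 1 - \<phi> x" if "x \<in> defects n g" for x using d[OF that] by (simp add: f_def)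
  have f_low: "f (2 * n + 1 - j) = low j" if "j \<in> {1..n}" for j
  proof -
    have "\<not> 2 * n + 1 - j \<le> n" "2 * n + 1 - (2 * n + 1 - j) = j" using that by auto
    then show ?thesis by (simp add: f_def)
  qed
  have f_larc: "f (2 * n + 1 - j) = 2 * n + 1 - h j" if "j \<in> {1..n}" "h j \<noteq> j" for j
    using f_low[OF that(1)] that by (simp add: low_def)
  have f_ldef: "f (2 * n + 1 - j) = \<psi> j" if "j \<in> defects n h" for j
    using f_low[OF d(1)[OF that]] d[OF that] by (simp add: low_def)
  have cases: "(x \<in> {1..n} \<and> g x \<noteq> x) \<or> x \<in> defects n g \<or> (\<exists>j\<in>{1..n}. h j \<noteq> j \<and> x = 2 * n + 1 - j) \<or> (\<exists>j\<in>defects n h. x = 2 * n + 1 - j)"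
    if x: "x \<in> {1..2*n}" for x
  proof (cases "x \<le> n")
    case False
    then have "2 * n + 1 - x \<in> {1..n}" "x = 2 * n + 1 - (2 * n + 1 - x)" using x by auto
    then show ?thesis unfolding defects_def by blast
  qed (use x in \<open>auto simp: defects_def\<close>)
  have m: "f x \<in> {1..2*n} \<and> f (f x) = x \<and> f x \<noteq> x" if x: "x \<in> {1..2*n}" for x
    using cases[OF x]
  proof (elim disjE bexE conjE)
    assume A: "x \<in> {1..n}" "g x \<noteq> x"
    have gx: "g x \<in> {1..n}" "g (g x) = x" "g (g x) \<noteq> g x" using G[OF A(1)] A by auto
    then have "f (g x) = x" using f_arc[of "g x"] by auto
    then show ?thesis using f_arc[of x] A gx by auto
  next
    assume A: "x \<in> defects n g"
    show ?thesis using f_def'[OF A] f_ldef[OF \<phi>(1)[OF A]] \<phi>(2)[OF A] d(1)[OF A] d(1)[OF \<phi>(1)[OF A]] by auto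
  next
    fix j assume A: "j \<in> {1..n}" "h j \<noteq> j" "x = 2 * n + 1 - j"
    have hj: "h j \<in> {1..n}" "h (h j) = j" "h (h j) \<noteq> h j" using H[OF A(1)] A by auto
    have "f (2 * n + 1 - h j) = 2 * n + 1 - j" using f_larc[OF hj(1,3)] hj by simp
    moreover have "2 * n + 1 - h j \<in> {1..2*n}" "2 * n + 1 - h j \<noteq> 2 * n + 1 - j" using hj(1) A by auto
    ultimately show ?thesis using f_larc[OF A(1,2)] A(3) by simp
  next
    fix j assume A: "j \<in> defects n h" "x = 2 * n + 1 - j"
    have "f (\<psi> j) = 2 * n + 1 - j" using f_def'[OF \<psi>(1)[OF A(1)]] \<psi>(2)[OF A(1)] by simp
    moreover have "\<psi> j \<in> {1..n}" "j \<in> {1..n}" using d(1) \<psi>(1)[OF A(1)] A by blast+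
    ultimately show ?thesis using f_ldef[OF A(1)] A(2) by auto
  qed
  have "\<not> (x < y \<and> y < f x \<and> f x < f y)" if x: "x \<in> {1..2*n}" and y: "y \<in> {1..2*n}" for x y
  proof
    assume A: "x < y \<and> y < f x \<and> f x < f y"
    show False
      using cases[OF x]
    proof (elim disjE bexE conjE)
      assume X: "x \<in> {1..n}" "g x \<noteq> x"
      have fx: "f x = g x" "g x \<le> n" using f_arc[of x] X G(1)[OF X(1)] by auto
      have "g y < g x" "g y \<noteq> y" using G(4,5)[OF X(1), of y] A fx by auto
      then show False using f_arc[of y] A fx by auto
    next
      assume X: "x \<in> defects n g"
      have fx: "f x = 2 * n + 1 - \<phi> x" "\<phi> x \<in> {1..n}" "h (\<phi> x) = \<phi> x" using f_def'[OF X] d[OF \<phi>(1)[OF X]] by auto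
      show False
        using cases[OF y]
      proof (elim disjE bexE conjE)
        assume Y: "y \<in> {1..n}" "g y \<noteq> y"
        then show False using f_arc[of y] A fx G(1)[OF Y(1)] by auto
      next
        assume Y: "y \<in> defects n g"
        show False using mono[OF X Y] A fx f_def'[OF Y] by auto
      next
        fix j assume Y: "j \<in> {1..n}" "h j \<noteq> j" "y = 2 * n + 1 - j"
        have hj: "h j \<in> {1..n}" "h (h j) = j" using H[OF Y(1)] by auto
        have "h j < \<phi> x" "\<phi> x < j" using A fx f_larc[OF Y(1,2)] Y(1,3) hj(1) by auto
        then show False using H(5)[OF hj(1), of "\<phi> x"] hj fx by auto
      next
        fix j assume Y: "j \<in> defects n h" "y = 2 * n + 1 - j"
        have "f y \<le> n" using f_ldef[OF Y(1)] d(1)[OF \<psi>(1)[OF Y(1)]] Y by auto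
        then show False using A fx by auto
      qed
    next
      fix i assume X: "i \<in> {1..n}" "h i \<noteq> i" "x = 2 * n + 1 - i"
      have hi: "h i \<in> {1..n}" "h (h i) = i" "f x = 2 * n + 1 - h i" using H[OF X(1)] f_larc[OF X(1,2)] X by auto
      define j where "j = 2 * n + 1 - y"
      have j: "y = 2 * n + 1 - j" "j \<in> {1..n}" "h i < j" "j < i" using A X hi y by (auto simp: j_def)
      have "h i < h j" "h j \<noteq> j" using H(3,5)[OF hi(1), of j] hi j by auto
      then have "f y = 2 * n + 1 - h j" using f_larc[OF j(2)] j by auto
      then show False using A hi \<open>h i < h j\<close> by auto
    next
      fix i assume X: "i \<in> defects n h" "x = 2 * n + 1 - i"
      have "f x \<le> n" using f_ldef[OF X(1)] d(1)[OF \<psi>(1)[OF X(1)]] X by auto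
      moreover have "n < x" using d(1)[OF X(1)] X by auto
      ultimately show False using A by auto
    qed
  qed
  then have tl: "tl_matching n f" using m by (simp add: tl_matching_def nc_matching_def matching_on_def)
  have "upper n f x = g x" if x: "x \<in> {1..n}" for x
  proof (cases "g x = x")
    case True
    then have xd: "x \<in> defects n g" using x by (simp add: defects_def)
    then have "\<not> f x \<le> n" using f_def'[OF xd] d(1)[OF \<phi>(1)[OF xd]] by auto
    then show ?thesis using True by (simp add: upper_def)
  next
    case False
    then show ?thesis using f_arc[of x] x G(1)[OF x] by (simp add: upper_def)
  qed
  moreover have "upper n (mirror n f) j = h j" if j: "j \<in> {1..n}" for j
  proof (cases "h j = j")
    case True
    then have jd: "j \<in> defects n h" using j by (simp add: defects_def)
    then have "\<not> mirror n f j \<le> n" using f_ldef[OF jd] d(1)[OF \<psi>(1)[OF jd]] by auto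
    then show ?thesis using True by (simp add: upper_def)
  next
    case False
    have "mirror n f j = h j" using f_larc[OF j False] H(1)[OF j] by auto
    then show ?thesis using H(1)[OF j] by (simp add: upper_def)
  qed
  ultimately show ?thesis using tl by blast
qed

section \<open>Separating diagrams by contraction\<close>

text \<open>Contracting \<open>f\<close> along its own lower arcs produces only loops, so
  \<open>f\<close> itself remains on the other points. The hypothesis on \<open>h\<close> is
  pointwise, so that the same \<open>h\<close> fits a second matching with the same lower
  half.\<close>

lemma reduce_lower_arcs:
  assumes f: "tl_matching n f" and h: "\<And>x. x \<in> {1..2*n} \<Longrightarrow> h x = (if n < x \<and> n < f x then f x else x)"
  shows "two_sided n h" "defects (2 * n) h = {1..n} \<union> {x \<in> {n+1..2*n}. f x \<le> n}"
    "nc_matching (defects (2 * n) h) f" "reduces_to n h f f"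
proof -
  note D = tl_matchingD[OF f]
  have ncf: "nc_matching {1..2*n} f" using f by (simp add: tl_matching_def)
  show "two_sided n h"
    unfolding two_sided_def half_diagram_def
  proof (intro conjI ballI)
    fix x assume x: "x \<in> {1..2*n}"
    have "x < h y \<and> h y < h x \<and> h y \<noteq> y" if y: "x < y" "y < h x" for y
    proof -
      have hx: "n < x" "n < f x" "h x = f x" using h[OF x] y by (auto split: if_splits)
      have Y: "y \<in> {1..2*n}" using y hx D(1)[OF x] x by auto
      have "x < f y" "f y < f x" using nc_matchingD[OF ncf x Y] y hx by auto
      then show ?thesis using h[OF Y] hx y D(3)[OF Y] by auto
    qed
    moreover have "h x \<in> {1..2*n}" "h (h x) = x" using h[OF x] h[OF D(1)[OF x]] D[OF x] x by auto
    ultimately show "h x \<in> {1..2*n}" "h (h x) = x" "\<forall>y. x < y \<and> y < h x \<longrightarrow> x < h y \<and> h y < h x \<and> h y \<noteq> y"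
      by blast+
    show "(h x \<le> n) = (x \<le> n)" using h[OF x] by auto
  qed
  have "h x = x \<longleftrightarrow> x \<le> n \<or> f x \<le> n" if "x \<in> {1..2*n}" for x
    using h[OF that] D(3)[OF that] by auto
  then have X: "x \<in> defects (2 * n) h \<longleftrightarrow> x \<in> {1..2*n} \<and> (x \<le> n \<or> f x \<le> n)" for x
    unfolding defects_def by blast
  have "x \<in> defects (2 * n) h \<longleftrightarrow> x \<in> {1..n} \<union> {x \<in> {n+1..2*n}. f x \<le> n}" for x
    unfolding X by auto
  then show "defects (2 * n) h = {1..n} \<union> {x \<in> {n+1..2*n}. f x \<le> n}" by (rule Set.set_eqI)
  have closed: "f x \<in> defects (2 * n) h" if "x \<in> defects (2 * n) h" for x
  proof -
    have x: "x \<in> {1..2*n}" "x \<le> n \<or> f x \<le> n" using that unfolding X by auto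
    then show ?thesis unfolding X using D(1,2)[OF x(1)] by auto
  qed
  have closed': "f x \<notin> defects (2 * n) h" if x: "x \<in> {1..2*n}" "x \<notin> defects (2 * n) h" for x
  proof -
    have "\<not> x \<le> n" "\<not> f x \<le> n" using x unfolding X by auto
    then show ?thesis unfolding X using D(1,2)[OF x(1)] by auto
  qed
  have sub: "x \<in> {1..2*n}" if "x \<in> defects (2 * n) h" for x using that X by blast
  have fin: "finite (defects (2 * n) h)" by (simp add: defects_def)
  show "nc_matching (defects (2 * n) h) f"
    unfolding nc_matching_def matching_on_def
  proof (intro conjI ballI fin)
    fix x assume x: "x \<in> defects (2 * n) h"
    show "f x \<in> defects (2 * n) h" "f (f x) = x" "f x \<noteq> x" using closed[OF x] D(2,3)[OF sub[OF x]] by auto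
    fix y assume "y \<in> defects (2 * n) h"
    then show "\<not> (x < y \<and> y < f x \<and> f x < f y)"
      using ncf sub[OF x] sub[of y] unfolding nc_matching_def by blast
  qed
  show "reduces_to n h f f"
    unfolding reduces_to_def
  proof (intro allI iffI)
    fix c assume c: "coloring (defects (2 * n) h) f c"
    \<comment> \<open>Points on the discarded arcs get the colour \<open>False\<close>.\<close>
    let ?c = "\<lambda>x. x \<in> defects (2 * n) h \<and> c x"
    have fc: "?c (f x) = ?c x" if x: "x \<in> {1..2*n}" for x
    proof (cases "x \<in> defects (2 * n) h")
      case True
      then show ?thesis using closed[OF True] c unfolding coloring_def by blast
    next
      case False
      then show ?thesis using closed'[OF x False] by blast
    qed
    moreover have "?c (h x) = ?c x" if x: "x \<in> {1..2*n}" for x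
    proof (cases "h x = x")
      case False
      then have "h x = f x" using h[OF x] by (auto split: if_splits)
      then show ?thesis using fc[OF x] by simp
    qed simp
    ultimately show "\<exists>c'. (\<forall>x\<in>defects (2 * n) h. c' x = c x) \<and> coloring {1..2*n} f c' \<and> coloring {1..2*n} h c'"
      by (intro exI[of _ ?c]) (simp add: coloring_def)
  next
    fix c assume "\<exists>c'. (\<forall>x\<in>defects (2 * n) h. c' x = c x) \<and> coloring {1..2*n} f c' \<and> coloring {1..2*n} h c'"
    then obtain c' where c': "\<And>x. x \<in> defects (2 * n) h \<Longrightarrow> c' x = c x" "coloring {1..2*n} f c'" by blast
    show "coloring (defects (2 * n) h) f c"
      unfolding coloring_def
    proof
      fix x assume x: "x \<in> defects (2 * n) h"
      have "c' (f x) = c' x" using c'(2) sub[OF x] unfolding coloring_def by blast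
      then show "c (f x) = c x" using c'(1)[OF x] c'(1)[OF closed[OF x]] by simp
    qed
  qed
qed

text \<open>The induction starts with no contraction at all (\<open>id\<close>); by
  \<open>contract_step\<close> mere difference is an invariant when both rows may be
  contracted.\<close>

lemma separate_two_sided:
  assumes f: "tl_matching n f" and g: "tl_matching n g" and ne: "x0 \<in> {1..2*n}" "f x0 \<noteq> g x0" and n: "n \<ge> 2"
  shows "\<exists>h. two_sided n h \<and> card (defects n h) + card (defects n (mirror n h)) = 4 \<and>
    half_rel n h O color_rel n f O half_rel n (mirror n h) \<noteq> half_rel n h O color_rel n g O half_rel n (mirror n h)"
proof -
  let ?Inv = "\<lambda>(h :: nat \<Rightarrow> nat) X a b. \<exists>x\<in>X. a x \<noteq> b x"
  have X: "{1..2*n} = defects (2 * n) id" by (auto simp: defects_def)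
  have id: "two_sided n id" by (simp add: two_sided_def half_diagram_def)
  have red: "reduces_to n id k k" if k: "tl_matching n k" for k
    unfolding reduces_to_def X[symmetric]
  proof (intro allI iffI)
    fix c assume "\<exists>c'. (\<forall>x\<in>{1..2*n}. c' x = c x) \<and> coloring {1..2*n} k c' \<and> coloring {1..2*n} id c'"
    then obtain c' where c': "\<And>x. x \<in> {1..2*n} \<Longrightarrow> c' x = c x" "coloring {1..2*n} k c'" by blast
    then show "coloring {1..2*n} k c" using tl_matchingD(1)[OF k] by (simp add: coloring_def)
  next
    fix c assume "coloring {1..2*n} k c"
    then show "\<exists>c'. (\<forall>x\<in>{1..2*n}. c' x = c x) \<and> coloring {1..2*n} k c' \<and> coloring {1..2*n} id c'"
      by (intro exI[of _ c]) (simp add: coloring_def)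
  qed
  have "\<exists>h a b. two_sided n h \<and> card (defects (2 * n) h) = 4 \<and> nc_matching (defects (2 * n) h) a \<and>
    nc_matching (defects (2 * n) h) b \<and> ?Inv h (defects (2 * n) h) a b \<and> reduces_to n h f a \<and> reduces_to n h g b"
  proof (rule reduce_to_four[OF _ id X _ _ _ red[OF f] red[OF g]])
    fix h X a b assume "nc_matching X a" "nc_matching X b" "\<exists>x\<in>X. a x \<noteq> b x" "6 \<le> card X"
    then show "\<exists>p q. consecutive X p q \<and> (p \<le> n) = (q \<le> n) \<and> (\<exists>x\<in>X - {p, q}. contract p q a x \<noteq> contract p q b x)"
      using contract_step[of X a b _ n] by blast
  qed (use f g ne n in \<open>auto simp: tl_matching_def\<close>)
  then obtain h a b x where h: "two_sided n h" "card (defects (2 * n) h) = 4" "nc_matching (defects (2 * n) h) a"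
    "nc_matching (defects (2 * n) h) b" "x \<in> defects (2 * n) h" "a x \<noteq> b x" "reduces_to n h f a" "reduces_to n h g b"
    by blast
  show ?thesis
    using separating_halves[OF h(1) tl_matching_on[OF f] tl_matching_on[OF g] h(7,8,3-6)]
      card_defects_two_sided[OF h(1)] h(1,2) by (intro exI[of _ h]) simp
qed

text \<open>The common lower arcs are contracted first, which leaves all upper points and the lower
  ends of the transversals. From there only upper points are contracted, so the lower half of
  \<open>h\<close> stays that of \<open>f\<close>, and stopping at four points leaves the stated
  number of free ends above.\<close>

lemma separate_one_sided:
  assumes f: "tl_matching n f" and g: "tl_matching n g" and ne: "x0 \<in> {1..2*n}" "f x0 \<noteq> g x0"
    and lo: "\<And>x. x \<in> {1..n} \<Longrightarrow> upper n (mirror n f) x = upper n (mirror n g) x"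
    and r: "card (defects n (upper n f)) \<le> 4" "n + card (defects n (upper n f)) \<ge> 4"
  shows "\<exists>h. half_diagram n h \<and> card (defects n h) = 4 - card (defects n (upper n f)) \<and>
    half_rel n h O color_rel n f O half_rel n (upper n (mirror n f)) \<noteq>
    half_rel n h O color_rel n g O half_rel n (upper n (mirror n f))"
proof -
  define h0 where "h0 x = (if n < x \<and> n < f x then f x else x)" for x
  have h0g: "h0 x = (if n < x \<and> n < g x then g x else x)" if "x \<in> {1..2*n}" for x
    using lower_arcs_eq[OF f g lo, of x] that by (auto simp: h0_def)
  note F = reduce_lower_arcs[OF f, of h0, OF h0_def] and G = reduce_lower_arcs[OF g h0g]
  let ?X = "defects (2 * n) h0"
  define W where "W = {x \<in> ?X. n < x}"
  define r where "r = card (defects n (upper n f))"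
  have mir: "mirror n h x = upper n (mirror n f) x" if h: "\<And>x. n < x \<Longrightarrow> h x = h0 x" and x: "x \<in> {1..n}" for h x
  proof -
    have y: "2 * n + 1 - x \<in> {1..2*n}" "n < 2 * n + 1 - x" "2 * n + 1 - (2 * n + 1 - x) = x" using x by auto
    have "1 \<le> f (2 * n + 1 - x)" "f (2 * n + 1 - x) \<le> 2 * n" using tl_matchingD(1)[OF f y(1)] by auto
    then show ?thesis using h[OF y(2)] y by (auto simp: h0_def upper_def)
  qed
  have card_low: "card (defects n (mirror n h)) = r" if "\<And>x. n < x \<Longrightarrow> h x = h0 x" for h
  proof -
    have "defects n (mirror n h) = defects n (upper n (mirror n f))" using mir[OF that] by (auto simp: defects_def)
    then show ?thesis using card_defects_mirror[OF f] by (simp add: r_def)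
  qed
  have "defects n h0 = {1..n}" by (auto simp: defects_def h0_def)
  then have cardX: "card ?X = n + r" using card_defects_two_sided[OF F(1)] card_low[of h0] by simp
  have "?X = {1..n} \<union> W" "finite W" "{1..n} \<inter> W = {}" unfolding W_def F(2) by auto
  then have cardW: "card W = r" using cardX by (simp add: card_Un_disjoint)
  \<comment> \<open>The last two clauses record that nothing changes beyond
    \<open>n\<close>.\<close>
  let ?Inv = "\<lambda>h X a b. separated_above X n a b \<and> {x \<in> X. n < x} = W \<and> (\<forall>x. n < x \<longrightarrow> h x = h0 x)"
  have init: "separated_above ?X n f g"
  proof -
    have "x0 \<in> ?X"
    proof (rule ccontr)
      assume "x0 \<notin> ?X"
      then have "x0 \<in> {n+1..2*n}" "n < f x0" unfolding F(2) using ne(1) by auto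
      then show False using lower_arcs_eq(2)[OF f g lo] ne(2) by blast
    qed
    moreover have "joins_outside ?X n f" unfolding joins_outside_def F(2) by auto
    ultimately show ?thesis using ne(2) unfolding separated_above_def by blast
  qed
  have "\<exists>h a b. two_sided n h \<and> card (defects (2 * n) h) = 4 \<and> nc_matching (defects (2 * n) h) a \<and>
    nc_matching (defects (2 * n) h) b \<and> ?Inv h (defects (2 * n) h) a b \<and> reduces_to n h f a \<and> reduces_to n h g b"
  proof (rule reduce_to_four[OF _ F(1) refl F(3) G(3) _ F(4) G(4)])
    fix h X a b assume A: "nc_matching X a" "nc_matching X b" "?Inv h X a b" "6 \<le> card X"
    then obtain p q where pq: "consecutive X p q" "p \<le> n" "q \<le> n"
      "separated_above (X - {p, q}) n (contract p q a) (contract p q b)"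
      using contract_step_below[of X a b n] assms(6) cardW by (auto simp: r_def)
    then have "{x \<in> X - {p, q}. n < x} = W" "\<forall>x. n < x \<longrightarrow> (h(p := q, q := p)) x = h0 x" using A(3) by auto
    then show "\<exists>p q. consecutive X p q \<and> (p \<le> n) = (q \<le> n) \<and> ?Inv (h(p := q, q := p)) (X - {p, q}) (contract p q a) (contract p q b)"
      using pq by blast
  qed (use init cardX assms(7) in \<open>simp_all add: W_def r_def\<close>)
  then obtain h a b where h: "two_sided n h" "card (defects (2 * n) h) = 4" "nc_matching (defects (2 * n) h) a"
    "nc_matching (defects (2 * n) h) b" "separated_above (defects (2 * n) h) n a b" "\<And>x. n < x \<Longrightarrow> h x = h0 x"
    "reduces_to n h f a" "reduces_to n h g b"
    by blast
  obtain x where x: "x \<in> defects (2 * n) h" "a x \<noteq> b x" using h(5) unfolding separated_above_def by blast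
  have "half_rel n (mirror n h) = half_rel n (upper n (mirror n f))"
    using mir[OF h(6)] by (rule half_rel_cong)
  then show ?thesis
    using separating_halves[OF h(1) tl_matching_on[OF f] tl_matching_on[OF g] h(7,8,3,4) x]
      card_defects_two_sided[OF h(1)] card_low[OF h(6)] h(2) half_diagram_upper[OF h(1)]
    by (intro exI[of _ h]) (simp add: r_def)
qed

section \<open>Faithful actions\<close>

definition faithful_action :: "'a set \<Rightarrow> ('a \<Rightarrow> 'a \<Rightarrow> 'a) \<Rightarrow> 'b set \<Rightarrow> ('b \<Rightarrow> 'a \<Rightarrow> 'b) \<Rightarrow> bool" where
  "faithful_action S mul Y act \<longleftrightarrow>
     (\<forall>y\<in>Y. \<forall>x\<in>S. act y x \<in> Y) \<and>
     (\<forall>y\<in>Y. \<forall>x\<in>S. \<forall>x'\<in>S. act (act y x) x' = act y (mul x x')) \<and>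
     (\<forall>x\<in>S. \<forall>x'\<in>S. x \<noteq> x' \<longrightarrow> (\<exists>y\<in>Y. act y x \<noteq> act y x'))"

text \<open>\<open>rc_action\<close> without the restriction to classes, and independent of the
  monoid record.\<close>

definition class_act :: "('a \<Rightarrow> 'a \<Rightarrow> 'a) \<Rightarrow> ('a \<times> 'a) set \<Rightarrow> 'a set \<Rightarrow> 'a \<Rightarrow> 'a set" where
  "class_act mul \<sigma> X x = (\<Union>z\<in>X. \<sigma> `` {mul z x})"

lemma class_act_class:
  assumes eq: "equiv S \<sigma>" and cong: "\<And>x y s. (x, y) \<in> \<sigma> \<Longrightarrow> s \<in> S \<Longrightarrow> (mul x s, mul y s) \<in> \<sigma>"
    and z: "z \<in> S" and x: "x \<in> S"
  shows "class_act mul \<sigma> (\<sigma> `` {z}) x = \<sigma> `` {mul z x}"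
proof -
  have "\<sigma> `` {mul z' x} = \<sigma> `` {mul z x}" if "z' \<in> \<sigma> `` {z}" for z'
    using that cong[of z z' x] x equiv_class_eq[OF eq] by blast
  moreover have "z \<in> \<sigma> `` {z}" using equiv_class_self[OF eq z] .
  ultimately show ?thesis unfolding class_act_def by blast
qed

lemma class_act_action:
  assumes eq: "equiv S \<sigma>" and cong: "\<And>x y s. (x, y) \<in> \<sigma> \<Longrightarrow> s \<in> S \<Longrightarrow> (mul x s, mul y s) \<in> \<sigma>"
    and closed: "\<And>x y. x \<in> S \<Longrightarrow> y \<in> S \<Longrightarrow> mul x y \<in> S"
    and assoc: "\<And>x y z. x \<in> S \<Longrightarrow> y \<in> S \<Longrightarrow> z \<in> S \<Longrightarrow> mul (mul x y) z = mul x (mul y z)"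
    and faith: "\<And>x x'. x \<in> S \<Longrightarrow> x' \<in> S \<Longrightarrow> x \<noteq> x' \<Longrightarrow>
      \<exists>X\<in>S // \<sigma>. class_act mul \<sigma> X x \<noteq> class_act mul \<sigma> X x'"
  shows "faithful_action S mul (S // \<sigma>) (class_act mul \<sigma>)"
  unfolding faithful_action_def
proof (intro conjI ballI impI)
  fix X x assume X: "X \<in> S // \<sigma>" and x: "x \<in> S"
  then obtain z where z: "z \<in> S" "X = \<sigma> `` {z}" by (auto elim: quotientE)
  note c = class_act_class[of S \<sigma> mul, OF eq cong]
  show "class_act mul \<sigma> X x \<in> S // \<sigma>" using x z by (simp add: c closed quotientI)
  fix x' assume "x' \<in> S"
  then show "class_act mul \<sigma> (class_act mul \<sigma> X x) x' = class_act mul \<sigma> X (mul x x')"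
    using x z by (simp add: c closed assoc)
qed (use faith in blast)

text \<open>The abstract properties of the Temperley--Lieb monoid that the theorem rests on. The projections
  \<open>x \<cdot> x\<^sup>*\<close> and \<open>x\<^sup>* \<cdot> x\<close> play the role of the upper and lower half of \<open>x\<close>; \<open>m\<close> is the minimal
  rank, and \<open>f1\<close>, \<open>f2\<close> are the two ways to close the free ends of the rank \<open>k\<close> projection \<open>u\<close>.\<close>

locale tl_like =
  fixes S :: "'a set" and mul :: "'a \<Rightarrow> 'a \<Rightarrow> 'a" (infixl "\<cdot>" 70) and star :: "'a \<Rightarrow> 'a"
    and rank :: "'a \<Rightarrow> nat" and P :: "'a set" and m k :: nat and u f1 f2 :: 'a
  assumes fin: "finite S"
    and closed: "x \<in> S \<Longrightarrow> y \<in> S \<Longrightarrow> x \<cdot> y \<in> S"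
    and assoc: "x \<in> S \<Longrightarrow> y \<in> S \<Longrightarrow> z \<in> S \<Longrightarrow> (x \<cdot> y) \<cdot> z = x \<cdot> (y \<cdot> z)"
    and star_closed: "x \<in> S \<Longrightarrow> star x \<in> S"
    and star_star: "x \<in> S \<Longrightarrow> star (star x) = x"
    and star_mult: "x \<in> S \<Longrightarrow> y \<in> S \<Longrightarrow> star (x \<cdot> y) = star y \<cdot> star x"
    and regular: "x \<in> S \<Longrightarrow> x \<cdot> star x \<cdot> x = x"
    and rank_star: "x \<in> S \<Longrightarrow> rank (star x) = rank x"
    and rank_mult: "x \<in> S \<Longrightarrow> y \<in> S \<Longrightarrow> rank (x \<cdot> y) \<le> rank x"
    and stable: "x \<in> S \<Longrightarrow> y \<in> S \<Longrightarrow> rank (x \<cdot> y) = rank x \<Longrightarrow> (x \<cdot> y) \<cdot> star (x \<cdot> y) = x \<cdot> star x"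
    and halves_inj: "x \<in> S \<Longrightarrow> y \<in> S \<Longrightarrow> x \<cdot> star x = y \<cdot> star y \<Longrightarrow> star x \<cdot> x = star y \<cdot> y \<Longrightarrow> x = y"
    and P_eq: "P = {p \<in> S. p \<cdot> p = p \<and> star p = p}"
    and connect: "p \<in> P \<Longrightarrow> q \<in> P \<Longrightarrow> rank p = rank q \<Longrightarrow> \<exists>x\<in>S. x \<cdot> star x = p \<and> star x \<cdot> x = q"
    and m_le: "m \<le> 1" and k_eq: "k = 4 - m"
    and rank_ge: "x \<in> S \<Longrightarrow> m \<le> rank x"
    and rank_le_4: "x \<in> S \<Longrightarrow> rank x \<le> 4 \<Longrightarrow> rank x \<in> {m, 2, k}"
    and separate_left: "x \<in> S \<Longrightarrow> y \<in> S \<Longrightarrow> rank x = rank y \<Longrightarrow> rank x \<le> 4 \<Longrightarrow>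
      star x \<cdot> x = star y \<cdot> y \<Longrightarrow> x \<noteq> y \<Longrightarrow> \<exists>z\<in>S. rank z = 4 - rank x \<and> z \<cdot> x \<noteq> z \<cdot> y"
    and separate: "x \<in> S \<Longrightarrow> y \<in> S \<Longrightarrow> x \<noteq> y \<Longrightarrow>
      \<exists>z\<in>P. \<exists>s\<in>P. rank z + rank s = 4 \<and> z \<cdot> x \<cdot> s \<noteq> z \<cdot> y \<cdot> s"
    and u: "u \<in> P" "rank u = k" "f1 \<in> P" "f2 \<in> P" "rank f1 = m" "rank f2 = m" "f1 \<noteq> f2"
      "u \<cdot> f1 = f1" "u \<cdot> f2 = f2"
    and below_u: "x \<in> S \<Longrightarrow> rank x = m \<Longrightarrow> u \<cdot> x = x \<Longrightarrow> x \<cdot> star x = f1 \<or> x \<cdot> star x = f2"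
    and rank2_unique: "x \<in> S \<Longrightarrow> y \<in> S \<Longrightarrow> z \<in> S \<Longrightarrow> rank x = 2 \<Longrightarrow> rank (x \<cdot> y) = m \<Longrightarrow> rank (x \<cdot> z) = m \<Longrightarrow>
      (x \<cdot> y) \<cdot> star (x \<cdot> y) = (x \<cdot> z) \<cdot> star (x \<cdot> z)"
    and rank2_below: "x \<in> S \<Longrightarrow> rank x = 2 \<Longrightarrow> \<exists>w\<in>P. rank w = 2 \<and> u \<cdot> w = w \<and> w \<cdot> f1 = f1"
begin

section \<open>Halves of elements and the minimal ideal\<close>

definition up :: "'a \<Rightarrow> 'a" where "up x = x \<cdot> star x"
definition lo :: "'a \<Rightarrow> 'a" where "lo x = star x \<cdot> x"

lemma P_S: "p \<in> P \<Longrightarrow> p \<in> S" and P_idem: "p \<in> P \<Longrightarrow> p \<cdot> p = p" and P_star: "p \<in> P \<Longrightarrow> star p = p"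
  by (auto simp: P_eq)

lemma up_closed: "x \<in> S \<Longrightarrow> up x \<in> S" and lo_closed: "x \<in> S \<Longrightarrow> lo x \<in> S"
  by (auto simp: up_def lo_def closed star_closed)

lemma up_star: "x \<in> S \<Longrightarrow> up (star x) = lo x" and lo_star: "x \<in> S \<Longrightarrow> lo (star x) = up x"
  by (simp_all add: up_def lo_def star_star)

lemma up_mult: "x \<in> S \<Longrightarrow> up x \<cdot> x = x"
  by (simp add: up_def regular)

lemma mult_lo: "x \<in> S \<Longrightarrow> x \<cdot> lo x = x"
  by (simp add: lo_def assoc[symmetric] star_closed regular)

lemma up_P: "x \<in> S \<Longrightarrow> up x \<in> P"
proof -
  assume x: "x \<in> S"
  have "up x \<cdot> up x = (up x \<cdot> x) \<cdot> star x"
    using assoc[OF up_closed[OF x] x star_closed[OF x]] by (simp add: up_def)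
  then have "up x \<cdot> up x = up x" using up_mult[OF x] by (simp add: up_def)
  moreover have "star (up x) = up x" using x by (simp add: up_def star_mult star_closed star_star)
  ultimately show "up x \<in> P" using up_closed[OF x] by (simp add: P_eq)
qed

lemma lo_P: "x \<in> S \<Longrightarrow> lo x \<in> P"
  using up_P[of "star x"] by (simp add: up_star star_closed)

lemma P_up: "p \<in> P \<Longrightarrow> up p = p" and P_lo: "p \<in> P \<Longrightarrow> lo p = p"
  by (simp_all add: up_def lo_def P_idem P_star)

lemma eqI: "x \<in> S \<Longrightarrow> y \<in> S \<Longrightarrow> up x = up y \<Longrightarrow> lo x = lo y \<Longrightarrow> x = y"
  using halves_inj by (simp add: up_def lo_def)

lemma rank_mult': "x \<in> S \<Longrightarrow> y \<in> S \<Longrightarrow> rank (x \<cdot> y) \<le> rank y"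
  using rank_mult[of "star y" "star x"] rank_star[of "x \<cdot> y"] rank_star[of y]
  by (simp add: star_mult star_closed closed)

lemma rank_up: "x \<in> S \<Longrightarrow> rank (up x) = rank x"
  using rank_mult[of x "star x"] rank_mult[of "up x" x] up_mult[of x] 
  by (simp add: up_def star_closed closed)

lemma rank_lo: "x \<in> S \<Longrightarrow> rank (lo x) = rank x"
  using rank_up[of "star x"] by (simp add: up_star star_closed rank_star)

lemma up_stable: "x \<in> S \<Longrightarrow> y \<in> S \<Longrightarrow> rank (x \<cdot> y) = rank x \<Longrightarrow> up (x \<cdot> y) = up x"
  using stable by (simp add: up_def)

lemma lo_stable: "x \<in> S \<Longrightarrow> y \<in> S \<Longrightarrow> rank (x \<cdot> y) = rank y \<Longrightarrow> lo (x \<cdot> y) = lo y"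
  using up_stable[of "star y" "star x"] rank_star[of "x \<cdot> y"] rank_star[of y] up_star[of "x \<cdot> y"] up_star[of y]
  by (simp add: star_mult star_closed closed)

text \<open>The rank cannot drop below \<open>m\<close>, so stability applies to every product with
  a factor of minimal rank.\<close>

lemma min_left: "x \<in> S \<Longrightarrow> y \<in> S \<Longrightarrow> rank x = m \<Longrightarrow> rank (x \<cdot> y) = m \<and> up (x \<cdot> y) = up x"
  using rank_mult[of x y] rank_ge[of "x \<cdot> y"] up_stable[of x y] by (simp add: closed)

lemma min_right: "x \<in> S \<Longrightarrow> y \<in> S \<Longrightarrow> rank y = m \<Longrightarrow> rank (x \<cdot> y) = m \<and> lo (x \<cdot> y) = lo y"
  using rank_mult'[of x y] rank_ge[of "x \<cdot> y"] lo_stable[of x y] by (simp add: closed)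

text \<open>For projections of equal rank the choice exists by \<open>connect\<close> and is unique
  by \<open>halves_inj\<close>.\<close>

definition elem :: "'a \<Rightarrow> 'a \<Rightarrow> 'a" where
  "elem p q = (SOME x. x \<in> S \<and> up x = p \<and> lo x = q)"

lemma elem:
  assumes "p \<in> P" "q \<in> P" "rank p = rank q"
  shows "elem p q \<in> S" "up (elem p q) = p" "lo (elem p q) = q" "rank (elem p q) = rank p"
proof -
  have "\<exists>x. x \<in> S \<and> up x = p \<and> lo x = q" using connect[OF assms] by (auto simp: up_def lo_def)
  then have "elem p q \<in> S \<and> up (elem p q) = p \<and> lo (elem p q) = q"
    unfolding elem_def by (rule someI_ex)
  then show "elem p q \<in> S" "up (elem p q) = p" "lo (elem p q) = q" "rank (elem p q) = rank p"
    using rank_up[of "elem p q"] by auto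
qed

lemma separate_right:
  assumes "x \<in> S" "y \<in> S" "rank x = rank y" "rank x \<le> 4" "up x = up y" "x \<noteq> y"
  shows "\<exists>z\<in>S. rank z = 4 - rank x \<and> x \<cdot> z \<noteq> y \<cdot> z"
proof -
  have "star x \<noteq> star y" using star_star assms by metis
  then obtain z where z: "z \<in> S" "rank z = 4 - rank x" "z \<cdot> star x \<noteq> z \<cdot> star y"
    using separate_left[of "star x" "star y"] assms by (auto simp: star_closed rank_star star_star up_def)
  have "x \<cdot> star z \<noteq> y \<cdot> star z"
  proof
    assume "x \<cdot> star z = y \<cdot> star z"
    then have "star (x \<cdot> star z) = star (y \<cdot> star z)" by simp
    then show False using z assms by (simp add: star_mult star_closed star_star)
  qed
  then show ?thesis using z by (intro bexI[of _ "star z"]) (auto simp: rank_star star_closed)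
qed

text \<open>Right multiplication by \<open>elem (lo z) q\<close> moves the lower half of
  \<open>z\<close> to \<open>q\<close> and is undone by the star of that element, so nothing
  separated becomes equal. With a lower half such as \<open>u\<close> or \<open>f1\<close> the
  possible values of the products can be listed.\<close>

lemma retarget:
  assumes x: "x \<in> S" and y: "y \<in> S" and z: "z \<in> S" and q: "q \<in> P" "rank z = rank q" and ne: "x \<cdot> z \<noteq> y \<cdot> z"
  shows "\<exists>z'\<in>S. rank z' = rank q \<and> lo z' = q \<and> up z' = up z \<and> x \<cdot> z' \<noteq> y \<cdot> z'"
proof -
  have r: "rank (lo z) = rank q" using rank_lo z q by simp
  note t = elem[OF lo_P[OF z] q(1) r]
  let ?t = "elem (lo z) q"
  have zt: "z \<cdot> ?t \<cdot> star ?t = z"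
    using t mult_lo[OF z] z by (simp add: assoc star_closed up_def)
  have rk: "rank (z \<cdot> ?t) = rank z"
    using rank_mult[of z ?t] rank_mult[of "z \<cdot> ?t" "star ?t"] z t zt by (simp add: closed star_closed)
  have "x \<cdot> (z \<cdot> ?t) \<noteq> y \<cdot> (z \<cdot> ?t)"
  proof
    assume "x \<cdot> (z \<cdot> ?t) = y \<cdot> (z \<cdot> ?t)"
    then have "x \<cdot> (z \<cdot> ?t) \<cdot> star ?t = y \<cdot> (z \<cdot> ?t) \<cdot> star ?t" by simp
    then have "x \<cdot> (z \<cdot> ?t \<cdot> star ?t) = y \<cdot> (z \<cdot> ?t \<cdot> star ?t)" using x y z t by (simp add: assoc closed star_closed)
    then show False using zt ne by simp
  qed
  moreover have "lo (z \<cdot> ?t) = q" using lo_stable[OF z t(1)] rk t rank_lo z q by simp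
  moreover have "up (z \<cdot> ?t) = up z" using up_stable[OF z t(1)] rk by simp
  ultimately show ?thesis using rk q z t by (intro bexI[of _ "z \<cdot> ?t"]) (auto simp: closed)
qed

section \<open>Elements of minimal rank below \<open>u\<close>, and the lower bound\<close>

text \<open>\<open>f1\<close> and \<open>e2\<close> are the two elements of minimal rank below
  \<open>u\<close> with lower half \<open>f1\<close>; a faithful action has a point that tells them
  apart.\<close>

definition e2 :: 'a where "e2 = elem f2 f1"

lemma e2: "e2 \<in> S" "up e2 = f2" "lo e2 = f1" "rank e2 = m" "u \<cdot> e2 = e2" "e2 \<noteq> f1"
proof -
  show e: "e2 \<in> S" "up e2 = f2" "lo e2 = f1" "rank e2 = m"
    using elem[OF u(4,3)] u by (auto simp: e2_def)
  have "u \<cdot> e2 = u \<cdot> (f2 \<cdot> e2)" using up_mult[OF e(1)] e by simp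
  also have "\<dots> = e2" using up_mult[OF e(1)] e u(9) assoc[OF P_S[OF u(1)] P_S[OF u(4)] e(1)] by simp
  finally show "u \<cdot> e2 = e2" .
  show "e2 \<noteq> f1" using e u P_up by metis
qed

lemma min_below_u:
  assumes "x \<in> S" "rank x = m" "u \<cdot> x = x" "lo x = f1"
  shows "x = f1 \<or> x = e2"
proof -
  have "up x = f1 \<or> up x = f2" using below_u[OF assms(1-3)] by (simp add: up_def)
  moreover have "up f1 = f1" "lo f1 = f1" using u P_up P_lo by auto
  ultimately show ?thesis
    using eqI[OF assms(1) P_S[OF u(3)]] eqI[OF assms(1) e2(1)] e2(2,3) assms(4) by metis
qed

lemma min_below_u':
  assumes "x \<in> S" "rank x = m" "x \<cdot> u = x" "up x = f1"
  shows "x = f1 \<or> x = star e2"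
proof -
  have "u \<cdot> star x = star x" using star_mult[OF assms(1) P_S[OF u(1)]] assms P_star u by simp
  then have "star x = f1 \<or> star x = e2"
    using min_below_u[of "star x"] assms by (simp add: star_closed rank_star lo_star)
  then show ?thesis using star_star[OF assms(1)] P_star u by metis
qed

definition Q :: "'a set" where "Q = {p \<in> P. rank p \<in> {m, 2, k}}"

abbreviation Pr :: "nat \<Rightarrow> 'a set" where "Pr r \<equiv> {p \<in> P. rank p = r}"

lemma mk: "m \<noteq> 2" "m \<noteq> k" "k \<noteq> 2" "k > 2" "4 - m = k" "4 - k = m" "k \<le> 4" "m \<le> 4"
  using m_le k_eq by auto

lemma finite_P: "finite P"
  by (rule finite_subset[OF _ fin]) (simp add: P_eq)

lemma card_Q: "card Q = card (Pr m) + card (Pr 2) + card (Pr k)"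
proof -
  have "Q = Pr m \<union> Pr 2 \<union> Pr k" unfolding Q_def by blast
  moreover have "finite (Pr r)" for r using finite_P by simp
  moreover have "Pr m \<inter> Pr 2 = {}" "(Pr m \<union> Pr 2) \<inter> Pr k = {}" using mk(1-3) by auto
  ultimately show ?thesis by (simp add: card_Un_disjoint)
qed

text \<open>An element of rank 2 closes in one way only, so for elements of minimal rank below it
  the upper half carries no information.\<close>

lemma rank2_eq:
  assumes "w \<in> S" "rank w = 2" "x \<in> S" "y \<in> S" "w \<cdot> x = x" "w \<cdot> y = y" "rank x = m" "rank y = m" "lo x = lo y"
  shows "x = y"
  using rank2_unique[OF assms(1,3,4,2)] assms eqI[OF assms(3,4)] by (simp add: up_def)

text \<open>The points counted are \<open>y1 (f1, q)\<close> for \<open>q\<close> of rank \<open>m\<close> and one more point hit by an element of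
  minimal rank, then \<open>y2 (w, q)\<close> for \<open>q\<close> of rank 2, and \<open>y0 (u, v)\<close> for \<open>v\<close> of rank \<open>k\<close>, where
  \<open>(p, q)\<close> is the element with upper half \<open>p\<close> and lower half \<open>q\<close>. Elements of minimal rank with the
  same lower half act alike exactly on the points of the first two kinds.\<close>

theorem action_card_ge:
  assumes act: "faithful_action S (\<cdot>) Y act" and finY: "finite Y"
  shows "card Y \<ge> 1 + card Q"
proof -
  have act_in: "\<And>y x. y \<in> Y \<Longrightarrow> x \<in> S \<Longrightarrow> act y x \<in> Y"
    and act_act: "\<And>y x x'. y \<in> Y \<Longrightarrow> x \<in> S \<Longrightarrow> x' \<in> S \<Longrightarrow> act (act y x) x' = act y (x \<cdot> x')"
    and faith: "\<And>x x'. x \<in> S \<Longrightarrow> x' \<in> S \<Longrightarrow> x \<noteq> x' \<Longrightarrow> \<exists>y\<in>Y. act y x \<noteq> act y x'"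
    using act unfolding faithful_action_def by simp_all
  have S: "u \<in> S" "f1 \<in> S" "f2 \<in> S" "e2 \<in> S" "star e2 \<in> S" using u P_S e2 star_closed by auto
  obtain y0' where y0': "y0' \<in> Y" "act y0' f1 \<noteq> act y0' e2" using faith[of f1 e2] S e2 by auto
  define y0 where "y0 = act y0' u"
  have y0: "y0 \<in> Y" "act y0 f1 \<noteq> act y0 e2"
    using y0' act_in act_act S u e2 by (auto simp: y0_def)
  have "star e2 \<noteq> f1" using e2 star_star P_star u by metis
  then obtain y1 where y1: "y1 \<in> Y" "act y1 f1 \<noteq> act y1 (star e2)" using faith[of f1 "star e2"] S by auto
  \<comment> \<open>Two properties keep the three sets of points disjoint: points of
    \<open>Z0\<close> are lower, those of \<open>Z2\<close> are blind but not lower, those of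
    \<open>Zk\<close> are not blind, and lower points are blind.\<close>
  define lower where "lower y \<longleftrightarrow> (\<exists>y'\<in>Y. \<exists>t\<in>S. rank t = m \<and> y = act y' t)" for y
  define blind where "blind y \<longleftrightarrow> (\<forall>a\<in>S. \<forall>b\<in>S. rank a = m \<longrightarrow> rank b = m \<longrightarrow> lo a = lo b \<longrightarrow> act y a = act y b)" for y
  have lower_blind: "blind y" if y: "lower y" for y
  proof -
    obtain y' t where t: "y' \<in> Y" "t \<in> S" "rank t = m" "y = act y' t" using y by (auto simp: lower_def)
    have tab: "t \<cdot> a = t \<cdot> b" if "a \<in> S" "b \<in> S" "rank a = m" "rank b = m" "lo a = lo b" for a b
      using that t min_left[of t a] min_left[of t b] min_right[of t a] min_right[of t b]
      by - (rule eqI; simp add: closed)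
    show ?thesis
      unfolding blind_def t(4)
    proof (intro ballI impI)
      fix a b assume "a \<in> S" "b \<in> S" "rank a = m" "rank b = m" "lo a = lo b"
      then show "act (act y' t) a = act (act y' t) b" using tab[of a b] act_act[OF t(1,2)] by simp
    qed
  qed

  define g where "g = elem f1"
  have g: "g q \<in> S" "up (g q) = f1" "lo (g q) = q" "rank (g q) = m" if "q \<in> Pr m" for q
    using elem[of f1 q] that u by (auto simp: g_def)
  have inj0: "inj_on (\<lambda>q. act y1 (g q)) (Pr m)"
  proof (rule inj_onI, rule ccontr)
    fix q q' assume q: "q \<in> Pr m" "q' \<in> Pr m" "act y1 (g q) = act y1 (g q')" "q \<noteq> q'"
    have "g q \<noteq> g q'" using q g by metis
    \<comment> \<open>Retargeted to lower half \<open>u\<close>, the separator takes both elements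
      into \<open>f1\<close> and \<open>star e2\<close>, which act differently on
      \<open>y1\<close>.\<close>
    then obtain z0 where "z0 \<in> S" "rank z0 = k" "g q \<cdot> z0 \<noteq> g q' \<cdot> z0"
      using separate_right[of "g q" "g q'"] g[OF q(1)] g[OF q(2)] mk by auto
    then obtain z where z: "z \<in> S" "rank z = k" "lo z = u" "g q \<cdot> z \<noteq> g q' \<cdot> z"
      using retarget[of "g q" "g q'" z0 u] g q u by auto
    have zu: "z \<cdot> u = z" using mult_lo[OF z(1)] z by simp
    have cls: "g p \<cdot> z = f1 \<or> g p \<cdot> z = star e2" if "p \<in> Pr m" for p
      using min_left[OF g(1)[OF that] z(1)] g[OF that] z zu S
      by (intro min_below_u') (simp_all add: closed assoc)
    have "act y1 (g q \<cdot> z) = act y1 (g q' \<cdot> z)"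
      using act_act[OF y1(1) g(1)[OF q(1)] z(1)] act_act[OF y1(1) g(1)[OF q(2)] z(1)] q by simp
    then show False using cls[OF q(1)] cls[OF q(2)] z y1 by auto
  qed
  let ?O = "(\<lambda>q. act y1 (g q)) ` Pr m"
  \<comment> \<open>\<open>f1\<close> sends all of \<open>?O\<close> to one point but fixes the two
    distinct points \<open>act y0 f1\<close> and \<open>act y0 e2\<close>, so one of these lies
    outside \<open>?O\<close>. This is the extra 1 in the bound.\<close>
  have O_f1: "act y f1 = act y1 f1" if y: "y \<in> ?O" for y
  proof -
    obtain q where q: "q \<in> Pr m" "y = act y1 (g q)" using y by blast
    have "g q \<cdot> f1 = f1" using g[OF q(1)] S min_left[of "g q" f1] min_right[of "g q" f1] u
      by - (rule eqI; simp add: closed P_up P_lo)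
    then show ?thesis using q act_act[OF y1(1) g(1)[OF q(1)] S(2)] by simp
  qed
  have "f1 \<cdot> f1 = f1" "e2 \<cdot> f1 = e2" using u P_idem mult_lo[OF S(4)] e2 by auto
  then have "act (act y0 f1) f1 = act y0 f1" "act (act y0 e2) f1 = act y0 e2" using act_act[OF y0(1)] S by auto
  then have "act y0 f1 \<notin> ?O \<or> act y0 e2 \<notin> ?O" using O_f1[of "act y0 f1"] O_f1[of "act y0 e2"] y0(2) by metis
  then obtain e where e: "e \<in> {f1, e2}" "act y0 e \<notin> ?O" by blast
  define Z0 where "Z0 = insert (act y0 e) ?O"
  have cardZ0: "card Z0 = card (Pr m) + 1"
    using e inj0 finite_P by (simp add: Z0_def card_image)
  have Z0: "Z0 \<subseteq> Y" "\<And>y. y \<in> Z0 \<Longrightarrow> lower y"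
  proof -
    have eS: "e \<in> S" "rank e = m" using e S u e2 by auto
    show "Z0 \<subseteq> Y" using eS act_in[OF y0(1)] act_in[OF y1(1)] g by (auto simp: Z0_def)
    show "lower y" if "y \<in> Z0" for y
      using that eS y0(1) y1(1) g unfolding Z0_def lower_def by blast
  qed

  have "\<exists>Z2\<subseteq>Y. card Z2 = card (Pr 2) \<and> (\<forall>y\<in>Z2. \<not> lower y \<and> blind y)"
  proof (cases "Pr 2 = {}")
    case False
    then obtain w where w: "w \<in> P" "rank w = 2" by blast
    have wS: "w \<in> S" using w P_S by simp
    \<comment> \<open>The projection obtained by closing the two free ends of \<open>w\<close>; the
      point \<open>y2\<close> tells it from \<open>w\<close>.\<close>
    define c where "c = up (w \<cdot> f1)"
    have wf: "w \<cdot> f1 \<in> S" "rank (w \<cdot> f1) = m" using min_right[of w f1] wS S u by (auto simp: closed)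
    have c: "c \<in> P" "rank c = m" using up_P[OF wf(1)] wf rank_up[OF wf(1)] by (simp_all add: c_def)
    then have "w \<noteq> c" using w mk by auto
    then obtain y2 where y2: "y2 \<in> Y" "act y2 w \<noteq> act y2 c" using faith[of w c] wS P_S[OF c(1)] by auto
    define x where "x = elem w"
    have x: "x q \<in> S" "up (x q) = w" "lo (x q) = q" "rank (x q) = 2" "w \<cdot> x q = x q" if "q \<in> Pr 2" for q
      using elem[of w q] that w up_mult[of "x q"] by (auto simp: x_def)
    have nl: "\<not> lower (act y2 (x q))" if q: "q \<in> Pr 2" for q
    proof
      assume "lower (act y2 (x q))"
      then obtain y t where t: "y \<in> Y" "t \<in> S" "rank t = m" "act y2 (x q) = act y t" by (auto simp: lower_def)
      let ?a = "lo t" and ?x = "x q"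
      have a: "?a \<in> S" "?a \<in> P" "rank ?a = m" "star ?a = ?a" using t lo_P[OF t(2)] P_S[OF lo_P[OF t(2)]] rank_lo[OF t(2)] P_star[OF lo_P[OF t(2)]] by simp_all
      note xq = x[OF q]
      \<comment> \<open>A point hit by \<open>t\<close> is fixed by \<open>lo t\<close>. Therefore
        \<open>?e\<close> acts on \<open>y2\<close> like \<open>w\<close>, while uniqueness of the
        closing identifies \<open>?e\<close> with \<open>c\<close>.\<close>
      let ?e = "?x \<cdot> (?a \<cdot> star ?x)"
      have sx: "star ?x \<in> S" by (rule star_closed[OF xq(1)])
      have eS: "?e \<in> S" using xq a sx by (simp add: closed)
      have rke: "rank ?e = m" using min_left[OF a(1) sx a(3)] min_right[of ?x "?a \<cdot> star ?x"] xq a sx by (simp add: closed)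
      have "act (act y2 ?x) ?a = act y2 ?x" using t act_act[OF t(1,2) a(1)] mult_lo[OF t(2)] by simp
      then have "act (act (act y2 ?x) ?a) (star ?x) = act (act y2 ?x) (star ?x)" by simp
      then have ee: "act y2 ?e = act y2 w"
        using act_act[OF y2(1)] xq(1) a(1) sx xq(2)[unfolded up_def] by (simp add: assoc closed)
      have we: "w \<cdot> ?e = ?e" using xq a sx wS by (simp add: assoc[symmetric] closed)
      have upe: "up ?e = c"
        using rank2_unique[OF wS eS S(2) w(2)] we rke wf by (simp add: c_def up_def)
      have "star ?e = ?e" using xq a sx by (simp add: star_mult closed star_star assoc)
      then have "lo ?e = c" using upe lo_star[OF eS] by simp
      then have "?e = c" using upe eS c P_S by - (rule eqI; simp add: P_up P_lo)
      then show False using ee y2 by simp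
    qed
    have inj2: "inj_on (\<lambda>q. act y2 (x q)) (Pr 2)"
    proof (rule inj_onI, rule ccontr)
      fix q q' assume q: "q \<in> Pr 2" "q' \<in> Pr 2" "act y2 (x q) = act y2 (x q')" "q \<noteq> q'"
      note X = x[OF q(1)] and X' = x[OF q(2)]
      have "x q \<noteq> x q'" using q X X' by metis
      then obtain z where z: "z \<in> S" "rank z = 2" "x q \<cdot> z \<noteq> x q' \<cdot> z"
        using separate_right[of "x q" "x q'"] X X' by auto
      have same: "act y2 (x q \<cdot> z) = act y2 (x q' \<cdot> z)"
        using act_act[OF y2(1) X(1) z(1)] act_act[OF y2(1) X'(1) z(1)] q(3) by simp
      \<comment> \<open>A product that keeps rank 2 equals \<open>x (lo z)\<close> and gives a point
        that is not lower; a product of rank \<open>m\<close> gives a lower point.\<close>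
      have not_mixed: False if p: "p \<in> Pr 2" "p' \<in> Pr 2" "rank (x p \<cdot> z) = 2" "rank (x p' \<cdot> z) = m"
        "act y2 (x p \<cdot> z) = act y2 (x p' \<cdot> z)" for p p'
      proof -
        have "lower (act y2 (x p' \<cdot> z))"
          using y2(1) closed[OF x(1)[OF p(2)] z(1)] p(4) unfolding lower_def by blast
        moreover have pz: "lo z \<in> Pr 2" using z lo_P[OF z(1)] rank_lo[OF z(1)] by simp
        moreover have "x p \<cdot> z = x (lo z)"
          using x[OF p(1)] x[OF pz] z p(3) up_stable[of "x p" z] lo_stable[of "x p" z]
          by - (rule eqI; simp add: closed)
        ultimately show False using nl[OF pz] p(5) by simp
      qed
      have rk: "rank (x p \<cdot> z) = m \<or> rank (x p \<cdot> z) = 2" if "p \<in> Pr 2" for p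
        using rank_mult[of "x p" z] rank_le_4[of "x p \<cdot> z"] x[OF that] z mk by (auto simp: closed)
      have "\<not> (rank (x q \<cdot> z) = 2 \<and> rank (x q' \<cdot> z) = 2)"
      proof
        assume "rank (x q \<cdot> z) = 2 \<and> rank (x q' \<cdot> z) = 2"
        then have "x q \<cdot> z = x q' \<cdot> z"
          using X X' z up_stable[of "x q" z] lo_stable[of "x q" z] up_stable[of "x q'" z] lo_stable[of "x q'" z]
          by - (rule eqI; simp add: closed)
        then show False using z by simp
      qed
      moreover have "\<not> (rank (x q \<cdot> z) = m \<and> rank (x q' \<cdot> z) = m)"
      proof
        assume r: "rank (x q \<cdot> z) = m \<and> rank (x q' \<cdot> z) = m"
        have sz: "star z \<in> S" "rank (star z) = 2" using z star_closed[OF z(1)] rank_star[OF z(1)] by simp_all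
        have st: "star z \<cdot> star (x p) = star (x p \<cdot> z)" if "p \<in> Pr 2" for p using x[OF that] z by (simp add: star_mult)
        \<comment> \<open>Applied to \<open>star z\<close>, uniqueness of the closing gives equal
          lower halves; \<open>rank2_eq\<close> at \<open>w\<close> does the rest.\<close>
        have "up (star (x q \<cdot> z)) = up (star (x q' \<cdot> z))"
          using rank2_unique[OF sz(1) star_closed[OF X(1)] star_closed[OF X'(1)] sz(2)] st[OF q(1)] st[OF q(2)] r X X' z
          by (simp add: up_def rank_star closed)
        then have "lo (x q \<cdot> z) = lo (x q' \<cdot> z)" using X X' z by (simp add: up_star closed)
        then have "x q \<cdot> z = x q' \<cdot> z"
          using X X' z r w wS by - (rule rank2_eq[of w]; simp add: closed assoc[symmetric])
        then show False using z by simp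
      qed
      ultimately show False
        using rk[OF q(1)] rk[OF q(2)] not_mixed[OF q(1,2)] not_mixed[OF q(2,1)] same by metis
    qed
    have bl: "blind (act y2 (x q))" if q: "q \<in> Pr 2" for q
      unfolding blind_def
    proof (intro ballI impI)
      fix a b assume ab: "a \<in> S" "b \<in> S" "rank a = m" "rank b = m" "lo a = lo b"
      have "x q \<cdot> a = x q \<cdot> b"
        using x[OF q] ab wS w min_right[of "x q" a] min_right[of "x q" b]
        by - (rule rank2_eq[of w]; simp add: closed assoc[symmetric])
      then show "act (act y2 (x q)) a = act (act y2 (x q)) b" using act_act[OF y2(1) x(1)[OF q]] ab by simp
    qed
    show ?thesis
      using inj2 nl bl act_in[OF y2(1) x(1)]
      by (intro exI[of _ "(\<lambda>q. act y2 (x q)) ` Pr 2"]) (auto simp: card_image)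
  next
    case True
    show ?thesis unfolding True by (intro exI[of _ "{}"]) simp
  qed
  then obtain Z2 where Z2: "Z2 \<subseteq> Y" "card Z2 = card (Pr 2)" "\<And>y. y \<in> Z2 \<Longrightarrow> \<not> lower y" "\<And>y. y \<in> Z2 \<Longrightarrow> blind y"
    by blast

  define x where "x = elem u"
  have x: "x v \<in> S" "up (x v) = u" "lo (x v) = v" "rank (x v) = k" "u \<cdot> x v = x v" if "v \<in> Pr k" for v
    using elem[of u v] that u up_mult[of "x v"] by (auto simp: x_def)
  have injk: "inj_on (\<lambda>v. act y0 (x v)) (Pr k)"
  proof (rule inj_onI, rule ccontr)
    fix v v' assume v: "v \<in> Pr k" "v' \<in> Pr k" "act y0 (x v) = act y0 (x v')" "v \<noteq> v'"
    note X = x[OF v(1)] and X' = x[OF v(2)]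
    have "x v \<noteq> x v'" using v X X' by metis
    \<comment> \<open>Mirror image of the argument for \<open>Pr m\<close>: the separator now has
      rank \<open>m\<close> and lower half \<open>f1\<close>, and the possible values are
      \<open>f1\<close> and \<open>e2\<close>.\<close>
    then obtain z0 where "z0 \<in> S" "rank z0 = m" "x v \<cdot> z0 \<noteq> x v' \<cdot> z0"
      using separate_right[of "x v" "x v'"] X X' mk by auto
    then obtain z where z: "z \<in> S" "rank z = m" "lo z = f1" "x v \<cdot> z \<noteq> x v' \<cdot> z"
      using retarget[of "x v" "x v'" z0 f1] X X' u by auto
    have cls: "x p \<cdot> z = f1 \<or> x p \<cdot> z = e2" if "p \<in> Pr k" for p
      using min_right[OF x(1)[OF that] z(1)] x[OF that] z S
      by (intro min_below_u) (simp_all add: closed assoc[symmetric])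
    have "act y0 (x v \<cdot> z) = act y0 (x v' \<cdot> z)"
      using act_act[OF y0(1) X(1) z(1)] act_act[OF y0(1) X'(1) z(1)] v by simp
    then show False using cls[OF v(1)] cls[OF v(2)] z y0 by auto
  qed
  \<comment> \<open>\<open>star (x v) \<cdot> f1\<close> and \<open>star (x v) \<cdot> e2\<close>
    have minimal rank and lower half \<open>f1\<close>, but \<open>x v\<close> takes them back to
    \<open>f1\<close> and \<open>e2\<close>, which differ at \<open>y0\<close>.\<close>
  have nb: "\<not> blind (act y0 (x v))" if v: "v \<in> Pr k" for v
  proof
    assume bl: "blind (act y0 (x v))"
    note X = x[OF v]
    have sx: "star (x v) \<in> S" by (rule star_closed[OF X(1)])
    have r: "rank (star (x v) \<cdot> t) = m \<and> lo (star (x v) \<cdot> t) = f1" "x v \<cdot> (star (x v) \<cdot> t) = u \<cdot> t" 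
      if "t \<in> {f1, e2}" for t
    proof -
      have t: "t \<in> S" "rank t = m" "lo t = f1" using that S u e2 P_lo[OF u(3)] by auto
      show "rank (star (x v) \<cdot> t) = m \<and> lo (star (x v) \<cdot> t) = f1" using min_right[OF sx t(1,2)] t by simp
      show "x v \<cdot> (star (x v) \<cdot> t) = u \<cdot> t" using X(2)[unfolded up_def] assoc[OF X(1) sx t(1)] by simp
    qed
    have "act (act y0 (x v)) (star (x v) \<cdot> f1) = act (act y0 (x v)) (star (x v) \<cdot> e2)"
      using bl r[of f1] r[of e2] sx S unfolding blind_def by (simp add: closed)
    then have "act y0 (u \<cdot> f1) = act y0 (u \<cdot> e2)" using act_act[OF y0(1) X(1)] sx S r by (simp add: closed)
    then show False using u e2 y0 by simp
  qed
  define Zk where "Zk = (\<lambda>v. act y0 (x v)) ` Pr k"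
  have Zk: "Zk \<subseteq> Y" "card Zk = card (Pr k)" "\<And>y. y \<in> Zk \<Longrightarrow> \<not> blind y"
    using injk nb act_in[OF y0(1) x(1)] by (auto simp: Zk_def card_image)

  have f: "finite Z0" "finite Z2" "finite Zk" using Z0(1) Z2(1) Zk(1) finite_subset[OF _ finY] by simp_all
  have "card (Z0 \<union> Z2) = card Z0 + card Z2" using f Z0(2) Z2(3) by (intro card_Un_disjoint) auto
  moreover have "card (Z0 \<union> Z2 \<union> Zk) = card (Z0 \<union> Z2) + card Zk"
    using f Z0(2) Z2(4) Zk(3) lower_blind by (intro card_Un_disjoint) blast+
  moreover have "card (Z0 \<union> Z2 \<union> Zk) \<le> card Y" using Z0(1) Z2(1) Zk(1) finY by (intro card_mono) auto
  ultimately show ?thesis using cardZ0 Z2 Zk card_Q by simp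
qed

text \<open>\<open>hit_rel\<close> is the largest right congruence for which \<open>{x. u \<cdot> x = f1}\<close> is a union of classes.\<close>

definition hits :: "'a \<Rightarrow> 'a set" where "hits x = {s \<in> S. u \<cdot> x \<cdot> s = f1}"

definition hit_rel :: "('a \<times> 'a) set" where
  "hit_rel = {(x, y). x \<in> S \<and> y \<in> S \<and> hits x = hits y}"

lemma equiv_hit_rel: "equiv S hit_rel"
  by (auto simp: equiv_def hit_rel_def refl_on_def sym_def trans_def)

lemma hits_mult:
  assumes "x \<in> S" "s \<in> S"
  shows "hits (x \<cdot> s) = {t \<in> S. s \<cdot> t \<in> hits x}"
  using assms P_S[OF u(1)] by (auto simp: hits_def assoc closed)

lemma hit_rel_mult: "(x, y) \<in> hit_rel \<Longrightarrow> s \<in> S \<Longrightarrow> (x \<cdot> s, y \<cdot> s) \<in> hit_rel"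
  by (auto simp: hit_rel_def closed hits_mult)

text \<open>For rank \<open>m\<close> or \<open>k\<close> the upper half of
  \<open>u \<cdot> x\<close> is forced to be \<open>f1\<close> or \<open>u\<close>, so
  \<open>u \<cdot> x\<close> is determined by its lower half. For rank 2 the upper halves may
  differ, but \<open>u \<cdot> y\<close> arises from \<open>u \<cdot> x\<close> by left
  multiplication, which keeps the lower half of \<open>f1\<close>, and every closing of
  \<open>u \<cdot> y\<close> has upper half \<open>f1\<close> because one hit has it.\<close>

lemma hits_eqI:
  assumes x: "x \<in> S" "hits x \<noteq> {}" and y: "y \<in> S" "hits y \<noteq> {}" and lo: "lo (u \<cdot> x) = lo (u \<cdot> y)"
  shows "hits x \<subseteq> hits y" "lo (u \<cdot> x) \<in> Q"
proof -
  have S: "u \<in> S" "f1 \<in> S" using u P_S by auto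
  let ?x = "u \<cdot> x" and ?y = "u \<cdot> y"
  obtain s where s: "s \<in> S" "?x \<cdot> s = f1" using x(2) by (auto simp: hits_def)
  obtain s' where s': "s' \<in> S" "?y \<cdot> s' = f1" using y(2) by (auto simp: hits_def)
  have XS: "?x \<in> S" "?y \<in> S" using S x y closed by auto
  have rk: "rank ?x \<le> k" "rank ?y = rank ?x"
    using rank_mult[of u x] S x u rank_lo[OF XS(1)] rank_lo[OF XS(2)] lo by auto
  have r3: "rank ?x \<in> {m, 2, k}" using rank_le_4[OF XS(1)] rk mk by simp
  then show "lo ?x \<in> Q" using lo_P[OF XS(1)] rank_lo[OF XS(1)] by (simp add: Q_def)
  show "hits x \<subseteq> hits y"
  proof (cases "rank ?x = 2")
    case True
    let ?b = "?y \<cdot> star ?x"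
    have bS: "?b \<in> S" using XS star_closed closed by simp
    have b: "?b \<cdot> ?x = ?y" using XS mult_lo[OF XS(2)] lo by (simp add: assoc star_closed lo_def)
    show ?thesis
    proof
      fix t assume "t \<in> hits x"
      then have t: "t \<in> S" "?x \<cdot> t = f1" by (auto simp: hits_def)
      have yt: "?y \<cdot> t = ?b \<cdot> f1" using b t XS bS by (metis assoc)
      have r: "rank (?y \<cdot> t) = m" "lo (?y \<cdot> t) = f1" using yt min_right[OF bS S(2)] u P_lo by auto
      have "up (?y \<cdot> t) = up (?y \<cdot> s')"
        using rank2_unique[OF XS(2) t(1) s'(1)] r s' True rk u by (simp add: up_def)
      then have "?y \<cdot> t = f1" using r s' XS t S u by - (rule eqI; simp add: closed P_up P_lo)
      then show "t \<in> hits y" using t by (simp add: hits_def)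
    qed
  next
    case False
    have "up ?x = up ?y"
    proof (cases "rank ?x = m")
      case True
      then show ?thesis using min_left[OF XS(1) s(1)] min_left[OF XS(2) s'(1)] s s' rk by simp
    next
      case F: False
      then have "rank ?x = k" using r3 False by simp
      then show ?thesis using up_stable[of u x] up_stable[of u y] S x y rk u by simp
    qed
    then have "?x = ?y" using lo XS eqI by blast
    then show ?thesis by (simp add: hits_def)
  qed
qed

section \<open>Number of classes, and faithfulness of the action on them\<close>

text \<open>\<open>None\<close> stands for the elements without hits. They form the absorbing class,
  the 1 in \<open>1 + card Q\<close>.\<close>

definition invariant :: "'a \<Rightarrow> 'a option" where
  "invariant x = (if hits x = {} then None else Some (lo (u \<cdot> x)))"

lemma invariant_cong:
  assumes "x \<in> S" "y \<in> S" "invariant x = invariant y"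
  shows "(x, y) \<in> hit_rel"
proof (cases "hits x = {}")
  case True
  then show ?thesis using assms by (auto simp: hit_rel_def invariant_def split: if_splits)
next
  case False
  then have "hits y \<noteq> {}" "lo (u \<cdot> x) = lo (u \<cdot> y)" using assms by (auto simp: invariant_def split: if_splits)
  then have "hits x \<subseteq> hits y" "hits y \<subseteq> hits x" using hits_eqI False assms by metis+
  then show ?thesis using assms by (simp add: hit_rel_def)
qed

lemma finite_classes: "finite (S // hit_rel)"
  by (rule finite_quotient[OF fin]) (auto simp: hit_rel_def)

lemma card_image_quotient:
  assumes "equiv S \<sigma>" "\<And>x y. x \<in> S \<Longrightarrow> y \<in> S \<Longrightarrow> g x = g y \<Longrightarrow> (x, y) \<in> \<sigma>" "g ` S \<subseteq> T" "finite T"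
  shows "card (S // \<sigma>) \<le> card T"
proof -
  have sel: "(SOME x. x \<in> X) \<in> X" "X \<subseteq> S" if "X \<in> S // \<sigma>" for X
    using that in_quotient_imp_non_empty[OF assms(1)] in_quotient_imp_subset[OF assms(1)] some_in_eq by blast+
  have "inj_on (\<lambda>X. g (SOME x. x \<in> X)) (S // \<sigma>)"
  proof (rule inj_onI)
    fix X X' assume X: "X \<in> S // \<sigma>" "X' \<in> S // \<sigma>" "g (SOME x. x \<in> X) = g (SOME x. x \<in> X')"
    then have "((SOME x. x \<in> X), (SOME x. x \<in> X')) \<in> \<sigma>" using assms(2) sel by blast
    then show "X = X'" using quotient_eqI[OF assms(1) X(1,2)] sel X by blast
  qed
  moreover have "(\<lambda>X. g (SOME x. x \<in> X)) ` (S // \<sigma>) \<subseteq> T" using sel assms(3) by blast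
  ultimately show ?thesis using assms(4) card_inj_on_le by blast
qed

lemma finite_Q: "finite Q" using finite_P by (simp add: Q_def)

lemma invariant_in: "x \<in> S \<Longrightarrow> invariant x \<in> insert None (Some ` Q)"
  using hits_eqI(2)[of x x] by (auto simp: invariant_def)

lemma card_quotient_le: "card (S // hit_rel) \<le> 1 + card Q"
proof -
  have "card (S // hit_rel) \<le> card (insert None (Some ` Q))"
    by (rule card_image_quotient[OF equiv_hit_rel, of invariant]) (use invariant_cong invariant_in finite_Q in auto)
  then show ?thesis using finite_Q by (simp add: card_image)
qed

text \<open>Separators \<open>z\<close>, \<open>s\<close> of total rank 4 are replaced by
  \<open>a\<close>, \<open>b\<close> with \<open>lo a = z\<close>, \<open>up b = s\<close> and
  \<open>a\<close> below \<open>u\<close>, chosen so that \<open>a \<cdot> t \<cdot> b\<close> has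
  only two possible values, one of them \<open>f1\<close>. Then \<open>b\<close> is a hit of exactly
  one of \<open>a \<cdot> x\<close> and \<open>a \<cdot> y\<close>.\<close>

lemma hit_rel_faithful:
  assumes x: "x \<in> S" and y: "y \<in> S" and eq: "\<And>z. z \<in> S \<Longrightarrow> (z \<cdot> x, z \<cdot> y) \<in> hit_rel"
  shows "x = y"
proof (rule ccontr)
  assume "x \<noteq> y"
  then obtain z s where zs: "z \<in> P" "s \<in> P" "rank z + rank s = 4" "z \<cdot> x \<cdot> s \<noteq> z \<cdot> y \<cdot> s"
    using separate x y by blast
  have S: "u \<in> S" "f1 \<in> S" "z \<in> S" "s \<in> S" using u P_S zs by auto
  have hit: "u \<cdot> (a \<cdot> x) \<cdot> b = f1 \<longleftrightarrow> u \<cdot> (a \<cdot> y) \<cdot> b = f1" if "a \<in> S" "b \<in> S" for a b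
    using eq[OF that(1)] that(2) by (auto simp: hit_rel_def hits_def)
  \<comment> \<open>Multiplication by \<open>star a\<close> and \<open>star b\<close> recovers the
    products with \<open>z\<close> and \<open>s\<close>.\<close>
  have transport: "a \<cdot> x \<cdot> b \<noteq> a \<cdot> y \<cdot> b" if "a \<in> S" "b \<in> S" "lo a = z" "up b = s" for a b
  proof
    assume e: "a \<cdot> x \<cdot> b = a \<cdot> y \<cdot> b"
    have "star a \<cdot> (a \<cdot> t \<cdot> b) \<cdot> star b = z \<cdot> t \<cdot> s" if "t \<in> S" for t
      using that \<open>a \<in> S\<close> \<open>b \<in> S\<close> \<open>lo a = z\<close>[symmetric] \<open>up b = s\<close>[symmetric]
      by (simp add: lo_def up_def assoc closed star_closed)
    then show False using zs x y e by metis
  qed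
  have contra: False if "a \<in> S" "b \<in> S" "lo a = z" "up b = s" "u \<cdot> a = a"
    "\<And>t t'. t \<in> {x, y} \<Longrightarrow> t' \<in> {x, y} \<Longrightarrow> a \<cdot> t \<cdot> b \<noteq> a \<cdot> t' \<cdot> b \<Longrightarrow> a \<cdot> t \<cdot> b = f1 \<or> a \<cdot> t' \<cdot> b = f1" for a b
  proof -
    have "u \<cdot> (a \<cdot> t) \<cdot> b = a \<cdot> t \<cdot> b" if "t \<in> S" for t using that \<open>a \<in> S\<close> \<open>u \<cdot> a = a\<close> S by (simp add: assoc[symmetric])
    then show False using hit[OF that(1,2)] that(6)[of x y] transport[OF that(1-4)] x y by auto
  qed
  have rz: "rank z \<in> {m, 2, k}" using rank_le_4[OF S(3)] zs(3) by simp
  show False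
  proof (cases "rank z = 2")
    case True
    then have s2: "rank s = 2" using zs by simp
    obtain w where w: "w \<in> P" "rank w = 2" "u \<cdot> w = w" "w \<cdot> f1 = f1" using rank2_below[OF S(3) True] by blast
    have wS: "w \<in> S" using w P_S by simp
    have fw: "f1 \<cdot> w = f1" using star_mult[OF wS S(2)] w u P_star by simp
    \<comment> \<open>Both separators have rank 2 here; the two values are \<open>w\<close> and its
      closing \<open>f1\<close>.\<close>
    define a where "a = elem w z"
    define b where "b = elem s w"
    have a: "a \<in> S" "up a = w" "lo a = z" "rank a = 2" "w \<cdot> a = a"
      using elem[of w z] w zs True up_mult[of a] by (auto simp: a_def)
    have b: "b \<in> S" "up b = s" "lo b = w" "rank b = 2" "b \<cdot> w = b"
      using elem[of s w] w zs s2 mult_lo[of b] by (auto simp: b_def)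
    have ua: "u \<cdot> a = a" using a w wS S by (metis assoc)
    have rk: "rank (a \<cdot> t \<cdot> b) = m \<or> rank (a \<cdot> t \<cdot> b) = 2" if "t \<in> S" for t
      using that a b rank_mult[of a "t \<cdot> b"] rank_le_4[of "a \<cdot> t \<cdot> b"] mk by (auto simp: closed assoc)
    have r2: "a \<cdot> t \<cdot> b = w" if "t \<in> S" "rank (a \<cdot> t \<cdot> b) = 2" for t
    proof (rule eqI)
      show "up (a \<cdot> t \<cdot> b) = up w" using that a b w up_stable[of a "t \<cdot> b"] by (simp add: closed assoc P_up)
      show "lo (a \<cdot> t \<cdot> b) = lo w" using that a b w lo_stable[of "a \<cdot> t" b] by (simp add: closed P_lo)
    qed (use that a b wS in \<open>auto simp: closed\<close>)
    have rm: "a \<cdot> t \<cdot> b = f1" if t: "t \<in> S" "rank (a \<cdot> t \<cdot> b) = m" for t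
    proof (rule eqI)
      let ?c = "a \<cdot> t \<cdot> b"
      have cS: "?c \<in> S" "star ?c \<in> S" using t a b closed star_closed by auto
      have wc: "w \<cdot> ?c = ?c" "?c \<cdot> w = ?c" using a b t wS
        by (metis assoc closed, metis assoc closed)
      have "w \<cdot> star ?c = star ?c" using star_mult[OF cS(1) wS] wc w P_star by simp
      then have "up (star ?c) = up (w \<cdot> f1)" "up ?c = up (w \<cdot> f1)"
        using rank2_unique[OF wS cS(2) S(2) w(2)] rank2_unique[OF wS cS(1) S(2) w(2)] wc t w u rank_star cS by (auto simp: up_def)
      then show "up ?c = up f1" "lo ?c = lo f1" using w u up_star[OF cS(1)] by (auto simp: P_up P_lo)
    qed (use t a b S in \<open>auto simp: closed\<close>)
    show False
    proof (rule contra[OF a(1) b(1) a(3) b(2) ua])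
      fix t t' assume "t \<in> {x, y}" "t' \<in> {x, y}" "a \<cdot> t \<cdot> b \<noteq> a \<cdot> t' \<cdot> b"
      then show "a \<cdot> t \<cdot> b = f1 \<or> a \<cdot> t' \<cdot> b = f1" using x y rk[of t] rk[of t'] r2[of t] r2[of t'] rm by auto
    qed
  next
    case n2: False
    show False
    proof (cases "rank z = k")
      case True
      then have sm: "rank s = m" using zs(3) True k_eq m_le by linarith
      \<comment> \<open>The two values are the elements \<open>f1\<close> and \<open>e2\<close> of
        minimal rank below \<open>u\<close> with lower half \<open>f1\<close>.\<close>
      define a where "a = elem u z"
      define b where "b = elem s f1"
      have a: "a \<in> S" "up a = u" "lo a = z" "u \<cdot> a = a"
        using elem[of u z] u zs True up_mult[of a] by (auto simp: a_def)
      have b: "b \<in> S" "up b = s" "lo b = f1" "rank b = m"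
        using elem[of s f1] u zs sm by (auto simp: b_def)
      have "a \<cdot> t \<cdot> b = f1 \<or> a \<cdot> t \<cdot> b = e2" if "t \<in> S" for t
        using that a b S min_right[of "a \<cdot> t" b]
        by (intro min_below_u) (simp_all add: closed assoc[symmetric])
      then show False using contra[OF a(1) b(1) a(3) b(2) a(4)] x y by (metis insertE singletonD)
    next
      case False
      then have zm: "rank z = m" "rank s = k" using rz n2 False zs(3) k_eq m_le by auto
      \<comment> \<open>The dual choice, with values \<open>f1\<close> and
        \<open>star e2\<close>.\<close>
      define a where "a = elem f1 z"
      define b where "b = elem s u"
      have a: "a \<in> S" "up a = f1" "lo a = z" "f1 \<cdot> a = a" "rank a = m"
        using elem[of f1 z] u zs zm up_mult[of a] by (auto simp: a_def)
      have ua: "u \<cdot> a = a" using a u S by (metis assoc)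
      have b: "b \<in> S" "up b = s" "lo b = u" "b \<cdot> u = b"
        using elem[of s u] u zs zm mult_lo[of b] by (auto simp: b_def)
      have "a \<cdot> t \<cdot> b = f1 \<or> a \<cdot> t \<cdot> b = star e2" if "t \<in> S" for t
        using that a b S min_left[of a "t \<cdot> b"]
        by (intro min_below_u') (simp_all add: closed assoc)
      then show False using contra[OF a(1) b(1) a(3) b(2) ua] x y by (metis insertE singletonD)
    qed
  qed
qed

abbreviation hit_act :: "'a set \<Rightarrow> 'a \<Rightarrow> 'a set" where
  "hit_act \<equiv> class_act (\<cdot>) hit_rel"

lemma hit_act: "z \<in> S \<Longrightarrow> x \<in> S \<Longrightarrow> hit_act (hit_rel `` {z}) x = hit_rel `` {z \<cdot> x}"
  using class_act_class[OF equiv_hit_rel hit_rel_mult] .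

lemma hit_act_faithful: "faithful_action S (\<cdot>) (S // hit_rel) hit_act"
proof (rule class_act_action[OF equiv_hit_rel hit_rel_mult closed assoc])
  fix x x' assume x: "x \<in> S" "x' \<in> S" "x \<noteq> x'"
  then obtain z where z: "z \<in> S" "(z \<cdot> x, z \<cdot> x') \<notin> hit_rel" using hit_rel_faithful by blast
  then have "hit_rel `` {z \<cdot> x} \<noteq> hit_rel `` {z \<cdot> x'}"
    using eq_equiv_class[OF _ equiv_hit_rel] x closed by blast
  then show "\<exists>X\<in>S // hit_rel. hit_act X x \<noteq> hit_act X x'"
    using x z by (intro bexI[of _ "hit_rel `` {z}"]) (auto simp: hit_act quotientI)
qed

text \<open>The general lower bound, applied to this very action, makes the upper estimate
  sharp.\<close>

lemma card_quotient: "card (S // hit_rel) = 1 + card Q"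
  using card_quotient_le action_card_ge[OF hit_act_faithful finite_classes] by simp

text \<open>Existence comes from counting: if every element had a hit, \<open>invariant\<close>
  would take at most \<open>card Q\<close> values, one too few.\<close>

lemma sink_class: "\<exists>X\<in>S // hit_rel. \<forall>x\<in>S. hit_act X x = X"
proof -
  have "\<exists>z\<in>S. hits z = {}"
  proof (rule ccontr)
    assume "\<not> (\<exists>z\<in>S. hits z = {})"
    then have "invariant x \<in> Some ` Q" if "x \<in> S" for x using invariant_in[OF that] that by (auto simp: invariant_def)
    then have "card (S // hit_rel) \<le> card (Some ` Q)"
      by (intro card_image_quotient[OF equiv_hit_rel, of invariant]) (use invariant_cong finite_Q in auto)
    then show False using card_quotient by (simp add: card_image)
  qed
  then obtain z where z: "z \<in> S" "hits z = {}" by blast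
  have "(z, z \<cdot> x) \<in> hit_rel" if "x \<in> S" for x
    using z that hits_mult[OF z(1) that] by (auto simp: hit_rel_def closed)
  then have "hit_rel `` {z \<cdot> x} = hit_rel `` {z}" if "x \<in> S" for x
    using equiv_class_eq[OF equiv_hit_rel] that by metis
  then show ?thesis using z by (intro bexI[of _ "hit_rel `` {z}"]) (auto simp: hit_act quotientI)
qed

end

section \<open>Temperley--Lieb diagrams as matchings\<close>

definition vertex_at :: "nat \<Rightarrow> nat \<Rightarrow> vertex" where
  "vertex_at n x = (if x \<le> n then Up x else Low (2 * n + 1 - x))"

definition diagram_of :: "nat \<Rightarrow> (nat \<Rightarrow> nat) \<Rightarrow> diagram" where
  "diagram_of n f = (\<lambda>x. {vertex_at n x, vertex_at n (f x)}) ` {1..2*n}"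

fun vertex_color :: "(nat \<Rightarrow> bool) \<Rightarrow> (nat \<Rightarrow> bool) \<Rightarrow> vertex \<Rightarrow> bool" where
  "vertex_color a b (Up x) = a x"
| "vertex_color a b (Low x) = b x"
| "vertex_color a b (Mid x) = False"

text \<open>The analogue of \<open>color_rel\<close> for arbitrary partitions. It is injective on
  them, so identities between diagrams can be checked on relations.\<close>

definition diagram_rel :: "diagram \<Rightarrow> ((nat \<Rightarrow> bool) \<times> (nat \<Rightarrow> bool)) set" where
  "diagram_rel \<alpha> = {(a, b). \<forall>B\<in>\<alpha>. \<forall>v\<in>B. \<forall>w\<in>B. vertex_color a b v = vertex_color a b w}"

lemma vertex_at_in: "x \<in> {1..2*n} \<Longrightarrow> vertex_at n x \<in> vertices n"
proof -
  assume x: "x \<in> {1..2*n}"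
  show ?thesis
  proof (cases "x \<le> n")
    case False
    then have "2 * n + 1 - x \<in> {1..n}" using x by auto
    then show ?thesis using False by (simp add: vertex_at_def vertices_def)
  qed (use x in \<open>simp add: vertex_at_def vertices_def\<close>)
qed

lemma boundary_pos_vertex_at: "x \<in> {1..2*n} \<Longrightarrow> boundary_pos n (vertex_at n x) = x"
  by (auto simp: vertex_at_def)

lemma vertex_at_boundary_pos: "v \<in> vertices n \<Longrightarrow> vertex_at n (boundary_pos n v) = v"
  by (auto simp: vertices_def vertex_at_def)

lemma boundary_pos_in: "v \<in> vertices n \<Longrightarrow> boundary_pos n v \<in> {1..2*n}"
  by (auto simp: vertices_def)

lemma vertex_at_inj: "x \<in> {1..2*n} \<Longrightarrow> y \<in> {1..2*n} \<Longrightarrow> vertex_at n x = vertex_at n y \<Longrightarrow> x = y"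
  using boundary_pos_vertex_at by metis

lemma vertices_eq: "vertices n = vertex_at n ` {1..2*n}"
  using vertex_at_in vertex_at_boundary_pos boundary_pos_in by (force intro: rev_image_eqI)

lemma vertex_color_vertex_at: "vertex_color a b (vertex_at n x) = join_colors n a b x"
  by (simp add: vertex_at_def join_colors_def)

lemma diagram_rel_of: "diagram_rel (diagram_of n f) = color_rel n f"
  unfolding diagram_rel_def color_rel_def diagram_of_def coloring_def
  by (auto simp: vertex_color_vertex_at)

text \<open>The indicator of a block is a colouring, so each block of one partition contains every
  block of the other that it meets.\<close>

lemma diagram_rel_inj:
  assumes "partition_on (vertices n) \<alpha>" "partition_on (vertices n) \<beta>" "diagram_rel \<alpha> = diagram_rel \<beta>"
  shows "\<alpha> = \<beta>"
proof -
  have *: "v \<in> B" if \<alpha>: "partition_on (vertices n) \<alpha>" and \<beta>: "partition_on (vertices n) \<beta>"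
    and rel: "diagram_rel \<alpha> \<subseteq> diagram_rel \<beta>" and B: "B \<in> \<alpha>" "w \<in> B" and C: "C \<in> \<beta>" "w \<in> C" "v \<in> C"
    for \<alpha> \<beta> B C v w
  proof -
    let ?a = "\<lambda>x. Up x \<in> B" and ?b = "\<lambda>x. Low x \<in> B"
    have col: "vertex_color ?a ?b x = (x \<in> B)" if "x \<in> vertices n" for x
      using that by (auto simp: vertices_def)
    have sub: "D \<subseteq> vertices n" if "D \<in> \<alpha> \<or> D \<in> \<beta>" for D
      using \<alpha> \<beta> that by (auto simp: partition_on_def)
    have "(?a, ?b) \<in> diagram_rel \<alpha>"
      unfolding diagram_rel_def
    proof clarify
      fix D x y assume D: "D \<in> \<alpha>" "x \<in> D" "y \<in> D"
      have "D = B \<or> D \<inter> B = {}" using \<alpha> D(1) B(1) by (auto simp: partition_on_def disjoint_def)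
      then show "vertex_color ?a ?b x = vertex_color ?a ?b y"
        using D col[of x] col[of y] sub[of D] by auto
    qed
    then have "vertex_color ?a ?b w = vertex_color ?a ?b v" using rel C unfolding diagram_rel_def by blast
    then show ?thesis using col[of w] col[of v] sub[of C] C B by auto
  qed
  have "\<alpha> \<subseteq> \<beta>" if \<alpha>: "partition_on (vertices n) \<alpha>" and \<beta>: "partition_on (vertices n) \<beta>"
    and rel: "diagram_rel \<alpha> = diagram_rel \<beta>" for \<alpha> \<beta>
  proof
    fix B assume B: "B \<in> \<alpha>"
    then obtain w where w: "w \<in> B" using \<alpha> by (metis ex_in_conv partition_on_def)
    then have "w \<in> \<Union>\<beta>" using \<alpha> \<beta> B by (auto simp: partition_on_def)
    then obtain C where C: "C \<in> \<beta>" "w \<in> C" by blast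
    have "B = C" using *[OF \<alpha> \<beta> _ B w C] *[OF \<beta> \<alpha> _ C B w] rel by blast
    then show "B \<in> \<beta>" using C by simp
  qed
  then show ?thesis using assms by blast
qed

section \<open>The product of partitions as composition of relations\<close>

lemma joined_refl: "joined \<alpha> \<beta> x x"
  and joined_sym: "joined \<alpha> \<beta> x y \<Longrightarrow> joined \<alpha> \<beta> y x"
  and joined_trans: "joined \<alpha> \<beta> x y \<Longrightarrow> joined \<alpha> \<beta> y z \<Longrightarrow> joined \<alpha> \<beta> x z"
  unfolding joined_def by (rule equivclp_refl, erule equivclp_sym, erule (1) equivclp_trans)

lemma equiv_joined:
  "equiv (vertices n) {(x, y). x \<in> vertices n \<and> y \<in> vertices n \<and> joined \<alpha> \<beta> x y}"
proof (rule equivI)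
  show "sym {(x, y). x \<in> vertices n \<and> y \<in> vertices n \<and> joined \<alpha> \<beta> x y}"
    by (rule symI) (simp add: joined_sym)
  show "trans {(x, y). x \<in> vertices n \<and> y \<in> vertices n \<and> joined \<alpha> \<beta> x y}"
    by (rule transI) (use joined_trans in blast)
qed (auto simp: refl_on_def joined_refl)

lemma partition_on_diagram_mult: "partition_on (vertices n) (diagram_mult n \<alpha> \<beta>)"
  unfolding diagram_mult_def by (rule partition_on_quotient[OF equiv_joined])

lemma diagram_mult_block_iff:
  assumes "v \<in> vertices n" "w \<in> vertices n"
  shows "(\<exists>B\<in>diagram_mult n \<alpha> \<beta>. v \<in> B \<and> w \<in> B) \<longleftrightarrow> joined \<alpha> \<beta> v w"
proof
  assume "\<exists>B\<in>diagram_mult n \<alpha> \<beta>. v \<in> B \<and> w \<in> B"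
  then obtain u where "joined \<alpha> \<beta> u v" "joined \<alpha> \<beta> u w"
    unfolding diagram_mult_def quotient_def by blast
  then show "joined \<alpha> \<beta> v w" using joined_sym joined_trans by blast
next
  assume j: "joined \<alpha> \<beta> v w"
  let ?r = "{(x, y). x \<in> vertices n \<and> y \<in> vertices n \<and> joined \<alpha> \<beta> x y}"
  have "?r `` {v} \<in> diagram_mult n \<alpha> \<beta>" unfolding diagram_mult_def using assms(1) by (rule quotientI)
  moreover have "v \<in> ?r `` {v}" "w \<in> ?r `` {v}" using assms j joined_refl by auto
  ultimately show "\<exists>B\<in>diagram_mult n \<alpha> \<beta>. v \<in> B \<and> w \<in> B" by (intro bexI[of _ "?r `` {v}"] conjI)
qed

text \<open>A colouring is constant on the generated equivalence iff it is constant on the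
  generating blocks. So a colouring of the outer rows respects the product iff some colouring of the
  middle row fits both factors.\<close>

lemma diagram_rel_mult:
  assumes \<alpha>: "partition_on (vertices n) \<alpha>" and \<beta>: "partition_on (vertices n) \<beta>"
  shows "diagram_rel (diagram_mult n \<alpha> \<beta>) = diagram_rel \<alpha> O diagram_rel \<beta>"
proof (intro equalityI subrelI)
  let ?blocks = "(image lower_to_mid) ` \<alpha> \<union> (image upper_to_mid) ` \<beta>"
  let ?link = "\<lambda>x y. \<exists>B\<in>?blocks. x \<in> B \<and> y \<in> B"
  have sub: "x \<in> vertices n" if "x \<in> B" "B \<in> \<alpha> \<or> B \<in> \<beta>" for x B
    using \<alpha> \<beta> that by (auto simp: partition_on_def)
  {
    fix a b assume "(a, b) \<in> diagram_rel \<alpha> O diagram_rel \<beta>"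
    then obtain m where m: "(a, m) \<in> diagram_rel \<alpha>" "(m, b) \<in> diagram_rel \<beta>" by blast
    define c where "c v = (case v of Up x \<Rightarrow> a x | Low x \<Rightarrow> b x | Mid x \<Rightarrow> m x)" for v
    have c\<alpha>: "c (lower_to_mid v) = vertex_color a m v" if "v \<in> vertices n" for v
      using that by (auto simp: vertices_def c_def)
    have c\<beta>: "c (upper_to_mid v) = vertex_color m b v" if "v \<in> vertices n" for v
      using that by (auto simp: vertices_def c_def)
    have link: "c x = c y" if "?link x y" for x y
    proof -
      from that consider B v w where "B \<in> \<alpha>" "v \<in> B" "w \<in> B" "x = lower_to_mid v" "y = lower_to_mid w"
        | B v w where "B \<in> \<beta>" "v \<in> B" "w \<in> B" "x = upper_to_mid v" "y = upper_to_mid w"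
        by blast
      then show ?thesis
      proof cases
        case 1
        then show ?thesis using c\<alpha> sub m(1) unfolding diagram_rel_def by blast
      next
        case 2
        then show ?thesis using c\<beta> sub m(2) unfolding diagram_rel_def by blast
      qed
    qed
    have joined: "c x = c y" if "joined \<alpha> \<beta> x y" for x y
      using that unfolding joined_def
    proof (induction rule: equivclp_induct)
      case (step y z)
      then show ?case using link by metis
    qed simp
    have vc: "vertex_color a b v = c v" if "v \<in> vertices n" for v
      using that by (auto simp: vertices_def c_def)
    have "vertex_color a b v = vertex_color a b w" if B: "B \<in> diagram_mult n \<alpha> \<beta>" "v \<in> B" "w \<in> B" for B v w
    proof -
      have vw: "v \<in> vertices n" "w \<in> vertices n"
        using partition_on_diagram_mult[of n \<alpha> \<beta>] B by (auto simp: partition_on_def)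
      then have "joined \<alpha> \<beta> v w" using diagram_mult_block_iff[OF vw] B by blast
      then show ?thesis using joined[of v w] vc[OF vw(1)] vc[OF vw(2)] by simp
    qed
    then show "(a, b) \<in> diagram_rel (diagram_mult n \<alpha> \<beta>)"
      unfolding diagram_rel_def by (intro CollectI case_prodI ballI)
  }
  fix a b assume ab: "(a, b) \<in> diagram_rel (diagram_mult n \<alpha> \<beta>)"
  have same: "vertex_color a b v = vertex_color a b w"
    if "v \<in> vertices n" "w \<in> vertices n" "joined \<alpha> \<beta> v w" for v w
    using ab diagram_mult_block_iff[OF that(1,2), of \<alpha> \<beta>] that(3) unfolding diagram_rel_def by blast
  \<comment> \<open>A middle point takes the colour of the outer vertices joined to it; components
    inside the middle row get \<open>False\<close>.\<close>
  define m where "m i \<longleftrightarrow> (\<exists>v\<in>vertices n. joined \<alpha> \<beta> v (Mid i) \<and> vertex_color a b v)" for i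
  have mid: "vertex_color a b v = m i" if "v \<in> vertices n" "joined \<alpha> \<beta> v (Mid i)" for v i
  proof
    assume "vertex_color a b v"
    then show "m i" using that unfolding m_def by blast
  next
    assume "m i"
    then obtain w where w: "w \<in> vertices n" "joined \<alpha> \<beta> w (Mid i)" "vertex_color a b w" unfolding m_def by blast
    have "joined \<alpha> \<beta> w v" by (rule joined_trans[OF w(2) joined_sym[OF that(2)]])
    then show "vertex_color a b v" using same[OF w(1) that(1)] w(3) by simp
  qed
  have midmid: "m i = m j" if "joined \<alpha> \<beta> (Mid i) (Mid j)" for i j
    unfolding m_def using joined_trans[OF _ that] joined_trans[OF _ joined_sym[OF that]] by (intro bex_cong) blast+
  have jlink: "joined \<alpha> \<beta> x y" if "?link x y" for x y
    unfolding joined_def by (rule r_into_equivclp) (rule that)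
  have V: "(\<exists>i. v = Up i) \<or> (\<exists>i. v = Low i)" if "v \<in> vertices n" for v
    using that by (auto simp: vertices_def)
  have "(a, m) \<in> diagram_rel \<alpha>"
    unfolding diagram_rel_def
  proof clarify
    fix B v w assume B: "B \<in> \<alpha>" "v \<in> B" "w \<in> B"
    have j: "joined \<alpha> \<beta> (lower_to_mid v) (lower_to_mid w)"
      by (rule jlink, rule bexI[of _ "lower_to_mid ` B"]) (use B in auto)
    have vw: "v \<in> vertices n" "w \<in> vertices n" using sub B by blast+
    show "vertex_color a m v = vertex_color a m w"
      using V[OF vw(1)] V[OF vw(2)]
    proof (elim disjE exE)
      fix i i' assume "v = Up i" "w = Up i'"
      then show ?thesis using j same[OF vw] midmid[of i i'] by simp
    next
      fix i i' assume "v = Up i" "w = Low i'"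
      then show ?thesis using j mid[OF vw(1), of i'] mid[OF vw(2), of i] joined_sym[OF j] by simp
    next
      fix i i' assume "v = Low i" "w = Up i'"
      then show ?thesis using j mid[OF vw(1), of i'] mid[OF vw(2), of i] joined_sym[OF j] by simp
    next
      fix i i' assume "v = Low i" "w = Low i'"
      then show ?thesis using j same[OF vw] midmid[of i i'] by simp
    qed
  qed
  moreover have "(m, b) \<in> diagram_rel \<beta>"
    unfolding diagram_rel_def
  proof clarify
    fix B v w assume B: "B \<in> \<beta>" "v \<in> B" "w \<in> B"
    have j: "joined \<alpha> \<beta> (upper_to_mid v) (upper_to_mid w)"
      by (rule jlink, rule bexI[of _ "upper_to_mid ` B"]) (use B in auto)
    have vw: "v \<in> vertices n" "w \<in> vertices n" using sub B by blast+
    show "vertex_color m b v = vertex_color m b w"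
      using V[OF vw(1)] V[OF vw(2)]
    proof (elim disjE exE)
      fix i i' assume "v = Up i" "w = Up i'"
      then show ?thesis using j same[OF vw] midmid[of i i'] by simp
    next
      fix i i' assume "v = Up i" "w = Low i'"
      then show ?thesis using j mid[OF vw(1), of i'] mid[OF vw(2), of i] joined_sym[OF j] by simp
    next
      fix i i' assume "v = Low i" "w = Up i'"
      then show ?thesis using j mid[OF vw(1), of i'] mid[OF vw(2), of i] joined_sym[OF j] by simp
    next
      fix i i' assume "v = Low i" "w = Low i'"
      then show ?thesis using j same[OF vw] midmid[of i i'] by simp
    qed
  qed
  ultimately show "(a, b) \<in> diagram_rel \<alpha> O diagram_rel \<beta>" by blast
qed

lemma partition_on_diagram_of:
  assumes f: "tl_matching n f"
  shows "partition_on (vertices n) (diagram_of n f)"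
proof -
  note D = tl_matchingD[OF f]
  have "\<Union>(diagram_of n f) = vertices n"
    unfolding diagram_of_def vertices_eq using D(1) by blast
  moreover have "disjoint (diagram_of n f)"
    unfolding disjoint_def diagram_of_def
  proof (intro ballI impI, elim imageE)
    fix A B x y assume x: "x \<in> {1..2*n}" "A = {vertex_at n x, vertex_at n (f x)}"
      and y: "y \<in> {1..2*n}" "B = {vertex_at n y, vertex_at n (f y)}" and ne: "A \<noteq> B"
    show "A \<inter> B = {}"
    proof (rule ccontr)
      assume "A \<inter> B \<noteq> {}"
      then have "x = y \<or> x = f y \<or> f x = y \<or> f x = f y"
        using x(2) y(2) vertex_at_inj x(1) y(1) D(1) by blast
      then have "y = x \<or> y = f x" using D(2)[OF x(1)] D(2)[OF y(1)] by metis
      then show False using ne x(2) y(2) D(2)[OF x(1)] by auto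
    qed
  qed
  moreover have "{} \<notin> diagram_of n f" by (auto simp: diagram_of_def)
  ultimately show ?thesis by (simp add: partition_on_def)
qed

lemma carrier_temperley_lieb: "carrier (temperley_lieb n) = diagram_of n ` {f. tl_matching n f}"
proof (intro equalityI subsetI)
  fix \<alpha> assume "\<alpha> \<in> diagram_of n ` {f. tl_matching n f}"
  then obtain f where f: "tl_matching n f" and \<alpha>: "\<alpha> = diagram_of n f" by blast
  note D = tl_matchingD[OF f]
  have card: "card B = 2" if B: "B \<in> \<alpha>" for B
  proof -
    obtain x where x: "x \<in> {1..2*n}" "B = {vertex_at n x, vertex_at n (f x)}"
      using B unfolding \<alpha> diagram_of_def by blast
    then have "vertex_at n x \<noteq> vertex_at n (f x)" using vertex_at_inj[OF x(1) D(1)[OF x(1)]] D(3)[OF x(1)] by metis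
    then show ?thesis using x by simp
  qed
  have "planar n \<alpha>"
    unfolding planar_def
  proof (intro notI, elim bexE conjE)
    fix A B a b c d assume A: "A \<in> \<alpha>" "a \<in> A" "c \<in> A" and B: "B \<in> \<alpha>" "b \<in> B" "d \<in> B"
      and lt: "boundary_pos n a < boundary_pos n b" "boundary_pos n b < boundary_pos n c" "boundary_pos n c < boundary_pos n d"
    have pair: "boundary_pos n v \<in> {1..2*n} \<and> boundary_pos n w = f (boundary_pos n v)"
      if C: "C \<in> \<alpha>" "v \<in> C" "w \<in> C" "boundary_pos n v \<noteq> boundary_pos n w" for C v w
    proof -
      obtain x where x: "x \<in> {1..2*n}" "C = {vertex_at n x, vertex_at n (f x)}"
        using C(1) unfolding \<alpha> diagram_of_def by blast
      then show ?thesis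
        using C D[OF x(1)] boundary_pos_vertex_at[OF x(1)] boundary_pos_vertex_at[OF D(1)[OF x(1)]] by auto
    qed
    have "boundary_pos n c = f (boundary_pos n a)" "boundary_pos n d = f (boundary_pos n b)"
      "boundary_pos n a \<in> {1..2*n}" "boundary_pos n b \<in> {1..2*n}"
      using pair[OF A] pair[OF B] lt by auto
    then show False using lt f unfolding tl_matching_def nc_matching_def by metis
  qed
  then show "\<alpha> \<in> carrier (temperley_lieb n)"
    using partition_on_diagram_of[OF f] card by (simp add: temperley_lieb_def partition_monoid_def \<alpha>)
next
  fix \<alpha> assume "\<alpha> \<in> carrier (temperley_lieb n)"
  then have part: "partition_on (vertices n) \<alpha>" and planar: "planar n \<alpha>" and card: "\<And>B. B \<in> \<alpha> \<Longrightarrow> card B = 2"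
    by (auto simp: temperley_lieb_def partition_monoid_def)
  have sub: "B \<subseteq> vertices n" if "B \<in> \<alpha>" for B using part that by (auto simp: partition_on_def)
  have ex: "\<exists>y. y \<in> {1..2*n} \<and> y \<noteq> x \<and> {vertex_at n x, vertex_at n y} \<in> \<alpha>" if x: "x \<in> {1..2*n}" for x
  proof -
    have "vertex_at n x \<in> \<Union>\<alpha>" using part vertex_at_in[OF x] by (auto simp: partition_on_def)
    then obtain B where B: "B \<in> \<alpha>" "vertex_at n x \<in> B" by blast
    obtain v where v: "B = {vertex_at n x, v}" "v \<noteq> vertex_at n x"
      using card[OF B(1)] B(2) unfolding card_2_iff by auto
    then have "v \<in> vertices n" using sub B by auto
    then have "boundary_pos n v \<in> {1..2*n}" "vertex_at n (boundary_pos n v) = v"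
      using boundary_pos_in vertex_at_boundary_pos by auto
    then show ?thesis using B v by (intro exI[of _ "boundary_pos n v"]) auto
  qed
  define f where "f x = (SOME y. y \<in> {1..2*n} \<and> y \<noteq> x \<and> {vertex_at n x, vertex_at n y} \<in> \<alpha>)" for x
  have f: "f x \<in> {1..2*n}" "f x \<noteq> x" "{vertex_at n x, vertex_at n (f x)} \<in> \<alpha>" if "x \<in> {1..2*n}" for x
    using someI_ex[OF ex[OF that]] unfolding f_def by auto
  have same: "B = C" if "B \<in> \<alpha>" "C \<in> \<alpha>" "v \<in> B" "v \<in> C" for B C v
    using part that unfolding partition_on_def disjoint_def by blast
  have ff: "f (f x) = x" if x: "x \<in> {1..2*n}" for x
  proof -
    note fx = f(1)[OF x]
    have "{vertex_at n x, vertex_at n (f x)} = {vertex_at n (f x), vertex_at n (f (f x))}"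
      by (rule same[OF f(3)[OF x] f(3)[OF fx], of "vertex_at n (f x)"]) simp_all
    then have "vertex_at n x = vertex_at n (f (f x))"
      by (metis doubleton_eq_iff)
    then show ?thesis using vertex_at_inj[OF x f(1)[OF fx]] by simp
  qed
  have "\<not> (x < y \<and> y < f x \<and> f x < f y)" if x: "x \<in> {1..2*n}" and y: "y \<in> {1..2*n}" for x y
  proof
    assume A: "x < y \<and> y < f x \<and> f x < f y"
    let ?A = "{vertex_at n x, vertex_at n (f x)}" and ?B = "{vertex_at n y, vertex_at n (f y)}"
    have p: "boundary_pos n (vertex_at n x) = x" "boundary_pos n (vertex_at n y) = y"
      "boundary_pos n (vertex_at n (f x)) = f x" "boundary_pos n (vertex_at n (f y)) = f y"
      using boundary_pos_vertex_at x y f(1) by auto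
    have "?A \<noteq> ?B"
    proof
      assume "?A = ?B"
      then have "vertex_at n y = vertex_at n x \<or> vertex_at n y = vertex_at n (f x)" by blast
      then have "y = x \<or> y = f x" using p by metis
      then show False using A by auto
    qed
    then have "\<exists>A\<in>\<alpha>. \<exists>B\<in>\<alpha>. A \<noteq> B \<and> (\<exists>a\<in>A. \<exists>b\<in>B. \<exists>c\<in>A. \<exists>d\<in>B.
       boundary_pos n a < boundary_pos n b \<and> boundary_pos n b < boundary_pos n c \<and> boundary_pos n c < boundary_pos n d)"
      using f(3)[OF x] f(3)[OF y] A p
      by (intro bexI[of _ ?A] bexI[of _ ?B] conjI bexI[of _ "vertex_at n x"] bexI[of _ "vertex_at n y"]
          bexI[of _ "vertex_at n (f x)"] bexI[of _ "vertex_at n (f y)"]) simp_all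
    then show False using planar unfolding planar_def by blast
  qed
  then have tl: "tl_matching n f"
    using f ff by (simp add: tl_matching_def nc_matching_def matching_on_def)
  have "diagram_of n f \<subseteq> \<alpha>" using f(3) by (auto simp: diagram_of_def)
  moreover have "\<alpha> \<subseteq> diagram_of n f"
  proof
    fix B assume B: "B \<in> \<alpha>"
    then obtain v where v: "v \<in> B" using card[OF B] by fastforce
    then have "v \<in> vertices n" using sub B by blast
    then obtain x where x: "x \<in> {1..2*n}" "v = vertex_at n x" unfolding vertices_eq by blast
    have "B = {vertex_at n x, vertex_at n (f x)}" by (rule same[OF B f(3)[OF x(1)] v]) (simp add: x)
    then show "B \<in> diagram_of n f" using x by (simp add: diagram_of_def)
  qed
  ultimately show "\<alpha> \<in> diagram_of n ` {f. tl_matching n f}" using tl by blast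
qed

text \<open>Exchanging \<open>Up x\<close> and \<open>Low x\<close> reverses the boundary
  order.\<close>

lemma diagram_star_of:
  assumes f: "tl_matching n f"
  shows "diagram_star (diagram_of n f) = diagram_of n (mirror n f)"
proof -
  have sw: "swap_vertex (vertex_at n x) = vertex_at n (2 * n + 1 - x)" if "x \<in> {1..2*n}" for x
    using that by (auto simp: vertex_at_def)
  have "image swap_vertex {vertex_at n x, vertex_at n (f x)} =
      {vertex_at n (2 * n + 1 - x), vertex_at n (mirror n f (2 * n + 1 - x))}" if x: "x \<in> {1..2*n}" for x
  proof -
    have "2 * n + 1 - (2 * n + 1 - x) = x" using x by auto
    then show ?thesis using sw[OF x] sw[OF tl_matchingD(1)[OF f x]] by simp
  qed
  then have "diagram_star (diagram_of n f) =
      (\<lambda>x. {vertex_at n (2 * n + 1 - x), vertex_at n (mirror n f (2 * n + 1 - x))}) ` {1..2*n}"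
    unfolding diagram_star_def diagram_of_def image_image by (intro image_cong refl) blast
  also have "\<dots> = (\<lambda>x. {vertex_at n x, vertex_at n (mirror n f x)}) ` ((\<lambda>x. 2 * n + 1 - x) ` {1..2*n})"
    by (simp only: image_image)
  also have "(\<lambda>x. 2 * n + 1 - x) ` {1..2*n} = {1..2*n}"
  proof (intro equalityI subsetI)
    fix x assume "x \<in> {1..2*n}"
    then have "2 * n + 1 - x \<in> {1..2*n}" "x = 2 * n + 1 - (2 * n + 1 - x)" by auto
    then show "x \<in> (\<lambda>x. 2 * n + 1 - x) ` {1..2*n}" by blast
  qed auto
  finally show ?thesis by (simp only: diagram_of_def)
qed

lemma diagram_rank_of:
  assumes f: "tl_matching n f"
  shows "diagram_rank (diagram_of n f) = card (defects n (upper n f))"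
proof -
  note D = tl_matchingD[OF f]
  let ?X = "{x \<in> {1..n}. n < f x}" and ?B = "\<lambda>x. {vertex_at n x, vertex_at n (f x)}"
  have up: "vertex_at n x \<in> range Up \<longleftrightarrow> x \<le> n" "vertex_at n x \<in> range Low \<longleftrightarrow> n < x" for x
    by (auto simp: vertex_at_def)
  have "transversals (diagram_of n f) = ?B ` ?X"
  proof (intro equalityI subsetI)
    fix B assume "B \<in> transversals (diagram_of n f)"
    then obtain x where x: "x \<in> {1..2*n}" "B = ?B x" "B \<inter> range Up \<noteq> {}" "B \<inter> range Low \<noteq> {}"
      unfolding transversals_def diagram_of_def by blast
    then have c: "x \<le> n \<and> n < f x \<or> f x \<le> n \<and> n < x" using up by auto
    show "B \<in> ?B ` ?X"
    proof (cases "x \<le> n")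
      case True
      then show ?thesis using c x by auto
    next
      case False
      then have "f x \<in> ?X" "B = ?B (f x)" using c x D[OF x(1)] by auto
      then show ?thesis by blast
    qed
  next
    fix B assume "B \<in> ?B ` ?X"
    then obtain x where x: "x \<in> ?X" "B = ?B x" by blast
    then have "vertex_at n x \<in> range Up" "vertex_at n (f x) \<in> range Low" "x \<in> {1..2*n}" using up by auto
    then show "B \<in> transversals (diagram_of n f)"
      unfolding transversals_def diagram_of_def using x(2) by blast
  qed
  moreover have "inj_on ?B ?X"
  proof (rule inj_onI)
    fix x y assume x: "x \<in> ?X" and y: "y \<in> ?X" and eq: "?B x = ?B y"
    have "vertex_at n x \<noteq> vertex_at n (f y)" using up(1)[of x] up(1)[of "f y"] x y by auto
    then have "vertex_at n x = vertex_at n y" using eq by (auto simp: doubleton_eq_iff)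
    then show "x = y" using vertex_at_inj[of x n y] x y by auto
  qed
  ultimately show ?thesis unfolding diagram_rank_def defects_upper[OF f] by (simp add: card_image)
qed

section \<open>Monoid laws, halves and projections\<close>

abbreviation TL :: "nat \<Rightarrow> diagram set" where "TL n \<equiv> carrier (temperley_lieb n)"

lemma TL_E:
  assumes "x \<in> TL n"
  obtains f where "tl_matching n f" "x = diagram_of n f"
  using assms unfolding carrier_temperley_lieb by blast

lemma diagram_of_in_TL: "tl_matching n f \<Longrightarrow> diagram_of n f \<in> TL n"
  unfolding carrier_temperley_lieb by blast

lemma TL_partition: "x \<in> TL n \<Longrightarrow> partition_on (vertices n) x"
  by (elim TL_E) (simp add: partition_on_diagram_of)

lemma TL_mult: "x \<otimes>\<^bsub>temperley_lieb n\<^esub> y = diagram_mult n x y"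
  by (simp add: temperley_lieb_def partition_monoid_def)

lemma TL_rel_inj: "x \<in> TL n \<Longrightarrow> y \<in> TL n \<Longrightarrow> diagram_rel x = diagram_rel y \<Longrightarrow> x = y"
  using diagram_rel_inj TL_partition by blast

lemma TL_rel_mult: "x \<in> TL n \<Longrightarrow> y \<in> TL n \<Longrightarrow> diagram_rel (diagram_mult n x y) = diagram_rel x O diagram_rel y"
  using diagram_rel_mult TL_partition by blast

text \<open>The noncrossing product of matchings and the product of partitions have the same colour
  relation, so planarity carries over.\<close>

lemma TL_closed:
  assumes "x \<in> TL n" "y \<in> TL n" shows "diagram_mult n x y \<in> TL n"
proof -
  obtain f g where f: "tl_matching n f" "x = diagram_of n f" and g: "tl_matching n g" "y = diagram_of n g"
    using assms by (metis TL_E)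
  obtain k where k: "tl_matching n k" "color_rel n k = color_rel n f O color_rel n g"
    using tl_product[OF f(1) g(1)] by blast
  have "diagram_mult n x y = diagram_of n k"
    using TL_rel_mult[OF assms] k f g
    by (intro diagram_rel_inj[OF partition_on_diagram_mult partition_on_diagram_of]) (simp_all add: diagram_rel_of)
  then show ?thesis using diagram_of_in_TL[OF k(1)] by simp
qed

lemma TL_star: "x \<in> TL n \<Longrightarrow> diagram_star x \<in> TL n"
  and TL_rel_star: "x \<in> TL n \<Longrightarrow> diagram_rel (diagram_star x) = (diagram_rel x)\<inverse>"
proof -
  assume "x \<in> TL n"
  then obtain f where f: "tl_matching n f" "x = diagram_of n f" by (rule TL_E)
  have star: "diagram_star x = diagram_of n (mirror n f)" unfolding f(2) by (rule diagram_star_of[OF f(1)])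
  show "diagram_star x \<in> TL n" unfolding star by (rule diagram_of_in_TL[OF tl_matching_mirror[OF f(1)]])
  show "diagram_rel (diagram_star x) = (diagram_rel x)\<inverse>"
    unfolding star unfolding f(2) diagram_rel_of by (rule color_rel_mirror[OF f(1)])
qed

lemma TL_assoc:
  assumes "x \<in> TL n" "y \<in> TL n" "z \<in> TL n"
  shows "diagram_mult n (diagram_mult n x y) z = diagram_mult n x (diagram_mult n y z)"
  by (rule TL_rel_inj[of _ n]) (use assms in \<open>simp_all add: TL_closed TL_rel_mult O_assoc\<close>)

lemma TL_regular:
  assumes "x \<in> TL n"
  shows "diagram_mult n (diagram_mult n x (diagram_star x)) x = x"
proof (rule TL_rel_inj[of _ n])
  obtain f where f: "tl_matching n f" "x = diagram_of n f" using assms by (rule TL_E)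
  have "color_rel n f O (color_rel n f)\<inverse> O color_rel n f = color_rel n f"
  proof (intro equalityI subrelI)
    fix a d assume "(a, d) \<in> color_rel n f O (color_rel n f)\<inverse> O color_rel n f"
    then obtain b c where "(a, b) \<in> color_rel n f" "(c, b) \<in> color_rel n f" "(c, d) \<in> color_rel n f" by blast
    then show "(a, d) \<in> color_rel n f" by (rule color_rel_difunctional)
  qed blast
  then show "diagram_rel (diagram_mult n (diagram_mult n x (diagram_star x)) x) = diagram_rel x"
    using assms f(2) by (simp add: TL_rel_mult TL_closed TL_star TL_rel_star O_assoc diagram_rel_of)
qed (use assms in \<open>simp_all add: TL_closed TL_star\<close>)

lemma diagram_of_cong:
  assumes "tl_matching n f" "\<And>x. x \<in> {1..2*n} \<Longrightarrow> f x = g x"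
  shows "diagram_of n f = diagram_of n g"
  unfolding diagram_of_def using assms by (intro image_cong) simp_all

lemma TL_rel_up:
  assumes "tl_matching n f"
  shows "diagram_rel (diagram_mult n (diagram_of n f) (diagram_star (diagram_of n f))) = half_rel n (upper n f)"
  using assms diagram_of_in_TL[OF assms]
  by (simp add: TL_rel_mult TL_star TL_rel_star diagram_rel_of color_rel_converse_comp)

lemma TL_rel_lo:
  assumes "tl_matching n f"
  shows "diagram_rel (diagram_mult n (diagram_star (diagram_of n f)) (diagram_of n f)) = half_rel n (upper n (mirror n f))"
proof -
  have "diagram_rel (diagram_mult n (diagram_star (diagram_of n f)) (diagram_of n f)) = (color_rel n f)\<inverse> O color_rel n f"
    using diagram_of_in_TL[OF assms] by (simp add: TL_rel_mult TL_star TL_rel_star diagram_rel_of)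
  also have "\<dots> = color_rel n (mirror n f) O (color_rel n (mirror n f))\<inverse>"
    unfolding color_rel_mirror[OF assms] converse_converse ..
  also have "\<dots> = half_rel n (upper n (mirror n f))"
    by (rule color_rel_converse_comp[OF tl_matching_mirror[OF assms]])
  finally show ?thesis .
qed

text \<open>On the diagonal, \<open>half_rel\<close> shows the colourings constant on arcs, and
  indicators of arcs recover the arcs.\<close>

lemma half_rel_inj:
  assumes h: "half_diagram n h" and k: "half_diagram n k" and eq: "half_rel n h = half_rel n k" and x: "x \<in> {1..n}"
  shows "h x = k x"
proof -
  have refl: "(c, c) \<in> half_rel n h \<longleftrightarrow> coloring {1..n} h c" for c h by (auto simp: half_rel_def)
  have *: "k x = x \<or> k x = h x" if h: "half_diagram n h" and eq: "half_rel n h = half_rel n k" for h k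
  proof -
    let ?c = "\<lambda>z. z = x \<or> z = h x"
    have "?c (h z) = ?c z" if "z \<in> {1..n}" for z
      using half_diagramD(2)[OF h that] half_diagramD(2)[OF h x] by metis
    then have "coloring {1..n} h ?c" by (simp add: coloring_def)
    then have "coloring {1..n} k ?c" using refl eq by blast
    then have "?c (k x) = ?c x" using x unfolding coloring_def by (rule bspec)
    then show ?thesis by simp
  qed
  show ?thesis using *[OF h eq] *[OF k eq[symmetric]] by metis
qed

text \<open>\<open>k\<close> arises from \<open>h\<close> by closing free ends. The upper half of a
  product extends that of its left factor, which controls ranks.\<close>

definition extends :: "nat \<Rightarrow> (nat \<Rightarrow> nat) \<Rightarrow> (nat \<Rightarrow> nat) \<Rightarrow> bool" where
  "extends n h k \<longleftrightarrow> (\<forall>x\<in>{1..n}. h x \<noteq> x \<longrightarrow> k x = h x)"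

lemma finite_defects: "finite (defects n h)" by (simp add: defects_def)

lemma extends_defects: "extends n h k \<Longrightarrow> defects n k \<subseteq> defects n h"
  by (auto simp: extends_def defects_def)

lemma extends_eq:
  assumes "extends n h k" "card (defects n k) = card (defects n h)" "x \<in> {1..n}"
  shows "h x = k x"
proof -
  have "defects n k = defects n h"
    by (rule card_subset_eq[OF finite_defects extends_defects[OF assms(1)] assms(2)])
  then have "h x = x \<longleftrightarrow> k x = x" using assms(3) unfolding defects_def by blast
  then show ?thesis using assms(1,3) by (cases "h x = x") (simp_all add: extends_def)
qed

lemma extends_maps_defects:
  assumes h: "half_diagram n h" and k: "half_diagram n k" and ext: "extends n h k" and x: "x \<in> defects n h"
  shows "k x \<in> defects n h"
proof -
  have x': "x \<in> {1..n}" "h x = x" using x by (auto simp: defects_def)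
  note K = half_diagramD(1,2)[OF k x'(1)]
  have "h (k x) = k x"
  proof (rule ccontr)
    assume ne: "h (k x) \<noteq> k x"
    then have "k (k x) = h (k x)" using ext K(1) by (simp add: extends_def)
    then have "x = h (k x)" using K(2) by simp
    then have "h x = k x" using half_diagramD(2)[OF h K(1)] by simp
    then show False using ne x'(2) by simp
  qed
  then show ?thesis using K(1) by (simp add: defects_def)
qed

text \<open>For projections: the one with more free ends acts as a left identity on the one that
  extends it.\<close>

lemma extends_half_rel:
  assumes h: "half_diagram n h" and k: "half_diagram n k" and ext: "extends n h k"
  shows "half_rel n h O half_rel n k = half_rel n k"
proof (intro equalityI subrelI)
  fix a c assume "(a, c) \<in> half_rel n h O half_rel n k"
  then obtain b where ab: "coloring {1..n} h a" "\<And>x. x \<in> defects n h \<Longrightarrow> a x = b x"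
    and bc: "coloring {1..n} k b" "coloring {1..n} k c" "\<And>x. x \<in> defects n k \<Longrightarrow> b x = c x"
    by (auto simp: half_rel_def)
  have "a (k x) = a x" if x: "x \<in> {1..n}" for x
  proof (cases "h x = x")
    case True
    then have xd: "x \<in> defects n h" using x by (simp add: defects_def)
    then show ?thesis using ab(2)[OF xd] ab(2)[OF extends_maps_defects[OF h k ext xd]] bc(1) x
      by (simp add: coloring_def)
  next
    case False
    then show ?thesis using ext ab(1) x by (simp add: extends_def coloring_def)
  qed
  then have "coloring {1..n} k a" by (simp add: coloring_def)
  moreover have "a x = c x" if "x \<in> defects n k" for x
    using ab(2) bc(3) extends_defects[OF ext] that by auto
  ultimately show "(a, c) \<in> half_rel n k" using bc(2) by (simp add: half_rel_def)
next
  fix a c assume ac: "(a, c) \<in> half_rel n k"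
  have "a (h x) = a x" if x: "x \<in> {1..n}" for x
  proof (cases "h x = x")
    case False
    then have "k x = h x" using ext x by (simp add: extends_def)
    moreover have "a (k x) = a x" using ac x unfolding half_rel_def coloring_def by blast
    ultimately show ?thesis by simp
  qed simp
  then have "(a, a) \<in> half_rel n h" by (simp add: half_rel_def coloring_def)
  then show "(a, c) \<in> half_rel n h O half_rel n k" using ac by blast
qed

lemma TL_mult_extends:
  assumes f: "tl_matching n f" and k: "tl_matching n k" and y: "y \<in> TL n"
    and eq: "diagram_of n k = diagram_mult n (diagram_of n f) y"
  shows "extends n (upper n f) (upper n k)"
proof -
  obtain g where g: "tl_matching n g" "y = diagram_of n g" using y by (rule TL_E)
  have rel: "color_rel n k = color_rel n f O color_rel n g"
    using TL_rel_mult[OF diagram_of_in_TL[OF f] y] eq g by (metis diagram_rel_of)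
  show ?thesis
    unfolding extends_def
  proof (intro ballI impI)
    fix x assume x: "x \<in> {1..n}" "upper n f x \<noteq> x"
    then have "f x \<le> n" by (auto simp: upper_def split: if_splits)
    then show "upper n k x = upper n f x" using upper_comp[OF f k rel x(1)] by (simp add: upper_def)
  qed
qed

lemma TL_projections_iff:
  "TL_projections n = {p \<in> TL n. diagram_mult n p p = p \<and> diagram_star p = p}"
  by (simp add: TL_projections_def TL_mult)

lemma projection_rel:
  assumes "diagram_of n f \<in> TL_projections n" "tl_matching n f"
  shows "diagram_rel (diagram_of n f) = half_rel n (upper n f)"
  using TL_rel_up[OF assms(2)] assms(1) by (simp add: TL_projections_iff)

text \<open>The projection is the product of a diagram with both halves \<open>h\<close> and its
  star.\<close>

lemma half_projection:
  assumes h: "half_diagram n h"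
  shows "\<exists>p\<in>TL_projections n. diagram_rel p = half_rel n h \<and> diagram_rank p = card (defects n h)"
proof -
  obtain f where f: "tl_matching n f" "\<And>x. x \<in> {1..n} \<Longrightarrow> upper n f x = h x"
    using tl_matching_halves_exist[OF h h refl] by blast
  let ?x = "diagram_of n f"
  let ?p = "diagram_mult n ?x (diagram_star ?x)"
  have x: "?x \<in> TL n" using f diagram_of_in_TL by simp
  have p: "?p \<in> TL n" using x TL_closed TL_star by simp
  have rel: "diagram_rel ?p = half_rel n h" using TL_rel_up[OF f(1)] half_rel_cong[OF f(2)] by simp
  have P: "?p \<in> TL_projections n"
    unfolding TL_projections_iff
  proof (intro CollectI conjI p)
    show "diagram_mult n ?p ?p = ?p"
      by (rule TL_rel_inj[of _ n]) (use p rel in \<open>simp_all add: TL_closed TL_rel_mult half_rel_idem\<close>)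
    show "diagram_star ?p = ?p"
      by (rule TL_rel_inj[of _ n]) (use p rel in \<open>simp_all add: TL_star TL_rel_star[of _ n] half_rel_converse\<close>)
  qed
  obtain g where g: "tl_matching n g" "?p = diagram_of n g" using p by (rule TL_E)
  have "half_rel n (upper n g) = half_rel n h" using projection_rel[of n g] P g rel by simp
  then have "upper n g x = h x" if "x \<in> {1..n}" for x
    using half_rel_inj[OF half_diagram_upper_part[OF g(1)] h _ that] by simp
  then have "defects n (upper n g) = defects n h" by (auto simp: defects_def)
  then have "diagram_rank ?p = card (defects n h)" using diagram_rank_of[OF g(1)] g(2) by simp
  then show ?thesis using P rel by blast
qed

lemma TL_rank_star: "x \<in> TL n \<Longrightarrow> diagram_rank (diagram_star x) = diagram_rank x"
proof -
  assume "x \<in> TL n"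
  then obtain f where f: "tl_matching n f" "x = diagram_of n f" by (rule TL_E)
  show ?thesis
    unfolding f(2) diagram_star_of[OF f(1)] diagram_rank_of[OF f(1)] diagram_rank_of[OF tl_matching_mirror[OF f(1)]]
    by (rule card_defects_mirror[OF f(1)])
qed

lemma TL_rank_mult:
  assumes x: "x \<in> TL n" and y: "y \<in> TL n"
  shows "diagram_rank (diagram_mult n x y) \<le> diagram_rank x"
    "diagram_rank (diagram_mult n x y) = diagram_rank x \<Longrightarrow>
      diagram_mult n (diagram_mult n x y) (diagram_star (diagram_mult n x y)) = diagram_mult n x (diagram_star x)"
proof -
  obtain f where f: "tl_matching n f" "x = diagram_of n f" using x by (rule TL_E)
  obtain k where k: "tl_matching n k" "diagram_mult n x y = diagram_of n k" using TL_closed[OF x y] by (rule TL_E)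
  have ext: "extends n (upper n f) (upper n k)" using TL_mult_extends[OF f(1) k(1) y] f k by simp
  have rk: "diagram_rank x = card (defects n (upper n f))" "diagram_rank (diagram_mult n x y) = card (defects n (upper n k))"
    using f k diagram_rank_of by auto
  show "diagram_rank (diagram_mult n x y) \<le> diagram_rank x"
    unfolding rk by (rule card_mono[OF finite_defects extends_defects[OF ext]])
  assume "diagram_rank (diagram_mult n x y) = diagram_rank x"
  then have "half_rel n (upper n f) = half_rel n (upper n k)"
    using extends_eq[OF ext] by (intro half_rel_cong) (simp add: rk)
  then have "diagram_rel (diagram_mult n (diagram_mult n x y) (diagram_star (diagram_mult n x y))) = diagram_rel (diagram_mult n x (diagram_star x))"
    using TL_rel_up[OF f(1)] TL_rel_up[OF k(1)] f(2) k(2) by simp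
  then show "diagram_mult n (diagram_mult n x y) (diagram_star (diagram_mult n x y)) = diagram_mult n x (diagram_star x)"
    using x y by (intro TL_rel_inj[of _ n]) (simp_all add: TL_closed TL_star)
qed

lemma TL_rank_parity:
  assumes "x \<in> TL n"
  shows "even (n + diagram_rank x)" "diagram_rank x \<le> n"
proof -
  obtain f where f: "tl_matching n f" "x = diagram_of n f" using assms by (rule TL_E)
  show "even (n + diagram_rank x)" using even_card_paired[OF f(1)] diagram_rank_of[OF f(1)] f(2) by simp
  have "card (defects n (upper n f)) \<le> card {1..n}" by (intro card_mono) (auto simp: defects_def)
  then show "diagram_rank x \<le> n" using diagram_rank_of[OF f(1)] f(2) by simp
qed

lemma TL_halves_inj:
  assumes x: "x \<in> TL n" and y: "y \<in> TL n"
    and up: "diagram_mult n x (diagram_star x) = diagram_mult n y (diagram_star y)"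
    and lo: "diagram_mult n (diagram_star x) x = diagram_mult n (diagram_star y) y"
  shows "x = y"
proof -
  obtain f where f: "tl_matching n f" "x = diagram_of n f" using x by (rule TL_E)
  obtain g where g: "tl_matching n g" "y = diagram_of n g" using y by (rule TL_E)
  have U: "upper n f z = upper n g z" if "z \<in> {1..n}" for z
    using TL_rel_up[OF f(1)] TL_rel_up[OF g(1)] up f(2) g(2)
    by (intro half_rel_inj[OF half_diagram_upper_part[OF f(1)] half_diagram_upper_part[OF g(1)] _ that]) simp
  have L: "upper n (mirror n f) z = upper n (mirror n g) z" if "z \<in> {1..n}" for z
    using TL_rel_lo[OF f(1)] TL_rel_lo[OF g(1)] lo f(2) g(2)
    by (intro half_rel_inj[OF half_diagram_upper_part[OF tl_matching_mirror[OF f(1)]]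
          half_diagram_upper_part[OF tl_matching_mirror[OF g(1)]] _ that]) simp
  have "diagram_of n f = diagram_of n g"
    using tl_matching_eqI[OF f(1) g(1) U L] by (intro diagram_of_cong[OF f(1)])
  then show ?thesis using f(2) g(2) by simp
qed

lemma TL_connect:
  assumes p: "p \<in> TL_projections n" and q: "q \<in> TL_projections n" and r: "diagram_rank p = diagram_rank q"
  shows "\<exists>x\<in>TL n. diagram_mult n x (diagram_star x) = p \<and> diagram_mult n (diagram_star x) x = q"
proof -
  have pq: "p \<in> TL n" "q \<in> TL n" using p q by (auto simp: TL_projections_iff)
  obtain f where f: "tl_matching n f" "p = diagram_of n f" using pq(1) by (rule TL_E)
  obtain g where g: "tl_matching n g" "q = diagram_of n g" using pq(2) by (rule TL_E)
  have "card (defects n (upper n f)) = card (defects n (upper n g))"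
    using r f g diagram_rank_of by simp
  then obtain k where k: "tl_matching n k" "\<forall>x\<in>{1..n}. upper n k x = upper n f x \<and> upper n (mirror n k) x = upper n g x"
    using tl_matching_halves_exist[OF half_diagram_upper_part[OF f(1)] half_diagram_upper_part[OF g(1)]] by blast
  let ?x = "diagram_of n k"
  have x: "?x \<in> TL n" using k diagram_of_in_TL by simp
  have "half_rel n (upper n k) = half_rel n (upper n f)" "half_rel n (upper n (mirror n k)) = half_rel n (upper n g)"
    using k(2) by (auto intro!: half_rel_cong)
  then have "diagram_rel (diagram_mult n ?x (diagram_star ?x)) = diagram_rel p"
    "diagram_rel (diagram_mult n (diagram_star ?x) ?x) = diagram_rel q"
    using TL_rel_up[OF k(1)] TL_rel_lo[OF k(1)] projection_rel[of n f] projection_rel[of n g] p q f g by simp_all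
  then show ?thesis using x pq by (intro bexI[of _ ?x] conjI TL_rel_inj[of _ n]) (simp_all add: TL_closed TL_star)
qed

lemma TL_separate:
  assumes x: "x \<in> TL n" and y: "y \<in> TL n" and ne: "x \<noteq> y" and n: "n \<ge> 2"
  shows "\<exists>z\<in>TL_projections n. \<exists>s\<in>TL_projections n. diagram_rank z + diagram_rank s = 4 \<and>
    diagram_mult n (diagram_mult n z x) s \<noteq> diagram_mult n (diagram_mult n z y) s"
proof -
  obtain f where f: "tl_matching n f" "x = diagram_of n f" using x by (rule TL_E)
  obtain g where g: "tl_matching n g" "y = diagram_of n g" using y by (rule TL_E)
  obtain x0 where x0: "x0 \<in> {1..2*n}" "f x0 \<noteq> g x0" using ne f g diagram_of_cong by metis
  obtain h where h: "two_sided n h" "card (defects n h) + card (defects n (mirror n h)) = 4"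
    "half_rel n h O color_rel n f O half_rel n (mirror n h) \<noteq> half_rel n h O color_rel n g O half_rel n (mirror n h)"
    using separate_two_sided[OF f(1) g(1) x0 n] by blast
  obtain z where z: "z \<in> TL_projections n" "diagram_rel z = half_rel n h" "diagram_rank z = card (defects n h)"
    using half_projection[OF half_diagram_upper[OF h(1)]] by blast
  obtain s where s: "s \<in> TL_projections n" "diagram_rel s = half_rel n (mirror n h)" "diagram_rank s = card (defects n (mirror n h))"
    using half_projection[OF half_diagram_mirror[OF h(1)]] by blast
  have zs: "z \<in> TL n" "s \<in> TL n" using z s by (auto simp: TL_projections_iff)
  have "diagram_rel (diagram_mult n (diagram_mult n z x) s) \<noteq> diagram_rel (diagram_mult n (diagram_mult n z y) s)"
    using h(3) zs x y f(2) g(2) z(2) s(2) by (simp add: TL_rel_mult TL_closed O_assoc diagram_rel_of)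
  then show ?thesis using z s h(2) by (intro bexI[of _ z] bexI[of _ s]) auto
qed

lemma TL_separate_left:
  assumes x: "x \<in> TL n" and y: "y \<in> TL n" and r: "diagram_rank x = diagram_rank y" "diagram_rank x \<le> 4"
    and lo: "diagram_mult n (diagram_star x) x = diagram_mult n (diagram_star y) y" and ne: "x \<noteq> y" and n: "n \<ge> 3"
  shows "\<exists>z\<in>TL n. diagram_rank z = 4 - diagram_rank x \<and> diagram_mult n z x \<noteq> diagram_mult n z y"
proof -
  obtain f where f: "tl_matching n f" "x = diagram_of n f" using x by (rule TL_E)
  obtain g where g: "tl_matching n g" "y = diagram_of n g" using y by (rule TL_E)
  obtain x0 where x0: "x0 \<in> {1..2*n}" "f x0 \<noteq> g x0" using ne f g diagram_of_cong by metis
  have L: "upper n (mirror n f) z = upper n (mirror n g) z" if "z \<in> {1..n}" for z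
    using TL_rel_lo[OF f(1)] TL_rel_lo[OF g(1)] lo f(2) g(2)
    by (intro half_rel_inj[OF half_diagram_upper_part[OF tl_matching_mirror[OF f(1)]]
          half_diagram_upper_part[OF tl_matching_mirror[OF g(1)]] _ that]) simp
  have rk: "card (defects n (upper n f)) = diagram_rank x" using f diagram_rank_of by simp
  \<comment> \<open>For \<open>n = 3\<close> parity makes the rank at least 1.\<close>
  have ge: "4 \<le> n + diagram_rank x" using TL_rank_parity(1)[OF x] n by presburger
  have "\<exists>h. half_diagram n h \<and> card (defects n h) = 4 - diagram_rank x \<and>
    half_rel n h O color_rel n f O half_rel n (upper n (mirror n f)) \<noteq>
    half_rel n h O color_rel n g O half_rel n (upper n (mirror n f))"
    by (rule separate_one_sided[OF f(1) g(1) x0, unfolded rk], erule L, rule r(2), rule ge)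
  then obtain h where h: "half_diagram n h" "card (defects n h) = 4 - diagram_rank x"
    "half_rel n h O color_rel n f O half_rel n (upper n (mirror n f)) \<noteq>
     half_rel n h O color_rel n g O half_rel n (upper n (mirror n f))"
    by blast
  obtain z where z: "z \<in> TL_projections n" "diagram_rel z = half_rel n h" "diagram_rank z = card (defects n h)"
    using half_projection[OF h(1)] by blast
  have zT: "z \<in> TL n" using z by (simp add: TL_projections_iff)
  have "diagram_mult n z x \<noteq> diagram_mult n z y"
  proof
    assume "diagram_mult n z x = diagram_mult n z y"
    then have "half_rel n h O color_rel n f = half_rel n h O color_rel n g"
      using TL_rel_mult[OF zT x] TL_rel_mult[OF zT y] z(2) f(2) g(2) by (simp add: diagram_rel_of)
    then show False using h(3) unfolding O_assoc[symmetric] by simp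
  qed
  then show ?thesis using zT z h(2) by auto
qed

lemma finite_TL: "finite (TL n)"
proof (rule finite_subset)
  show "TL n \<subseteq> Pow (Pow (vertices n))" using TL_partition by (fastforce simp: partition_on_def)
qed (simp add: vertices_def)

section \<open>The projection \<open>u\<close>, its two closings, and the abstract
  properties\<close>

text \<open>The half of \<open>u\<close>. All free ends stand first, so their closings can be listed
  explicitly.\<close>

definition pair_from :: "nat \<Rightarrow> nat \<Rightarrow> nat" where
  "pair_from k x = (if x \<le> k then x else if odd (x - k) then x + 1 else x - 1)"

lemma pair_from:
  assumes "k \<le> n" "even (n - k)"
  shows "half_diagram n (pair_from k)" "defects n (pair_from k) = {1..k}"
proof -
  show "half_diagram n (pair_from k)"
    unfolding half_diagram_def
  proof (intro ballI)
    fix x assume x: "x \<in> {1..n}"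
    have no: "\<not> (x < y \<and> y < pair_from k x)" for y by (auto simp: pair_from_def)
    have "pair_from k x \<in> {1..n} \<and> pair_from k (pair_from k x) = x"
    proof (cases "x \<le> k")
      case False
      show ?thesis
      proof (cases "odd (x - k)")
        case True
        then have "x \<noteq> n" using assms by auto
        moreover have "even (x + 1 - k)" using True False by (simp add: Suc_diff_le)
        ultimately show ?thesis using True False x by (auto simp: pair_from_def)
      next
        case F: False
        then have "x - 1 > k" using False by presburger
        moreover have "odd (x - 1 - k)" using F False by simp
        ultimately show ?thesis using F False x by (auto simp: pair_from_def)
      qed
    qed (use x in \<open>simp add: pair_from_def\<close>)
    then show "pair_from k x \<in> {1..n} \<and> pair_from k (pair_from k x) = x \<and>
        (\<forall>y. x < y \<and> y < pair_from k x \<longrightarrow> x < pair_from k y \<and> pair_from k y < pair_from k x \<and> pair_from k y \<noteq> y)"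
      using no by blast
  qed
  show "defects n (pair_from k) = {1..k}"
    using assms by (auto simp: defects_def pair_from_def split: if_splits)
qed

text \<open>Apart from \<open>h1\<close> and \<open>h2\<close> only an arc from 1 to 3 is
  conceivable; it would pass over a free end at 2 or cross the arc there. The number
  \<open>4 - k\<close> is the minimal rank. For \<open>k = 4\<close>, joining 1 and 2 alone gives
  the intermediate half of rank 2 that \<open>rank2_below\<close> asks for.\<close>

lemma closings:
  assumes k: "k = 3 \<or> k = 4" "k \<le> n" "even (n - k)"
  defines "h1 \<equiv> if k = 4 then (pair_from k)(1 := 2, 2 := 1, 3 := 4, 4 := 3) else (pair_from k)(1 := 2, 2 := 1)"
    and "h2 \<equiv> if k = 4 then (pair_from k)(2 := 3, 3 := 2, 1 := 4, 4 := 1) else (pair_from k)(2 := 3, 3 := 2)"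
  shows "half_diagram n h1" "half_diagram n h2" "card (defects n h1) = 4 - k" "card (defects n h2) = 4 - k"
    "extends n (pair_from k) h1" "extends n (pair_from k) h2" "h1 2 \<noteq> h2 2"
    "\<And>h. half_diagram n h \<Longrightarrow> extends n (pair_from k) h \<Longrightarrow> card (defects n h) = 4 - k \<Longrightarrow>
      (\<forall>x\<in>{1..n}. h x = h1 x) \<or> (\<forall>x\<in>{1..n}. h x = h2 x)"
    "k = 4 \<Longrightarrow> \<exists>w. half_diagram n w \<and> card (defects n w) = 2 \<and> extends n (pair_from k) w \<and> extends n w h1"
proof -
  let ?u = "pair_from k"
  note u = pair_from[OF k(2,3)]
  have c12: "consecutive (defects n ?u) 1 2" and c23: "consecutive (defects n ?u) 2 3"
    unfolding u(2) using k(1) by (auto simp: consecutive_def)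
  note j1 = half_diagram_join[OF u(1) c12] and j2 = half_diagram_join[OF u(1) c23]
  have d1: "defects n (?u(1 := 2, 2 := 1)) = {1..k} - {1, 2}" and d2: "defects n (?u(2 := 3, 3 := 2)) = {1..k} - {2, 3}"
    using j1(2) j2(2) u(2) by simp_all
  have small: "?u x = x" if "x \<le> k" for x using that by (simp add: pair_from_def)
  have s4: "{1..4} - {1, 2} = {3, 4 :: nat}" "{1..4} - {2, 3} = {1, 4 :: nat}"
    "{1..3} - {1, 2} = {3 :: nat}" "{1..3} - {2, 3} = {1 :: nat}" by auto
  have H: "half_diagram n h1 \<and> half_diagram n h2 \<and> card (defects n h1) = 4 - k \<and> card (defects n h2) = 4 - k"
  proof (cases "k = 4")
    case True
    have "consecutive (defects n (?u(1 := 2, 2 := 1))) 3 4" "consecutive (defects n (?u(2 := 3, 3 := 2))) 1 4"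
      unfolding d1 d2 unfolding True s4 by (auto simp: consecutive_def)
    note J1 = half_diagram_join[OF j1(1) this(1)] and J2 = half_diagram_join[OF j2(1) this(2)]
    have "h1 = ?u(1 := 2, 2 := 1, 3 := 4, 4 := 3)" "h2 = ?u(2 := 3, 3 := 2, 1 := 4, 4 := 1)"
      using True by (simp_all add: h1_def h2_def)
    then show ?thesis using J1 J2 d1 d2 True s4 by simp
  next
    case False
    then have "k = 3" using k by simp
    then show ?thesis using j1(1) j2(1) d1 d2 s4 by (simp add: h1_def h2_def)
  qed
  then show "half_diagram n h1" "half_diagram n h2" "card (defects n h1) = 4 - k" "card (defects n h2) = 4 - k" by auto
  have big: "h1 x = ?u x" "h2 x = ?u x" if "k < x" for x using that k(1) by (auto simp: h1_def h2_def)
  show "extends n ?u h1" "extends n ?u h2" using small big unfolding extends_def by (metis not_le)+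
  show "h1 2 \<noteq> h2 2" by (simp add: h1_def h2_def)
  show "(\<forall>x\<in>{1..n}. h x = h1 x) \<or> (\<forall>x\<in>{1..n}. h x = h2 x)"
    if h: "half_diagram n h" and ext: "extends n ?u h" and card: "card (defects n h) = 4 - k" for h
  proof -
    have in_k: "h x \<in> {1..k}" "h (h x) = x" if "x \<in> {1..k}" for x
      using extends_maps_defects[OF u(1) h ext, of x] half_diagramD(2)[OF h, of x] that k(2) unfolding u(2) by auto
    have hbig: "h x = ?u x" if "x \<in> {1..n}" "k < x" for x
    proof -
      have "?u x \<noteq> x" using that by (auto simp: pair_from_def)
      then show ?thesis using ext that(1) by (simp add: extends_def)
    qed
    \<comment> \<open>An arc from 1 passing over 2 needs 2 to be joined underneath, which excludes
      \<open>h 1 = 3\<close>.\<close>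
    have cover: "1 < h 2 \<and> h 2 < h 1 \<and> h 2 \<noteq> 2" if "2 < h 1"
      using half_diagramD(3-5)[OF h, of 1 2] that k(1,2) by auto
    have "(\<forall>x\<in>{1..k}. h x = h1 x) \<or> (\<forall>x\<in>{1..k}. h x = h2 x)"
      using k(1)
    proof
      assume k4: "k = 4"
      have nd: "h x \<noteq> x" if "x \<in> {1..4}" for x
      proof -
        have "defects n h = {}" using card k4 finite_defects[of n h] by simp
        then show ?thesis using that k(2) k4 unfolding defects_def by auto
      qed
      have set: "{1..4} = {1, 2, 3, 4 :: nat}" by auto
      note I = in_k[unfolded k4]
      have h1v: "h 1 \<in> {2, 3, 4}" using I(1)[of 1] nd[of 1] unfolding set by auto
      moreover have "h 1 \<noteq> 3" using cover by auto
      ultimately consider "h 1 = 2" | "h 1 = 4" by auto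
      then show ?thesis
      proof cases
        case 1
        then have "h 2 = 1" using I(2)[of 1] by auto
        have "h 3 \<in> {1, 2, 3, 4}" "h 3 \<noteq> 3" "h (h 3) = 3" using I[of 3] nd[of 3] unfolding set by auto
        then have "h 3 = 4" using 1 \<open>h 2 = 1\<close> by auto
        then have "h 4 = 3" using I(2)[of 3] by auto
        then show ?thesis using 1 \<open>h 2 = 1\<close> \<open>h 3 = 4\<close> unfolding k4 set h1_def by simp
      next
        case 2
        then have "h 4 = 1" using I(2)[of 1] by auto
        have "h 2 = 3" using cover 2 by auto
        then have "h 3 = 2" using I(2)[of 2] by auto
        then show ?thesis using 2 \<open>h 4 = 1\<close> \<open>h 2 = 3\<close> unfolding k4 set h2_def by simp
      qed
    next
      assume k3: "k = 3"
      have set: "{1..3} = {1, 2, 3 :: nat}" by auto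
      note I = in_k[unfolded k3]
      have "h 1 \<in> {1, 2, 3}" using I(1)[of 1] unfolding set by auto
      moreover have "h 1 \<noteq> 3" using cover by auto
      ultimately consider "h 1 = 1" | "h 1 = 2" by auto
      then show ?thesis
      proof cases
        case 1
        have "h 2 \<noteq> 2"
        proof
          assume "h 2 = 2"
          then have "{1, 2} \<subseteq> defects n h" using 1 k(2) k3 by (auto simp: defects_def)
          then have "card {1, 2 :: nat} \<le> card (defects n h)" by (intro card_mono finite_defects)
          then show False using card k3 by simp
        qed
        moreover have "h 2 \<in> {1, 2, 3}" "h (h 2) = 2" using I[of 2] unfolding set by auto
        ultimately have "h 2 = 3" using 1 by auto
        then have "h 3 = 2" using I(2)[of 2] by auto
        then show ?thesis using 1 \<open>h 2 = 3\<close> unfolding k3 set h2_def by (simp add: pair_from_def)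
      next
        case 2
        then have "h 2 = 1" using I(2)[of 1] by auto
        have "h 3 \<in> {1, 2, 3}" "h (h 3) = 3" using I[of 3] unfolding set by auto
        then have "h 3 = 3" using 2 \<open>h 2 = 1\<close> by auto
        then show ?thesis using 2 \<open>h 2 = 1\<close> unfolding k3 set h1_def by (simp add: pair_from_def)
      qed
    qed
    then show ?thesis using hbig big by (metis atLeastAtMost_iff not_le)
  qed
  show "\<exists>w. half_diagram n w \<and> card (defects n w) = 2 \<and> extends n ?u w \<and> extends n w h1" if k4: "k = 4"
  proof (intro exI[of _ "?u(1 := 2, 2 := 1)"] conjI)
    show "half_diagram n (?u(1 := 2, 2 := 1))" by (rule j1(1))
    show "card (defects n (?u(1 := 2, 2 := 1))) = 2" unfolding d1 unfolding k4 s4 by simp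
    show "extends n ?u (?u(1 := 2, 2 := 1))" using small k4 by (simp add: extends_def)
    show "extends n (?u(1 := 2, 2 := 1)) h1" using small k4 unfolding h1_def by (auto simp: extends_def)
  qed
qed

text \<open>If both free ends must be closed, they can only be joined to each other.\<close>

lemma closing_unique:
  assumes h: "half_diagram n h" "card (defects n h) = 2"
    and k: "half_diagram n k" "extends n h k" "defects n k = {}"
    and l: "half_diagram n l" "extends n h l" "defects n l = {}" and x: "x \<in> {1..n}"
  shows "k x = l x"
proof (cases "h x = x")
  case True
  then have xd: "x \<in> defects n h" using x by (simp add: defects_def)
  have "k x \<in> defects n h" "l x \<in> defects n h" "k x \<noteq> x" "l x \<noteq> x"
    using extends_maps_defects[OF h(1) k(1,2) xd] extends_maps_defects[OF h(1) l(1,2) xd] k(3) l(3) x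
    unfolding defects_def by auto
  then show ?thesis using h(2) xd unfolding card_2_iff by auto
next
  case False
  then show ?thesis using k(2) l(2) x by (simp add: extends_def)
qed

theorem tl_like_TL:
  assumes n: "n \<ge> 3"
  shows "\<exists>u f1 f2. tl_like (TL n) (diagram_mult n) diagram_star diagram_rank (TL_projections n)
    (n mod 2) (4 - n mod 2) u f1 f2"
proof -
  let ?m = "n mod 2" and ?k = "4 - n mod 2"
  have k: "?k = 3 \<or> ?k = 4" by linarith
  \<comment> \<open>\<open>?k\<close> is at most 4, and it is 3 when \<open>n = 3\<close>.\<close>
  have kn: "?k \<le> n"
  proof (cases "n = 3")
    case False
    then show ?thesis using n by auto
  qed simp
  have ev: "even (n - ?k)"
    using kn by presburger
  note u = pair_from[OF kn ev]
  define h1 where "h1 = (if ?k = 4 then (pair_from ?k)(1 := 2, 2 := 1, 3 := 4, 4 := 3) else (pair_from ?k)(1 := 2, 2 := 1))"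
  define h2 where "h2 = (if ?k = 4 then (pair_from ?k)(2 := 3, 3 := 2, 1 := 4, 4 := 1) else (pair_from ?k)(2 := 3, 3 := 2))"
  note h = closings(1-7)[OF k kn ev, folded h1_def h2_def]
    and cl = closings(8)[OF k kn ev, folded h1_def h2_def]
    and wex = closings(9)[OF k kn ev, folded h1_def h2_def]
  have m: "4 - ?k = ?m" by linarith
  obtain u where uP: "u \<in> TL_projections n" "diagram_rel u = half_rel n (pair_from ?k)" "diagram_rank u = ?k"
    using half_projection[OF u(1)] u(2) by auto
  obtain f1 where f1: "f1 \<in> TL_projections n" "diagram_rel f1 = half_rel n h1" "diagram_rank f1 = ?m"
    using half_projection[OF h(1)] h(3) m by auto
  obtain f2 where f2: "f2 \<in> TL_projections n" "diagram_rel f2 = half_rel n h2" "diagram_rank f2 = ?m"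
    using half_projection[OF h(2)] h(4) m by auto
  have PT: "p \<in> TL n" if "p \<in> TL_projections n" for p using that by (simp add: TL_projections_iff)
  have absorb: "diagram_mult n p q = q"
    if "p \<in> TL_projections n" "q \<in> TL_projections n" "diagram_rel p = half_rel n g" "diagram_rel q = half_rel n h"
      "half_diagram n g" "half_diagram n h" "extends n g h" for p q g h
    by (rule TL_rel_inj[of _ n]) (use that PT extends_half_rel in \<open>simp_all add: TL_closed TL_rel_mult\<close>)
  have parity: "diagram_rank x mod 2 = ?m" if "x \<in> TL n" for x using TL_rank_parity(1)[OF that] by presburger
  have f12: "f1 \<noteq> f2"
  proof
    assume "f1 = f2"
    then have "half_rel n h1 = half_rel n h2" using f1 f2 by simp
    then show False using half_rel_inj[OF h(1,2), of 2] h(7) n by simp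
  qed
  have L1: "diagram_star (diagram_star x) = x" if "x \<in> TL n" for x
    by (rule TL_rel_inj[of _ n]) (use that in \<open>simp_all add: TL_star TL_rel_star[of _ n]\<close>)
  have L2: "diagram_star (diagram_mult n x y) = diagram_mult n (diagram_star y) (diagram_star x)"
    if "x \<in> TL n" "y \<in> TL n" for x y
    by (rule TL_rel_inj[of _ n]) (use that in \<open>simp_all add: TL_star TL_rel_star[of _ n] TL_closed TL_rel_mult converse_relcomp\<close>)
  have L3: "?m \<le> diagram_rank x" if "x \<in> TL n" for x using parity[OF that] by (metis mod_less_eq_dividend)
  have L4: "diagram_rank x \<in> {?m, 2, ?k}" if "x \<in> TL n" "diagram_rank x \<le> 4" for x
  proof -
    have "diagram_rank x = 0 \<or> diagram_rank x = 1 \<or> diagram_rank x = 2 \<or> diagram_rank x = 3 \<or> diagram_rank x = 4"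
      using that(2) by linarith
    then show ?thesis using parity[OF that(1)] by auto
  qed
  have L5: "diagram_mult n u f1 = f1" by (rule absorb[OF uP(1) f1(1) uP(2) f1(2) u(1) h(1,5)])
  have L6: "diagram_mult n u f2 = f2" by (rule absorb[OF uP(1) f2(1) uP(2) f2(2) u(1) h(2,6)])
  have L7: "diagram_mult n x (diagram_star x) = f1 \<or> diagram_mult n x (diagram_star x) = f2"
    if x: "x \<in> TL n" "diagram_rank x = ?m" "diagram_mult n u x = x" for x
  proof -
    obtain f where f: "tl_matching n f" "x = diagram_of n f" using x(1) by (rule TL_E)
    obtain g where g: "tl_matching n g" "u = diagram_of n g" using PT[OF uP(1)] by (rule TL_E)
    have "extends n (upper n g) (upper n f)" using TL_mult_extends[OF g(1) f(1) x(1)] x(3) f(2) g(2) by simp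
    moreover have "upper n g z = pair_from ?k z" if "z \<in> {1..n}" for z
      using projection_rel[of n g] uP g
      by (intro half_rel_inj[OF half_diagram_upper_part[OF g(1)] u(1) _ that]) simp
    ultimately have "extends n (pair_from ?k) (upper n f)" by (simp add: extends_def)
    moreover have "card (defects n (upper n f)) = 4 - ?k" using x(2) f diagram_rank_of m by simp
    ultimately have dis: "half_rel n (upper n f) = half_rel n h1 \<or> half_rel n (upper n f) = half_rel n h2"
      using cl[OF half_diagram_upper_part[OF f(1)]] half_rel_cong by metis
    have rel: "diagram_rel (diagram_mult n x (diagram_star x)) = half_rel n (upper n f)"
      using TL_rel_up[OF f(1)] f(2) by simp
    have mem: "diagram_mult n x (diagram_star x) \<in> TL n" using x(1) by (simp add: TL_closed TL_star)
    show ?thesis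
      using dis TL_rel_inj[OF mem PT[OF f1(1)]] TL_rel_inj[OF mem PT[OF f2(1)]] unfolding rel f1(2) f2(2) by blast
  qed
  \<comment> \<open>Rank 2 forces \<open>n\<close> to be even, so minimal rank is 0 and no free end
    remains after closing.\<close>
  have L8: "diagram_mult n (diagram_mult n x y) (diagram_star (diagram_mult n x y)) =
      diagram_mult n (diagram_mult n x z) (diagram_star (diagram_mult n x z))"
    if x: "x \<in> TL n" "y \<in> TL n" "z \<in> TL n" "diagram_rank x = 2" "diagram_rank (diagram_mult n x y) = ?m"
      "diagram_rank (diagram_mult n x z) = ?m" for x y z
  proof -
    have m0: "?m = 0" using parity[OF x(1)] x(4) by simp
    obtain f where f: "tl_matching n f" "x = diagram_of n f" using x(1) by (rule TL_E)
    obtain g where g: "tl_matching n g" "diagram_mult n x y = diagram_of n g" using TL_closed[OF x(1,2)] by (rule TL_E)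
    obtain l where l: "tl_matching n l" "diagram_mult n x z = diagram_of n l" using TL_closed[OF x(1,3)] by (rule TL_E)
    have c: "card (defects n (upper n f)) = 2" "card (defects n (upper n g)) = 0" "card (defects n (upper n l)) = 0"
      using diagram_rank_of f g l x m0 by auto
    have e: "defects n (upper n g) = {}" "defects n (upper n l) = {}" using c finite_defects by auto
    have "upper n g v = upper n l v" if "v \<in> {1..n}" for v
      by (rule closing_unique[OF half_diagram_upper_part[OF f(1)] c(1) half_diagram_upper_part[OF g(1)] _ e(1)
          half_diagram_upper_part[OF l(1)] _ e(2) that])
        (use TL_mult_extends[OF f(1) g(1) x(2)] TL_mult_extends[OF f(1) l(1) x(3)] f g l in simp_all)
    then have "half_rel n (upper n g) = half_rel n (upper n l)" by (rule half_rel_cong)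
    then show ?thesis
      using TL_rel_up[OF g(1)] TL_rel_up[OF l(1)] g(2) l(2) x diagram_of_in_TL[OF g(1)] diagram_of_in_TL[OF l(1)]
      by (intro TL_rel_inj[of _ n]) (simp_all add: TL_closed TL_star)
  qed
  have L9: "\<exists>w\<in>TL_projections n. diagram_rank w = 2 \<and> diagram_mult n u w = w \<and> diagram_mult n w f1 = f1"
    if x: "x \<in> TL n" "diagram_rank x = 2" for x
  proof -
    have "?k = 4" using parity[OF x(1)] x(2) by simp
    then obtain w where w: "half_diagram n w" "card (defects n w) = 2" "extends n (pair_from ?k) w" "extends n w h1"
      using wex by blast
    obtain p where p: "p \<in> TL_projections n" "diagram_rel p = half_rel n w" "diagram_rank p = 2"
      using half_projection[OF w(1)] w(2) by auto
    show ?thesis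
      using p absorb[OF uP(1) p(1) uP(2) p(2) u(1) w(1,3)] absorb[OF p(1) f1(1) p(2) f1(2) w(1) h(1) w(4)]
      by (intro bexI[of _ p] conjI)
  qed
  show ?thesis
    by (intro exI[of _ u] exI[of _ f1] exI[of _ f2], unfold_locales)
      (fact finite_TL TL_closed TL_assoc TL_star TL_regular TL_rank_star TL_rank_mult TL_halves_inj
        TL_projections_iff TL_connect uP f1 f2 f12 L1 L2 L3 L4 L5 L6 L7 L8 L9 refl |
       rule TL_separate_left[OF _ _ _ _ _ _ n], assumption+ | rule TL_separate, assumption+, use n in linarith | simp)+
qed

section \<open>Transformation degrees\<close>

lemma monD:
  assumes "h \<in> mon G H"
  shows "\<And>x. x \<in> carrier G \<Longrightarrow> h x \<in> carrier H"
    "\<And>x y. x \<in> carrier G \<Longrightarrow> y \<in> carrier G \<Longrightarrow> h (x \<otimes>\<^bsub>G\<^esub> y) = h x \<otimes>\<^bsub>H\<^esub> h y"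
    "inj_on h (carrier G)"
  using assms by (auto simp: mon_def hom_def)

lemma monI:
  assumes "\<And>x. x \<in> carrier G \<Longrightarrow> h x \<in> carrier H"
    "\<And>x y. x \<in> carrier G \<Longrightarrow> y \<in> carrier G \<Longrightarrow> h (x \<otimes>\<^bsub>G\<^esub> y) = h x \<otimes>\<^bsub>H\<^esub> h y"
    "\<And>x y. x \<in> carrier G \<Longrightarrow> y \<in> carrier G \<Longrightarrow> h x = h y \<Longrightarrow> x = y"
  shows "h \<in> mon G H"
  using assms by (auto simp: mon_def hom_def inj_on_def)

lemma full_transformation_action:
  assumes "h \<in> mon S (full_transformation_monoid m)"
  shows "faithful_action (carrier S) (mult S) {1..m} (\<lambda>y x. h x y)"
proof -
  note H = monD[OF assms, unfolded full_transformation_monoid_def, simplified]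
  have ext: "h x \<in> {1..m} \<rightarrow>\<^sub>E {1..m}" if "x \<in> carrier S" for x using H(1)[OF that] by simp
  show ?thesis
    unfolding faithful_action_def
  proof (intro conjI ballI impI)
    fix y x assume yx: "y \<in> {1..m}" "x \<in> carrier S"
    show "h x y \<in> {1..m}" using ext[OF yx(2)] yx(1) by (rule PiE_mem)
    fix x' assume "x' \<in> carrier S"
    then show "h x' (h x y) = h (x \<otimes>\<^bsub>S\<^esub> x') y" using H(2)[OF yx(2)] yx(1) by (simp add: compose_def)
  next
    fix x x' assume x: "x \<in> carrier S" "x' \<in> carrier S" "x \<noteq> x'"
    then have "h x \<noteq> h x'" using H(3) by (auto dest: inj_onD)
    then show "\<exists>y\<in>{1..m}. h x y \<noteq> h x' y" using PiE_ext[OF ext[OF x(1)] ext[OF x(2)]] by blast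
  qed
qed

lemma partial_transformation_action:
  assumes "h \<in> mon S (partial_transformation_monoid m)"
  shows "faithful_action (carrier S) (mult S) (insert None (Some ` {1..m})) (\<lambda>y x. Option.bind y (h x))"
proof -
  note H = monD[OF assms, unfolded partial_transformation_monoid_def, simplified]
  have dr: "dom (h x) \<subseteq> {1..m}" "ran (h x) \<subseteq> {1..m}" if "x \<in> carrier S" for x using H(1)[OF that] by auto
  show ?thesis
    unfolding faithful_action_def
  proof (intro conjI ballI impI)
    fix y x assume yx: "y \<in> insert None (Some ` {1..m})" "x \<in> carrier S"
    have "h x i \<in> insert None (Some ` {1..m})" for i
      using dr(2)[OF yx(2)] by (cases "h x i") (auto simp: ran_def)
    then show "Option.bind y (h x) \<in> insert None (Some ` {1..m})" by (cases y) auto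
    fix x' assume "x' \<in> carrier S"
    then show "Option.bind (Option.bind y (h x)) (h x') = Option.bind y (h (x \<otimes>\<^bsub>S\<^esub> x'))"
      using H(2)[OF yx(2)] by (cases y) (auto simp: map_comp_def split: option.split)
  next
    fix x x' assume x: "x \<in> carrier S" "x' \<in> carrier S" "x \<noteq> x'"
    then have "h x \<noteq> h x'" using H(3) by (auto dest: inj_onD)
    then obtain i where i: "h x i \<noteq> h x' i" by blast
    then have "i \<in> dom (h x) \<union> dom (h x')" by auto
    then have "i \<in> {1..m}" using dr(1)[OF x(1)] dr(1)[OF x(2)] by blast
    then show "\<exists>y\<in>insert None (Some ` {1..m}). Option.bind y (h x) \<noteq> Option.bind y (h x')"
      using i by (intro bexI[of _ "Some i"]) auto
  qed
qed

section \<open>From actions back to embeddings\<close>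

lemma action_full_transformation:
  assumes act: "faithful_action (carrier S) (mult S) Y act" and fin: "finite Y"
    and closed: "\<And>x y. x \<in> carrier S \<Longrightarrow> y \<in> carrier S \<Longrightarrow> x \<otimes>\<^bsub>S\<^esub> y \<in> carrier S"
  shows "mon S (full_transformation_monoid (card Y)) \<noteq> {}"
proof -
  have A: "\<And>y x. y \<in> Y \<Longrightarrow> x \<in> carrier S \<Longrightarrow> act y x \<in> Y"
    "\<And>y x x'. y \<in> Y \<Longrightarrow> x \<in> carrier S \<Longrightarrow> x' \<in> carrier S \<Longrightarrow> act (act y x) x' = act y (x \<otimes>\<^bsub>S\<^esub> x')"
    "\<And>x x'. x \<in> carrier S \<Longrightarrow> x' \<in> carrier S \<Longrightarrow> x \<noteq> x' \<Longrightarrow> \<exists>y\<in>Y. act y x \<noteq> act y x'"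
    using act unfolding faithful_action_def by simp_all
  obtain b where b: "bij_betw b {1..card Y} Y" using ex_bij_betw_nat_finite_1[OF fin] by blast
  define c where "c = inv_into {1..card Y} b"
  have bY: "b i \<in> Y" "c (b i) = i" if "i \<in> {1..card Y}" for i
    using b that unfolding c_def by (auto simp: bij_betw_def inv_into_f_f)
  have cY: "c y \<in> {1..card Y}" "b (c y) = y" if "y \<in> Y" for y
    using b that bij_betwE[OF bij_betw_inv_into[OF b]] bij_betw_inv_into_right[OF b] unfolding c_def by auto
  let ?h = "\<lambda>x. \<lambda>i\<in>{1..card Y}. c (act (b i) x)"
  have "?h \<in> mon S (full_transformation_monoid (card Y))"
  proof (rule monI)
    fix x assume x: "x \<in> carrier S"
    then show "?h x \<in> carrier (full_transformation_monoid (card Y))"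
      using A(1) bY cY by (simp add: full_transformation_monoid_def)
    fix y assume y: "y \<in> carrier S"
    have "?h (x \<otimes>\<^bsub>S\<^esub> y) i = compose {1..card Y} (?h y) (?h x) i" for i
    proof (cases "i \<in> {1..card Y}")
      case True
      have "act (b i) x \<in> Y" using A(1)[OF bY(1)[OF True] x] .
      then show ?thesis using cY[of "act (b i) x"] A(2)[OF bY(1)[OF True] x y] True by (simp add: compose_def)
    next
      case False
      then show ?thesis by (simp only: compose_def restrict_def if_False)
    qed
    then show "?h (x \<otimes>\<^bsub>S\<^esub> y) = ?h x \<otimes>\<^bsub>full_transformation_monoid (card Y)\<^esub> ?h y"
      by (simp add: full_transformation_monoid_def fun_eq_iff)
  next
    fix x x' assume x: "x \<in> carrier S" "x' \<in> carrier S" "?h x = ?h x'"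
    show "x = x'"
    proof (rule ccontr)
      assume "x \<noteq> x'"
      then obtain y where y: "y \<in> Y" "act y x \<noteq> act y x'" using A(3) x by blast
      have "?h x (c y) = ?h x' (c y)" using x(3) by (rule fun_cong)
      then have "c (act y x) = c (act y x')" using cY[OF y(1)] by simp
      then have "b (c (act y x)) = b (c (act y x'))" by simp
      then show False using cY(2) A(1) x y by simp
    qed
  qed
  then show ?thesis by blast
qed

text \<open>A point fixed by everything can be read as the undefined value: once a point is sent to
  \<open>z\<close> it stays there, just as an undefined value stays undefined.\<close>

lemma action_partial_transformation:
  assumes act: "faithful_action (carrier S) (mult S) Y act" and fin: "finite Y"
    and z: "z \<in> Y" "\<And>x. x \<in> carrier S \<Longrightarrow> act z x = z"
  shows "mon S (partial_transformation_monoid (card Y - 1)) \<noteq> {}"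
proof -
  have A: "\<And>y x. y \<in> Y \<Longrightarrow> x \<in> carrier S \<Longrightarrow> act y x \<in> Y"
    "\<And>y x x'. y \<in> Y \<Longrightarrow> x \<in> carrier S \<Longrightarrow> x' \<in> carrier S \<Longrightarrow> act (act y x) x' = act y (x \<otimes>\<^bsub>S\<^esub> x')"
    "\<And>x x'. x \<in> carrier S \<Longrightarrow> x' \<in> carrier S \<Longrightarrow> x \<noteq> x' \<Longrightarrow> \<exists>y\<in>Y. act y x \<noteq> act y x'"
    using act unfolding faithful_action_def by simp_all
  let ?Y = "Y - {z}" and ?I = "{1..card Y - 1}"
  have "card ?Y = card Y - 1" "finite ?Y" using fin z by simp_all
  then obtain b where b: "bij_betw b ?I ?Y" using ex_bij_betw_nat_finite_1[of ?Y] by auto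
  define c where "c = inv_into ?I b"
  have bY: "b i \<in> Y" "b i \<noteq> z" if "i \<in> ?I" for i
    using bij_betwE[OF b] that by auto
  have cY: "c y \<in> ?I" "b (c y) = y" if "y \<in> Y" "y \<noteq> z" for y
    using b that bij_betwE[OF bij_betw_inv_into[OF b]] bij_betw_inv_into_right[OF b] unfolding c_def by auto
  define h where "h x i = (if i \<in> ?I \<and> act (b i) x \<noteq> z then Some (c (act (b i) x)) else None)" for x i
  have "h \<in> mon S (partial_transformation_monoid (card Y - 1))"
  proof (rule monI)
    fix x assume x: "x \<in> carrier S"
    have "j \<in> ?I" if j: "h x i = Some j" for i j
    proof -
      have i: "i \<in> ?I" "act (b i) x \<noteq> z" "j = c (act (b i) x)" using j by (auto simp: h_def split: if_splits)
      show ?thesis unfolding i(3) by (rule cY(1)[OF A(1)[OF bY(1)[OF i(1)] x] i(2)])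
    qed
    then have "ran (h x) \<subseteq> ?I" unfolding ran_def by blast
    moreover have "dom (h x) \<subseteq> ?I" unfolding dom_def h_def by (auto split: if_splits)
    ultimately show "h x \<in> carrier (partial_transformation_monoid (card Y - 1))"
      by (simp add: partial_transformation_monoid_def)
    fix y assume y: "y \<in> carrier S"
    have "h (x \<otimes>\<^bsub>S\<^esub> y) i = (h y \<circ>\<^sub>m h x) i" for i
    proof (cases "i \<in> ?I")
      case True
      note bi = bY(1)[OF True]
      show ?thesis
      proof (cases "act (b i) x = z")
        case z: True
        then have "act (b i) (x \<otimes>\<^bsub>S\<^esub> y) = z" using A(2)[OF bi x y] assms(4)[OF y] by simp
        then show ?thesis using z by (simp add: h_def map_comp_def)
      next
        case False
        note c = cY[OF A(1)[OF bi x] False]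
        show ?thesis using c True False A(2)[OF bi x y] by (simp add: h_def map_comp_def)
      qed
    next
      case False
      then have "h w i = None" for w unfolding h_def by (simp only: if_False simp_thms)
      then show ?thesis by (simp add: map_comp_def)
    qed
    then show "h (x \<otimes>\<^bsub>S\<^esub> y) = h x \<otimes>\<^bsub>partial_transformation_monoid (card Y - 1)\<^esub> h y"
      by (simp add: partial_transformation_monoid_def fun_eq_iff)
  next
    fix x x' assume x: "x \<in> carrier S" "x' \<in> carrier S" "h x = h x'"
    show "x = x'"
    proof (rule ccontr)
      assume "x \<noteq> x'"
      then obtain y where y: "y \<in> Y" "act y x \<noteq> act y x'" using A(3) x by blast
      then have "y \<noteq> z" using z x by auto
      note c = cY[OF y(1) this]
      have "h x (c y) = h x' (c y)" using x(3) by simp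
      then have "(if act y x \<noteq> z then Some (c (act y x)) else None) = (if act y x' \<noteq> z then Some (c (act y x')) else None)"
        unfolding h_def c(2) using c(1) by (simp only: simp_thms)
      then show False using cY(2)[OF A(1)[OF y(1) x(1)]] cY(2)[OF A(1)[OF y(1) x(2)]] y(2)
        by (auto split: if_splits)
    qed
  qed
  then show ?thesis by blast
qed

lemma right_congruence_action:
  assumes rc: "right_congruence S \<sigma>" and faith: "faithful_rc S \<sigma>"
    and closed: "\<And>x y. x \<in> carrier S \<Longrightarrow> y \<in> carrier S \<Longrightarrow> x \<otimes>\<^bsub>S\<^esub> y \<in> carrier S"
    and assoc: "\<And>x y z. x \<in> carrier S \<Longrightarrow> y \<in> carrier S \<Longrightarrow> z \<in> carrier S \<Longrightarrow> (x \<otimes>\<^bsub>S\<^esub> y) \<otimes>\<^bsub>S\<^esub> z = x \<otimes>\<^bsub>S\<^esub> (y \<otimes>\<^bsub>S\<^esub> z)"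
  shows "faithful_action (carrier S) (mult S) (carrier S // \<sigma>) (class_act (mult S) \<sigma>)"
proof (rule class_act_action)
  show "equiv (carrier S) \<sigma>" using rc by (simp add: right_congruence_def)
  show "(x \<otimes>\<^bsub>S\<^esub> s, y \<otimes>\<^bsub>S\<^esub> s) \<in> \<sigma>" if "(x, y) \<in> \<sigma>" "s \<in> carrier S" for x y s
    using rc that by (simp add: right_congruence_def)
  fix x x' assume x: "x \<in> carrier S" "x' \<in> carrier S" "x \<noteq> x'"
  then have "rc_action S \<sigma> x \<noteq> rc_action S \<sigma> x'" using faith by (auto simp: faithful_rc_def dest: inj_onD)
  then show "\<exists>X\<in>carrier S // \<sigma>. class_act (mult S) \<sigma> X x \<noteq> class_act (mult S) \<sigma> X x'"
    unfolding rc_action_def class_act_def by (metis (no_types, lifting) restrict_ext)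
qed (use closed assoc in blast)+

lemma faithful_rc_class_act:
  assumes "faithful_action (carrier S) (mult S) (carrier S // \<sigma>) (class_act (mult S) \<sigma>)"
  shows "faithful_rc S \<sigma>"
  unfolding faithful_rc_def
proof (rule inj_onI, rule ccontr)
  fix x x' assume x: "x \<in> carrier S" "x' \<in> carrier S" "rc_action S \<sigma> x = rc_action S \<sigma> x'" "x \<noteq> x'"
  then obtain X where X: "X \<in> carrier S // \<sigma>" "class_act (mult S) \<sigma> X x \<noteq> class_act (mult S) \<sigma> X x'"
    using assms unfolding faithful_action_def by blast
  have "rc_action S \<sigma> x X = rc_action S \<sigma> x' X" using x(3) by simp
  then show False using X by (simp add: rc_action_def class_act_def)
qed

theorem theorem5p1:
  fixes n :: nat
  assumes "n \<ge> 3"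
  shows "deg' (temperley_lieb n) = card (TL_Q n) \<and>
         deg (temperley_lieb n) = deg_rc (temperley_lieb n) \<and>
         deg_rc (temperley_lieb n) = 1 + card (TL_Q n)"
proof -
  let ?S = "temperley_lieb n"
  obtain u f1 f2 where L: "tl_like (TL n) (diagram_mult n) diagram_star diagram_rank (TL_projections n)
      (n mod 2) (4 - n mod 2) u f1 f2"
    using tl_like_TL[OF assms] by blast
  interpret L: tl_like "TL n" "diagram_mult n" diagram_star diagram_rank "TL_projections n"
    "n mod 2" "4 - n mod 2" u f1 f2
    by (rule L)
  have mult: "mult ?S = diagram_mult n" by (intro ext) (rule TL_mult)
  note closed = L.closed[folded TL_mult] and assoc = L.assoc[folded TL_mult]
  \<comment> \<open>\<open>L.Q\<close> always lists rank 2, \<open>TL_Q\<close> only for even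
    \<open>n\<close>; parity reconciles the two.\<close>
  have "diagram_rank p \<noteq> 2" if "odd n" "p \<in> TL_projections n" for p
    using TL_rank_parity(1)[of p n] that by (auto simp: TL_projections_iff)
  then have Q: "L.Q = TL_Q n"
    unfolding L.Q_def TL_Q_def TL_projections_rank_def
    by (cases "even n") (auto simp: even_iff_mod_2_eq_zero odd_iff_mod_2_eq_one)
  \<comment> \<open>The type of points is kept generic, since the bound is used for numbers, for
    options of numbers and for congruence classes.\<close>
  have lower: "card Y \<ge> 1 + card (TL_Q n)" if "faithful_action (TL n) (mult ?S) Y act" "finite Y"
    for Y :: "'x set" and act
    using L.action_card_ge[of Y act] that unfolding mult Q by blast
  define \<sigma> where "\<sigma> = L.hit_rel"
  have act: "faithful_action (TL n) (mult ?S) (TL n // \<sigma>) (class_act (mult ?S) \<sigma>)"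
    unfolding mult \<sigma>_def by (rule L.hit_act_faithful)
  have fin: "finite (TL n // \<sigma>)" unfolding \<sigma>_def by (rule L.finite_classes)
  have card: "card (TL n // \<sigma>) = 1 + card (TL_Q n)" unfolding \<sigma>_def using L.card_quotient Q by simp
  obtain Z where Z: "Z \<in> TL n // \<sigma>" "\<And>x. x \<in> TL n \<Longrightarrow> class_act (mult ?S) \<sigma> Z x = Z"
    using L.sink_class unfolding mult \<sigma>_def by blast
  \<comment> \<open>\<open>deg'\<close> minimises over \<open>m \<ge> 1\<close>, so the candidate
    has to be positive; \<open>u\<close> is a member.\<close>
  have Q1: "card (TL_Q n) \<ge> 1"
  proof -
    have "u \<in> L.Q" using L.u by (simp add: L.Q_def)
    then show ?thesis using L.finite_Q Q by (metis One_nat_def Suc_leI card_gt_0_iff empty_iff)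
  qed
  have "deg' ?S = card (TL_Q n)"
    unfolding deg'_def
  proof (rule Least_equality)
    show "card (TL_Q n) \<ge> 1 \<and> mon ?S (partial_transformation_monoid (card (TL_Q n))) \<noteq> {}"
      using action_partial_transformation[OF act fin Z] Q1 card by simp
  next
    fix m assume "m \<ge> 1 \<and> mon ?S (partial_transformation_monoid m) \<noteq> {}"
    then obtain h where "h \<in> mon ?S (partial_transformation_monoid m)" by blast
    from lower[OF partial_transformation_action[OF this]]
    show "card (TL_Q n) \<le> m" by (simp add: card_image)
  qed
  moreover have "deg ?S = 1 + card (TL_Q n)"
    unfolding deg_def
  proof (rule Least_equality)
    show "1 + card (TL_Q n) \<ge> 1 \<and> mon ?S (full_transformation_monoid (1 + card (TL_Q n))) \<noteq> {}"
      using action_full_transformation[OF act fin closed] card by simp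
  next
    fix m assume "m \<ge> 1 \<and> mon ?S (full_transformation_monoid m) \<noteq> {}"
    then obtain h where "h \<in> mon ?S (full_transformation_monoid m)" by blast
    from lower[OF full_transformation_action[OF this]]
    show "1 + card (TL_Q n) \<le> m" by simp
  qed
  moreover have "deg_rc ?S = 1 + card (TL_Q n)"
    unfolding deg_rc_def
  proof (rule Least_equality)
    have "right_congruence ?S \<sigma>"
      unfolding right_congruence_def \<sigma>_def TL_mult using L.equiv_hit_rel L.hit_rel_mult by blast
    then show "\<exists>\<sigma>. right_congruence ?S \<sigma> \<and> faithful_rc ?S \<sigma> \<and> card (TL n // \<sigma>) = 1 + card (TL_Q n)"
      using faithful_rc_class_act[OF act] card by blast
  next
    fix k assume "\<exists>\<sigma>. right_congruence ?S \<sigma> \<and> faithful_rc ?S \<sigma> \<and> card (TL n // \<sigma>) = k"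
    then obtain \<tau> where \<tau>: "right_congruence ?S \<tau>" "faithful_rc ?S \<tau>" "card (TL n // \<tau>) = k" by blast
    have "finite (TL n // \<tau>)"
      using \<tau>(1) finite_quotient[OF L.fin] by (simp add: right_congruence_def equiv_def)
    then show "1 + card (TL_Q n) \<le> k"
      using lower[OF right_congruence_action[OF \<tau>(1,2) closed assoc]] \<tau>(3) by simp
  qed
  ultimately show ?thesis by simp
qed

end
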